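(* (i) Let $R$ be a Hopf $F$-algebra and let $T = R[x;\sigma,\delta]$ be a Hopf Ore extension of $R$, so that $\Delta(x)=a\otimes x+x\otimes b+v(x\otimes x)+w$ with $a,b\in R$ and $v,w\in R\otimes R$. Suppose that (H) $S(x)=\alpha x+\beta$ for some $\alpha,\beta\in R$ with $\alpha$ a unit of $R$. Write $w=\sum w_1\otimes w_2\in R\otimes R$, with $\{w_1\}$ and $\{w_2\}$ chosen to be $F$-linearly independent subsets of $R$. Then: (a) $a,b\in G(R)$ and $v=0$. (b) After a change of the variable $x$ and corresponding adjustments to $\sigma$, $\delta$ and $w$, one has $\varepsilon(x)=0$ and $\Delta(x)=a\otimes x+x\otimes 1+w$. Assume from now on in (i) that $\varepsilon(x)=0$ and $\Delta(x)=a\otimes x+x\otimes 1+w$. Then: (c) $S(x)=-a^{-1}\big(x+\sum w_1S(w_2)\big)$. (d) There is a character $\chi:R\to F$ such that, for all $r\in R$, $\sigma(r)=\chi(r_1)r_2=ar_1a^{-1}\chi(r_2)$; that is, $\sigma$ is the left winding automorphism $\tau^{\ell}_{\chi}$ (where $\tau^{\ell}_{\chi}(r)=\chi(r_1)r_2$), and equals the composition $\mathrm{ad}(a)\circ\tau^{r}_{\chi}$ of the right winding automorphism $\tau^r_\chi(r)=r_1\chi(r_2)$ with conjugation $\mathrm{ad}(a)(r)=ara^{-1}$. (e) The $\sigma$-derivation $\delta$ satisfies, for all $r\in R$, $\Delta\delta(r)-\delta(r_1)\otimes r_2-ar_1\otimes\delta(r_2)=w\Delta(r)-\Delta\sigma(r)w$.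 (f) $w\in R^+\otimes R^+$, and $w$ satisfies $\sum S(w_1)w_2=a^{-1}\sum w_1S(w_2)$ and $w\otimes 1+(\Delta\otimes\mathrm{Id})(w)=a\otimes w+(\mathrm{Id}\otimes\Delta)(w)$. (ii) Conversely, let $R$ be a Hopf $F$-algebra, and suppose given $a\in G(R)$, $w=\sum w_1\otimes w_2\in R\otimes R$, an $F$-algebra automorphism $\sigma$ of $R$ and a $\sigma$-derivation $\delta$ of $R$ such that this data satisfies (d), (e) and (f) of (i). Then the skew polynomial algebra $T=R[x;\sigma,\delta]$ admits a structure of Hopf algebra with $R$ as a Hopf subalgebra, in which $\Delta(x)=a\otimes x+x\otimes 1+w$, $\varepsilon(x)=0$ and $S(x)=-a^{-1}\big(x+\sum w_1S(w_2)\big)$ (so that (H), (a), (b) and (c) of (i) hold). As a consequence, $T$ is a Hopf Ore extension of $R$.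
   Context: $F$ is an arbitrary field; Hopf algebras are assumed to have bijective antipode; Sweedler notation $\Delta(h)=h_1\otimes h_2$ is used; $G(R)$ denotes the group-like elements of $R$ and $R^+$ the augmentation ideal. For an $F$-algebra automorphism $\sigma$ of $R$, a (left) $\sigma$-derivation $\delta$ is an $F$-linear map with $\delta(ab)=\delta(a)b+\sigma(a)\delta(b)$; the skew polynomial algebra $T=R[x;\sigma,\delta]$ is generated by $R$ and $x$ subject to $xr-\sigma(r)x=\delta(r)$ for all $r\in R$. A Hopf Ore extension (HOE) of a Hopf $F$-algebra $R$ is a Hopf $F$-algebra $T$ having $R$ as a Hopf subalgebra, such that $T=R[x;\sigma,\delta]$ for some automorphism $\sigma$ and $\sigma$-derivation $\delta$ of $R$, and such that $\Delta(x)=a\otimes x+x\otimes b+v(x\otimes x)+w$ for some $a,b\in R$ and $v,w\in R\otimes R$. *)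

theory Defs
  imports Main
begin

text \<open>
Conventions.  All algebras live inside one ambient ring type 't::ring_1; an F-algebra is a
subset A of 't closed under the ring operations, together with a unital ring homomorphism
iota : 'f => 't (F = the field type 'f) whose image lies in A and is central in A; the scalar
action is c.y = iota c * y.  Elements of A (x) A are represented by finite lists of pairs
[(u1,v1),...] standing for the sum u1 (x) v1 + ...; two lists are equal as tensors iff every
F-bilinear form on A takes the same value on them (this is equality in the tensor product
A (x)_F A, whose dual is the space of bilinear forms).  Same for triple tensors.
\<close>

definition scalars :: "('f::field \<Rightarrow> 't::ring_1) \<Rightarrow> bool" where
  "scalars \<iota> \<longleftrightarrow> \<iota> 1 = 1 \<and> (\<forall>c d. \<iota> (c + d) = \<iota> c + \<iota> d \<and> \<iota> (c * d) = \<iota> c * \<iota> d)"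

definition falg :: "('f::field \<Rightarrow> 't::ring_1) \<Rightarrow> 't set \<Rightarrow> bool" where
  "falg \<iota> A \<longleftrightarrow> scalars \<iota> \<and> range \<iota> \<subseteq> A \<and> 0 \<in> A \<and> 1 \<in> A \<and>
     (\<forall>x\<in>A. \<forall>y\<in>A. x + y \<in> A \<and> x * y \<in> A) \<and> (\<forall>x\<in>A. - x \<in> A) \<and>
     (\<forall>c. \<forall>y\<in>A. \<iota> c * y = y * \<iota> c)"

definition bilin :: "('f::field \<Rightarrow> 't::ring_1) \<Rightarrow> 't set \<Rightarrow> ('t \<Rightarrow> 't \<Rightarrow> 'f) \<Rightarrow> bool" where
  "bilin \<iota> A \<beta> \<longleftrightarrow>
     (\<forall>x\<in>A. \<forall>x'\<in>A. \<forall>y\<in>A. \<beta> (x + x') y = \<beta> x y + \<beta> x' y \<and> \<beta> y (x + x') = \<beta> y x + \<beta> y x') \<and>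
     (\<forall>c. \<forall>x\<in>A. \<forall>y\<in>A. \<beta> (\<iota> c * x) y = c * \<beta> x y \<and> \<beta> y (\<iota> c * x) = c * \<beta> y x)"

definition trilin :: "('f::field \<Rightarrow> 't::ring_1) \<Rightarrow> 't set \<Rightarrow> ('t \<Rightarrow> 't \<Rightarrow> 't \<Rightarrow> 'f) \<Rightarrow> bool" where
  "trilin \<iota> A \<gamma> \<longleftrightarrow>
     (\<forall>x\<in>A. \<forall>x'\<in>A. \<forall>y\<in>A. \<forall>z\<in>A.
        \<gamma> (x + x') y z = \<gamma> x y z + \<gamma> x' y z \<and>
        \<gamma> y (x + x') z = \<gamma> y x z + \<gamma> y x' z \<and>
        \<gamma> y z (x + x') = \<gamma> y z x + \<gamma> y z x') \<and>
     (\<forall>c. \<forall>x\<in>A. \<forall>y\<in>A. \<forall>z\<in>A.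
        \<gamma> (\<iota> c * x) y z = c * \<gamma> x y z \<and> \<gamma> y (\<iota> c * x) z = c * \<gamma> y x z \<and>
        \<gamma> y z (\<iota> c * x) = c * \<gamma> y z x)"

definition tsum :: "('t \<Rightarrow> 't \<Rightarrow> 'b::comm_monoid_add) \<Rightarrow> ('t \<times> 't) list \<Rightarrow> 'b" where
  "tsum f ts = sum_list (map (\<lambda>(u, v). f u v) ts)"

definition tsum3 :: "('t \<Rightarrow> 't \<Rightarrow> 't \<Rightarrow> 'b::comm_monoid_add) \<Rightarrow> ('t \<times> 't \<times> 't) list \<Rightarrow> 'b" where
  "tsum3 f ts = sum_list (map (\<lambda>(u, v, z). f u v z) ts)"

definition teq :: "('f::field \<Rightarrow> 't::ring_1) \<Rightarrow> 't set \<Rightarrow> ('t \<times> 't) list \<Rightarrow> ('t \<times> 't) list \<Rightarrow> bool" where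
  "teq \<iota> A ts us \<longleftrightarrow> (\<forall>\<beta>. bilin \<iota> A \<beta> \<longrightarrow> tsum \<beta> ts = tsum \<beta> us)"

definition teq3 :: "('f::field \<Rightarrow> 't::ring_1) \<Rightarrow> 't set \<Rightarrow> ('t \<times> 't \<times> 't) list \<Rightarrow> ('t \<times> 't \<times> 't) list \<Rightarrow> bool" where
  "teq3 \<iota> A ts us \<longleftrightarrow> (\<forall>\<gamma>. trilin \<iota> A \<gamma> \<longrightarrow> tsum3 \<gamma> ts = tsum3 \<gamma> us)"

definition tmul :: "('t::ring_1 \<times> 't) list \<Rightarrow> ('t \<times> 't) list \<Rightarrow> ('t \<times> 't) list" where
  "tmul ts us = concat (map (\<lambda>(u, v). map (\<lambda>(u', v'). (u * u', v * v')) us) ts)"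

definition tneg :: "('t::ring_1 \<times> 't) list \<Rightarrow> ('t \<times> 't) list" where
  "tneg ts = map (\<lambda>(u, v). (- u, v)) ts"

definition tscale :: "'t::ring_1 \<Rightarrow> ('t \<times> 't) list \<Rightarrow> ('t \<times> 't) list" where
  "tscale k ts = map (\<lambda>(u, v). (k * u, v)) ts"

definition DeltaId :: "('t \<Rightarrow> ('t \<times> 't) list) \<Rightarrow> ('t \<times> 't) list \<Rightarrow> ('t \<times> 't \<times> 't) list" where
  "DeltaId \<Delta> ts = concat (map (\<lambda>(u, v). map (\<lambda>(p, q). (p, q, v)) (\<Delta> u)) ts)"

definition IdDelta :: "('t \<Rightarrow> ('t \<times> 't) list) \<Rightarrow> ('t \<times> 't) list \<Rightarrow> ('t \<times> 't \<times> 't) list" where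
  "IdDelta \<Delta> ts = concat (map (\<lambda>(u, v). map (\<lambda>(p, q). (u, p, q)) (\<Delta> v)) ts)"

definition hopf :: "('f::field \<Rightarrow> 't::ring_1) \<Rightarrow> 't set \<Rightarrow> ('t \<Rightarrow> ('t \<times> 't) list) \<Rightarrow>
    ('t \<Rightarrow> 'f) \<Rightarrow> ('t \<Rightarrow> 't) \<Rightarrow> bool" where
  "hopf \<iota> A \<Delta> \<epsilon> S \<longleftrightarrow> falg \<iota> A \<and>
     (\<forall>x\<in>A. set (\<Delta> x) \<subseteq> A \<times> A) \<and>
     (\<forall>x\<in>A. \<forall>y\<in>A. teq \<iota> A (\<Delta> (x + y)) (\<Delta> x @ \<Delta> y)) \<and>
     (\<forall>c. \<forall>x\<in>A. teq \<iota> A (\<Delta> (\<iota> c * x)) (tscale (\<iota> c) (\<Delta> x))) \<and>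
     (\<forall>x\<in>A. \<forall>y\<in>A. teq \<iota> A (\<Delta> (x * y)) (tmul (\<Delta> x) (\<Delta> y))) \<and>
     teq \<iota> A (\<Delta> 1) [(1, 1)] \<and>
     (\<forall>x\<in>A. teq3 \<iota> A (DeltaId \<Delta> (\<Delta> x)) (IdDelta \<Delta> (\<Delta> x))) \<and>
     (\<forall>x\<in>A. \<forall>y\<in>A. \<epsilon> (x + y) = \<epsilon> x + \<epsilon> y \<and> \<epsilon> (x * y) = \<epsilon> x * \<epsilon> y) \<and>
     (\<forall>c. \<forall>x\<in>A. \<epsilon> (\<iota> c * x) = c * \<epsilon> x) \<and> \<epsilon> 1 = 1 \<and>
     (\<forall>x\<in>A. tsum (\<lambda>u v. \<iota> (\<epsilon> u) * v) (\<Delta> x) = x \<and> tsum (\<lambda>u v. u * \<iota> (\<epsilon> v)) (\<Delta> x) = x) \<and>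
     bij_betw S A A \<and>
     (\<forall>x\<in>A. \<forall>y\<in>A. S (x + y) = S x + S y) \<and> (\<forall>c. \<forall>x\<in>A. S (\<iota> c * x) = \<iota> c * S x) \<and>
     (\<forall>x\<in>A. tsum (\<lambda>u v. S u * v) (\<Delta> x) = \<iota> (\<epsilon> x) \<and> tsum (\<lambda>u v. u * S v) (\<Delta> x) = \<iota> (\<epsilon> x))"

definition grouplike :: "('f::field \<Rightarrow> 't::ring_1) \<Rightarrow> 't set \<Rightarrow> ('t \<Rightarrow> ('t \<times> 't) list) \<Rightarrow> 't \<Rightarrow> bool" where
  "grouplike \<iota> A \<Delta> g \<longleftrightarrow> g \<in> A \<and> g \<noteq> 0 \<and> teq \<iota> A (\<Delta> g) [(g, g)]"

definition augideal :: "'t set \<Rightarrow> ('t \<Rightarrow> 'f::zero) \<Rightarrow> 't set" where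
  "augideal A \<epsilon> = {r \<in> A. \<epsilon> r = 0}"

definition is_unit_in :: "'t set \<Rightarrow> 't::ring_1 \<Rightarrow> bool" where
  "is_unit_in A a \<longleftrightarrow> a \<in> A \<and> (\<exists>b\<in>A. a * b = 1 \<and> b * a = 1)"

definition uinv :: "'t set \<Rightarrow> 't::ring_1 \<Rightarrow> 't" where
  "uinv A a = (THE b. b \<in> A \<and> a * b = 1 \<and> b * a = 1)"

definition character :: "('f::field \<Rightarrow> 't::ring_1) \<Rightarrow> 't set \<Rightarrow> ('t \<Rightarrow> 'f) \<Rightarrow> bool" where
  "character \<iota> A \<chi> \<longleftrightarrow> (\<forall>x\<in>A. \<forall>y\<in>A. \<chi> (x + y) = \<chi> x + \<chi> y \<and> \<chi> (x * y) = \<chi> x * \<chi> y) \<and>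
     (\<forall>c. \<forall>x\<in>A. \<chi> (\<iota> c * x) = c * \<chi> x) \<and> \<chi> 1 = 1"

definition alg_aut :: "('f::field \<Rightarrow> 't::ring_1) \<Rightarrow> 't set \<Rightarrow> ('t \<Rightarrow> 't) \<Rightarrow> bool" where
  "alg_aut \<iota> A \<sigma> \<longleftrightarrow> bij_betw \<sigma> A A \<and>
     (\<forall>x\<in>A. \<forall>y\<in>A. \<sigma> (x + y) = \<sigma> x + \<sigma> y \<and> \<sigma> (x * y) = \<sigma> x * \<sigma> y) \<and>
     (\<forall>c. \<forall>x\<in>A. \<sigma> (\<iota> c * x) = \<iota> c * \<sigma> x) \<and> \<sigma> 1 = 1"

definition sigma_deriv :: "('f::field \<Rightarrow> 't::ring_1) \<Rightarrow> 't set \<Rightarrow> ('t \<Rightarrow> 't) \<Rightarrow> ('t \<Rightarrow> 't) \<Rightarrow> bool" where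
  "sigma_deriv \<iota> A \<sigma> \<delta> \<longleftrightarrow> (\<forall>x\<in>A. \<delta> x \<in> A) \<and>
     (\<forall>x\<in>A. \<forall>y\<in>A. \<delta> (x + y) = \<delta> x + \<delta> y \<and> \<delta> (x * y) = \<delta> x * y + \<sigma> x * \<delta> y) \<and>
     (\<forall>c. \<forall>x\<in>A. \<delta> (\<iota> c * x) = \<iota> c * \<delta> x)"

definition ore_ext :: "('f::field \<Rightarrow> 't::ring_1) \<Rightarrow> 't set \<Rightarrow> 't set \<Rightarrow> 't \<Rightarrow> ('t \<Rightarrow> 't) \<Rightarrow> ('t \<Rightarrow> 't) \<Rightarrow> bool" where
  "ore_ext \<iota> R T x \<sigma> \<delta> \<longleftrightarrow> falg \<iota> R \<and> falg \<iota> T \<and> R \<subseteq> T \<and> x \<in> T \<and>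
     alg_aut \<iota> R \<sigma> \<and> sigma_deriv \<iota> R \<sigma> \<delta> \<and>
     (\<forall>r\<in>R. x * r - \<sigma> r * x = \<delta> r) \<and>
     T = {(\<Sum>i<n. c i * x ^ i) | n c. \<forall>i<n. c i \<in> R} \<and>
     (\<forall>n c. (\<forall>i<n. c i \<in> R) \<and> (\<Sum>i<n. c i * x ^ i) = 0 \<longrightarrow> (\<forall>i<n. c i = 0))"

definition hoe :: "('f::field \<Rightarrow> 't::ring_1) \<Rightarrow> 't set \<Rightarrow> ('t \<Rightarrow> ('t \<times> 't) list) \<Rightarrow> ('t \<Rightarrow> 'f) \<Rightarrow> ('t \<Rightarrow> 't) \<Rightarrow>
    't set \<Rightarrow> ('t \<Rightarrow> ('t \<times> 't) list) \<Rightarrow> ('t \<Rightarrow> 'f) \<Rightarrow> ('t \<Rightarrow> 't) \<Rightarrow>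
    't \<Rightarrow> ('t \<Rightarrow> 't) \<Rightarrow> ('t \<Rightarrow> 't) \<Rightarrow> 't \<Rightarrow> 't \<Rightarrow> ('t \<times> 't) list \<Rightarrow> ('t \<times> 't) list \<Rightarrow> bool" where
  "hoe \<iota> R \<Delta>R \<epsilon>R SR T \<Delta> \<epsilon> S x \<sigma> \<delta> a b v w \<longleftrightarrow>
     hopf \<iota> R \<Delta>R \<epsilon>R SR \<and> hopf \<iota> T \<Delta> \<epsilon> S \<and> R \<subseteq> T \<and>
     (\<forall>r\<in>R. teq \<iota> T (\<Delta> r) (\<Delta>R r) \<and> \<epsilon> r = \<epsilon>R r \<and> S r = SR r) \<and>
     ore_ext \<iota> R T x \<sigma> \<delta> \<and>
     a \<in> R \<and> b \<in> R \<and> set v \<subseteq> R \<times> R \<and> set w \<subseteq> R \<times> R \<and>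
     teq \<iota> T (\<Delta> x) ([(a, x), (x, b)] @ tmul v [(x, x)] @ w)"

end

theory Submission
  imports Defs "HOL.Vector_Spaces"
begin

text \<open>
Since \<open>T\<close> is free over \<open>R\<close> on the powers of \<open>x\<close>, every identity in \<open>T \<otimes> T\<close> or
\<open>T \<otimes> T \<otimes> T\<close> can be read off coefficient by coefficient.  Applied to coassociativity at \<open>x\<close>
this gives the necessary conditions on \<open>a\<close>, \<open>b\<close>, \<open>v\<close>, \<open>w\<close>; the antipode axiom at \<open>x\<close> gives
\<open>\<Sum> S(v\<^sub>1) v\<^sub>2 = 0\<close> and \<open>S(a) = - \<alpha> \<sigma>(b)\<close>.  Hence \<open>\<epsilon>(a) = \<epsilon>(b) = 1\<close>, then \<open>S(a) a = S(b) b = 1\<close>,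
so \<open>a\<close> and \<open>b\<close> are units; now \<open>v = v' \<otimes> 1\<close> with \<open>S(v') = 0\<close>, whence \<open>v = 0\<close>.
Coefficients of \<open>\<Delta>(x r) = \<Delta>(\<sigma>(r) x + \<delta>(r))\<close> give (d), with \<open>\<chi> = \<epsilon> \<circ> \<sigma>\<close>, and (e).

Conversely, (d) and (e) say that \<open>a \<otimes> x + x \<otimes> 1 + w\<close> satisfies the defining relation of \<open>T\<close> over
\<open>\<Delta>(R)\<close>, so \<open>\<Delta>\<close> extends to an algebra map; the Hopf axioms need only be checked on \<open>R\<close> and \<open>x\<close>.
The antipode extends to an anti-homomorphism because the defect
\<open>D(r) = S(r) S(x) - S(x) S(\<sigma>(r)) - S(\<delta>(r))\<close> satisfies \<open>\<Sum> r\<^sub>1 D(r\<^sub>2) = 0\<close>.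
\<close>

section \<open>Sums over lists of pure tensors\<close>

text \<open>In part (i) the obstacle is that inverses are at first only one-sided and that
  \<open>a\<close>, \<open>b\<close> cannot be seen to be group-like at once: in the coefficients of
  coassociativity at 1\<otimes>1\<otimes>x and x\<otimes>1\<otimes>1, \<open>v\<close> occurs
  multiplied with \<open>w\<close>. Applying the antipode law to the two legs produced by a
  coproduct and the counit to the remaining leg turns these terms into multiples of \<Sum>
  \<epsilon>(v1) \<epsilon>(v2), already known to vanish. So S(a) a = S(b) b = 1 comes before v = 0,
  and group-likeness only after it. The step from S(v') = 0 to v' = 0 uses that the antipode of
  \<open>R\<close> is injective.

  In part (ii) the Ore extension is given by its basis and not by a universal property. The
  coproduct and the antipode are therefore written down on the monomials r x^i, and multiplicativity
  of one and antimultiplicativity of the other are theorems. Bijectivity is part of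
  \<open>hopf\<close>, so it too must be carried over from \<open>R\<close> to \<open>T\<close>.

  Throughout, a tensor identity is an equation \<open>tsum B ts = tsum B us\<close> for every form
  \<open>B\<close>, and a proof consists in choosing the form.\<close>

lemma tsum_simps [simp]:
  "tsum f [] = 0"
  "tsum f ((u, v) # ts) = f u v + tsum f ts"
  "tsum f (ts @ us) = tsum f ts + tsum f us"
  by (simp_all add: tsum_def)

lemma tsum3_simps [simp]:
  "tsum3 g [] = 0"
  "tsum3 g ((u, v, z) # us) = g u v z + tsum3 g us"
  "tsum3 g (us @ us') = tsum3 g us + tsum3 g us'"
  by (simp_all add: tsum3_def)

lemma tsum_map [simp]:
  "tsum f (map (\<lambda>(u, v). (g u v, h u v)) ts) = tsum (\<lambda>u v. f (g u v) (h u v)) ts"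
  by (induction ts) auto

lemma tsum3_map [simp]:
  "tsum3 f (map (\<lambda>(u, v). (g u v, h u v, k u v)) ts) = tsum (\<lambda>u v. f (g u v) (h u v) (k u v)) ts"
  by (induction ts) auto

lemma tsum_tneg [simp]: "tsum f (tneg ts) = tsum (\<lambda>u v. f (- u) v) ts"
  unfolding tneg_def by (rule tsum_map)

lemma tsum_tscale [simp]: "tsum f (tscale k ts) = tsum (\<lambda>u v. f (k * u) v) ts"
  unfolding tscale_def by (rule tsum_map)

lemma tsum_tmul [simp]:
  "tsum f (tmul ts us) = tsum (\<lambda>u v. tsum (\<lambda>u' v'. f (u * u') (v * v')) us) ts"
  by (induction ts) (auto simp: tmul_def)

lemma tsum3_DeltaId [simp]:
  "tsum3 f (DeltaId \<Delta> ts) = tsum (\<lambda>u v. tsum (\<lambda>p q. f p q v) (\<Delta> u)) ts"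
  by (induction ts) (auto simp: DeltaId_def)

lemma tsum3_map_Pair [simp]: "tsum3 f (map (Pair u) ts) = tsum (f u) ts"
  by (induction ts) auto

lemma tsum3_IdDelta [simp]:
  "tsum3 f (IdDelta \<Delta> ts) = tsum (\<lambda>u v. tsum (\<lambda>p q. f u p q) (\<Delta> v)) ts"
  by (induction ts) (auto simp: IdDelta_def)

lemma tsum_zero [simp]: "tsum (\<lambda>u v. 0) ts = 0"
  by (induction ts) auto

lemma tsum_add: "tsum (\<lambda>u v. f u v + g u v) ts = tsum f ts + tsum g ts"
  by (induction ts) (auto simp: add_ac)

lemma tsum_neg: "tsum (\<lambda>u v. - f u v) ts = - tsum f (ts :: ('a \<times> 'a) list)" for f :: "_ \<Rightarrow> _ \<Rightarrow> 'b::ab_group_add"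
  by (induction ts) auto

lemma tsum_diff: "tsum (\<lambda>u v. f u v - g u v) ts = tsum f ts - tsum g ts" for f :: "_ \<Rightarrow> _ \<Rightarrow> 'b::ab_group_add"
  by (induction ts) auto

lemma tsum_mult_left: "tsum (\<lambda>u v. k * f u v) ts = k * tsum f ts" for k :: "'b::ring"
  by (induction ts) (auto simp: distrib_left)

lemma tsum_mult_right: "tsum (\<lambda>u v. f u v * k) ts = tsum f ts * k" for k :: "'b::ring"
  by (induction ts) (auto simp: distrib_right)

lemma tsum_swap:
  "tsum (\<lambda>u v. tsum (\<lambda>p q. f u v p q) us) ts = tsum (\<lambda>p q. tsum (\<lambda>u v. f u v p q) ts) us"
  by (induction ts) (auto simp: tsum_add)

lemma tsum_cong:
  assumes "set ts \<subseteq> A \<times> B" "\<And>u v. u \<in> A \<Longrightarrow> v \<in> B \<Longrightarrow> f u v = g u v"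
  shows "tsum f ts = tsum g ts"
  using assms by (induction ts) auto

text \<open>Serves as a congruence rule: rewriting under the sum may then use that the legs come
  from a list with entries in \<open>R\<close>.\<close>

lemma tsum_cong_set:
  assumes "ts = us" "\<And>u v. (u, v) \<in> set us \<Longrightarrow> f u v = g u v"
  shows "tsum f ts = tsum g us"
  unfolding assms(1) using assms(2) by (induction us) auto

lemma set_tmul: "set ts \<subseteq> A \<times> A \<Longrightarrow> set us \<subseteq> A \<times> A \<Longrightarrow> (\<And>x y. x \<in> A \<Longrightarrow> y \<in> A \<Longrightarrow> x * y \<in> A)
   \<Longrightarrow> set (tmul ts us) \<subseteq> A \<times> A"
  by (auto simp: tmul_def)

section \<open>Linear and multilinear maps\<close>

text \<open>Tensors are tested against multilinear maps with values in the ambient ring instead of the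
  field: the scalar embedding turns forms into such maps, and conversely linear functionals
  separate points.\<close>

definition lin :: "('f::field \<Rightarrow> 't::ring_1) \<Rightarrow> 't set \<Rightarrow> ('t \<Rightarrow> 't) \<Rightarrow> bool" where
  "lin \<iota> A f \<longleftrightarrow> (\<forall>x\<in>A. \<forall>y\<in>A. f (x + y) = f x + f y) \<and> (\<forall>c. \<forall>x\<in>A. f (\<iota> c * x) = \<iota> c * f x)"

definition bil :: "('f::field \<Rightarrow> 't::ring_1) \<Rightarrow> 't set \<Rightarrow> ('t \<Rightarrow> 't \<Rightarrow> 't) \<Rightarrow> bool" where
  "bil \<iota> A B \<longleftrightarrow> (\<forall>y\<in>A. lin \<iota> A (\<lambda>x. B x y)) \<and> (\<forall>x\<in>A. lin \<iota> A (\<lambda>y. B x y))"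

definition tri :: "('f::field \<Rightarrow> 't::ring_1) \<Rightarrow> 't set \<Rightarrow> ('t \<Rightarrow> 't \<Rightarrow> 't \<Rightarrow> 't) \<Rightarrow> bool" where
  "tri \<iota> A C \<longleftrightarrow> (\<forall>y\<in>A. \<forall>z\<in>A. lin \<iota> A (\<lambda>x. C x y z)) \<and> (\<forall>x\<in>A. \<forall>z\<in>A. lin \<iota> A (\<lambda>y. C x y z)) \<and>
     (\<forall>x\<in>A. \<forall>y\<in>A. lin \<iota> A (\<lambda>z. C x y z))"

lemma bilI: "(\<And>y. y \<in> A \<Longrightarrow> lin \<iota> A (\<lambda>x. B x y)) \<Longrightarrow> (\<And>x. x \<in> A \<Longrightarrow> lin \<iota> A (\<lambda>y. B x y)) \<Longrightarrow> bil \<iota> A B"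
  by (simp add: bil_def)

lemma triI: "(\<And>y z. y \<in> A \<Longrightarrow> z \<in> A \<Longrightarrow> lin \<iota> A (\<lambda>x. C x y z)) \<Longrightarrow>
   (\<And>x z. x \<in> A \<Longrightarrow> z \<in> A \<Longrightarrow> lin \<iota> A (\<lambda>y. C x y z)) \<Longrightarrow>
   (\<And>x y. x \<in> A \<Longrightarrow> y \<in> A \<Longrightarrow> lin \<iota> A (\<lambda>z. C x y z)) \<Longrightarrow> tri \<iota> A C"
  by (simp add: tri_def)

named_theorems lin_intros

lemma lin_id [lin_intros]: "lin \<iota> A (\<lambda>x. x)"
  by (simp add: lin_def)

lemma lin_add [lin_intros]: "lin \<iota> A f \<Longrightarrow> lin \<iota> A g \<Longrightarrow> lin \<iota> A (\<lambda>x. f x + g x)"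
  by (simp add: lin_def algebra_simps)

lemma lin_diff [lin_intros]: "lin \<iota> A f \<Longrightarrow> lin \<iota> A g \<Longrightarrow> lin \<iota> A (\<lambda>x. f x - g x)"
  by (simp add: lin_def algebra_simps)

lemma lin_mult_right [lin_intros]: "lin \<iota> A f \<Longrightarrow> lin \<iota> A (\<lambda>x. f x * k)"
  by (simp add: lin_def algebra_simps)

lemma lin_tsum:
  assumes "set ts \<subseteq> B \<times> C" "\<And>u v. u \<in> B \<Longrightarrow> v \<in> C \<Longrightarrow> lin \<iota> A (\<lambda>x. G x u v)"
  shows "lin \<iota> A (\<lambda>x. tsum (\<lambda>u v. G x u v) ts)"
  using assms(1)
proof (induction ts)
  case Nil
  then show ?case by (simp add: lin_def)
next
  case (Cons p ts)
  then show ?case by (cases p) (simp add: lin_add assms(2))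
qed

lemma lin_comp:
  "lin \<iota> B f \<Longrightarrow> lin \<iota> A g \<Longrightarrow> (\<And>x. x \<in> A \<Longrightarrow> g x \<in> B) \<Longrightarrow> lin \<iota> A (\<lambda>x. f (g x))"
  by (simp add: lin_def)

lemma lin_bil1: "bil \<iota> B f \<Longrightarrow> lin \<iota> A g \<Longrightarrow> (\<And>x. x \<in> A \<Longrightarrow> g x \<in> B) \<Longrightarrow> y \<in> B \<Longrightarrow> lin \<iota> A (\<lambda>x. f (g x) y)"
  by (auto simp: bil_def intro: lin_comp[of \<iota> B "\<lambda>x. f x y"])

lemma lin_bil2: "bil \<iota> B f \<Longrightarrow> lin \<iota> A g \<Longrightarrow> (\<And>x. x \<in> A \<Longrightarrow> g x \<in> B) \<Longrightarrow> y \<in> B \<Longrightarrow> lin \<iota> A (\<lambda>x. f y (g x))"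
  by (auto simp: bil_def intro: lin_comp[of \<iota> B "\<lambda>x. f y x"])

lemma lin_tri1: "tri \<iota> B f \<Longrightarrow> lin \<iota> A g \<Longrightarrow> (\<And>x. x \<in> A \<Longrightarrow> g x \<in> B) \<Longrightarrow> y \<in> B \<Longrightarrow> z \<in> B \<Longrightarrow>
  lin \<iota> A (\<lambda>x. f (g x) y z)"
  by (auto simp: tri_def intro: lin_comp[of \<iota> B "\<lambda>x. f x y z"])

lemma lin_tri2: "tri \<iota> B f \<Longrightarrow> lin \<iota> A g \<Longrightarrow> (\<And>x. x \<in> A \<Longrightarrow> g x \<in> B) \<Longrightarrow> y \<in> B \<Longrightarrow> z \<in> B \<Longrightarrow>
  lin \<iota> A (\<lambda>x. f y (g x) z)"
  by (auto simp: tri_def intro: lin_comp[of \<iota> B "\<lambda>x. f y x z"])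

lemma lin_tri3: "tri \<iota> B f \<Longrightarrow> lin \<iota> A g \<Longrightarrow> (\<And>x. x \<in> A \<Longrightarrow> g x \<in> B) \<Longrightarrow> y \<in> B \<Longrightarrow> z \<in> B \<Longrightarrow>
  lin \<iota> A (\<lambda>x. f y z (g x))"
  by (auto simp: tri_def intro: lin_comp[of \<iota> B "\<lambda>x. f y z x"])

lemma lin_mono: "lin \<iota> A f \<Longrightarrow> B \<subseteq> A \<Longrightarrow> lin \<iota> B f"
  unfolding lin_def by blast

text \<open>A form on the larger algebra restricts to the smaller one, so tensor identities over
  \<open>R\<close> persist over \<open>T\<close>.\<close>

lemma bil_mono: "bil \<iota> A f \<Longrightarrow> B \<subseteq> A \<Longrightarrow> bil \<iota> B f"
  unfolding bil_def by (meson lin_mono subsetD)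

lemma tri_mono: "tri \<iota> A f \<Longrightarrow> B \<subseteq> A \<Longrightarrow> tri \<iota> B f"
  unfolding tri_def by (meson lin_mono subsetD)

locale falgebra =
  fixes \<iota> :: "'f::field \<Rightarrow> 't::ring_1" and A :: "'t set"
  assumes falg: "falg \<iota> A"
begin

lemma iota_hom [simp]: "\<iota> 1 = 1" "\<iota> (c + d) = \<iota> c + \<iota> d" "\<iota> (c * d) = \<iota> c * \<iota> d"
  using falg by (auto simp: falg_def scalars_def)

lemma closed [simp, intro]: "0 \<in> A" "1 \<in> A" "\<iota> c \<in> A"
  "x \<in> A \<Longrightarrow> y \<in> A \<Longrightarrow> x + y \<in> A" "x \<in> A \<Longrightarrow> y \<in> A \<Longrightarrow> x * y \<in> A" "x \<in> A \<Longrightarrow> - x \<in> A"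
  using falg by (auto simp: falg_def)

lemma closed_diff [simp, intro]: "x \<in> A \<Longrightarrow> y \<in> A \<Longrightarrow> x - y \<in> A"
  using closed(4)[of x "- y"] by simp

lemma closed_power [simp, intro]: "x \<in> A \<Longrightarrow> x ^ n \<in> A"
  by (induction n) auto

lemma closed_sum [simp, intro]: "(\<And>i. i \<in> I \<Longrightarrow> f i \<in> A) \<Longrightarrow> sum f I \<in> A"
  by (induction I rule: infinite_finite_induct) auto

lemma closed_tsum [intro]:
  "set ts \<subseteq> B \<times> C \<Longrightarrow> (\<And>u v. u \<in> B \<Longrightarrow> v \<in> C \<Longrightarrow> f u v \<in> A) \<Longrightarrow> tsum f ts \<in> A"
  by (induction ts) auto

lemma central: "y \<in> A \<Longrightarrow> y * \<iota> c = \<iota> c * y"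
  using falg by (auto simp: falg_def)

lemma iota_0 [simp]: "\<iota> 0 = 0"
  using iota_hom(2)[of 0 0] by simp

lemma iota_minus [simp]: "\<iota> (- c) = - \<iota> c"
  using iota_hom(2)[of c "- c"] by (simp add: eq_neg_iff_add_eq_0 add.commute)

lemma iota_diff [simp]: "\<iota> (c - d) = \<iota> c - \<iota> d"
  using iota_hom(2)[of c "- d"] by simp

lemma iota_tsum: "\<iota> (tsum f ts) = tsum (\<lambda>u v. \<iota> (f u v)) ts"
  by (induction ts) auto

lemma iota_tsum3: "\<iota> (tsum3 f ts) = tsum3 (\<lambda>u v z. \<iota> (f u v z)) ts"
  by (induction ts) auto

lemma iota_mult_eq_0: "\<iota> c * y = 0 \<longleftrightarrow> c = 0 \<or> y = 0"
proof
  assume *: "\<iota> c * y = 0"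
  have "y = \<iota> (inverse c * c) * y" if "c \<noteq> 0" using that by simp
  also have "\<dots> = \<iota> (inverse c) * (\<iota> c * y)" by (simp add: mult.assoc)
  finally show "c = 0 \<or> y = 0" using * by auto
qed auto

lemma iota_inj: "\<iota> c = \<iota> d \<longleftrightarrow> c = d"
  using iota_mult_eq_0[of "c - d" 1] by auto

text \<open>Scalars have to pass \<open>k\<close>, and they are central only in \<open>A\<close>;
  this explains the premise on \<open>k\<close> and why the rule is supplied separately for
  \<open>R\<close> and for \<open>T\<close>.\<close>

lemma lin_mult_left:
  "k \<in> A \<Longrightarrow> lin \<iota> B f \<Longrightarrow> lin \<iota> B (\<lambda>x. k * f x)"
  unfolding lin_def by (metis central distrib_left mult.assoc)

lemma vector_space: "vector_space (\<lambda>c y. \<iota> c * y)"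
  by unfold_locales (auto simp: algebra_simps)

text \<open>The whole ambient type is a vector space under \<open>\<iota> c * y\<close>. If
  \<open>y - z\<close> is nonzero, then \<open>{y - z}\<close> is independent, and a functional with
  value 1 on it separates \<open>y\<close> from \<open>z\<close>.\<close>

lemma eqI_functional:
  assumes "\<And>\<phi> :: 't \<Rightarrow> 'f. (\<And>x y. \<phi> (x + y) = \<phi> x + \<phi> y) \<Longrightarrow> (\<And>c x. \<phi> (\<iota> c * x) = c * \<phi> x) \<Longrightarrow> \<phi> y = \<phi> z"
  shows "y = z"
proof (rule ccontr)
  assume "y \<noteq> z"
  interpret p: vector_space_pair "\<lambda>c y. \<iota> c * y" "\<lambda>c (d::'f). c * d"
    using vector_space unfolding vector_space_pair_def
    by (auto simp: vector_space_def algebra_simps)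
  have "p.vs1.independent {y - z}"
    using \<open>y \<noteq> z\<close> by (simp add: p.vs1.dependent_single)
  from p.linear_independent_extend[OF this, of "\<lambda>_. 1"]
  obtain \<phi> where \<phi>: "Vector_Spaces.linear (\<lambda>c y. \<iota> c * y) (\<lambda>c d. c * d) \<phi>" "\<phi> (y - z) = 1" by auto
  from \<phi>(1) have "\<phi> y = \<phi> z"
    using assms[of \<phi>] by (simp add: linear_iff_module_hom module_hom_iff)
  moreover have "\<phi> ((y - z) + z) = \<phi> (y - z) + \<phi> z"
    using \<phi>(1) unfolding linear_iff_module_hom module_hom_iff by blast
  ultimately show False using \<phi>(2) by simp
qed

text \<open>Ring-valued forms include products such as \<open>S u * v\<close>, so the antipode and
  counit laws become evaluations of tensors like any other.\<close>

lemma teq_iff_bil: "teq \<iota> A ts us \<longleftrightarrow> (\<forall>B. bil \<iota> A B \<longrightarrow> tsum B ts = tsum B us)"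
proof (intro iffI allI impI)
  fix B assume teq: "teq \<iota> A ts us" and B: "bil \<iota> A B"
  show "tsum B ts = tsum B us"
  proof (rule eqI_functional)
    fix \<phi> :: "'t \<Rightarrow> 'f"
    assume add: "\<And>x y. \<phi> (x + y) = \<phi> x + \<phi> y" and sc: "\<And>c x. \<phi> (\<iota> c * x) = c * \<phi> x"
    have 0: "\<phi> 0 = 0" using sc[of 0] by simp
    have sum: "\<phi> (tsum B rs) = tsum (\<lambda>u v. \<phi> (B u v)) rs" for rs
      by (induction rs) (auto simp: 0 add)
    have "bilin \<iota> A (\<lambda>u v. \<phi> (B u v))"
      using B by (auto simp: bilin_def bil_def lin_def add sc)
    then show "\<phi> (tsum B ts) = \<phi> (tsum B us)"
      using teq by (auto simp: teq_def sum)
  qed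
next
  assume *: "\<forall>B. bil \<iota> A B \<longrightarrow> tsum B ts = tsum B us"
  show "teq \<iota> A ts us"
    unfolding teq_def
  proof (intro allI impI)
    fix \<beta> assume "bilin \<iota> A \<beta>"
    then have "bil \<iota> A (\<lambda>u v. \<iota> (\<beta> u v))"
      by (auto simp: bilin_def bil_def lin_def)
    then show "tsum \<beta> ts = tsum \<beta> us"
      using * by (metis iota_inj iota_tsum)
  qed
qed

lemma teq3_iff_tri: "teq3 \<iota> A ts us \<longleftrightarrow> (\<forall>C. tri \<iota> A C \<longrightarrow> tsum3 C ts = tsum3 C us)"
proof (intro iffI allI impI)
  fix C assume teq: "teq3 \<iota> A ts us" and C: "tri \<iota> A C"
  show "tsum3 C ts = tsum3 C us"
  proof (rule eqI_functional)
    fix \<phi> :: "'t \<Rightarrow> 'f"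
    assume add: "\<And>x y. \<phi> (x + y) = \<phi> x + \<phi> y" and sc: "\<And>c x. \<phi> (\<iota> c * x) = c * \<phi> x"
    have 0: "\<phi> 0 = 0" using sc[of 0] by simp
    have sum: "\<phi> (tsum3 C rs) = tsum3 (\<lambda>u v z. \<phi> (C u v z)) rs" for rs
      by (induction rs) (auto simp: 0 add)
    have "trilin \<iota> A (\<lambda>u v z. \<phi> (C u v z))"
      using C by (auto simp: trilin_def tri_def lin_def add sc)
    then show "\<phi> (tsum3 C ts) = \<phi> (tsum3 C us)"
      using teq by (auto simp: teq3_def sum)
  qed
next
  assume *: "\<forall>C. tri \<iota> A C \<longrightarrow> tsum3 C ts = tsum3 C us"
  show "teq3 \<iota> A ts us"
    unfolding teq3_def
  proof (intro allI impI)
    fix \<gamma> assume "trilin \<iota> A \<gamma>"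
    then have "tri \<iota> A (\<lambda>u v z. \<iota> (\<gamma> u v z))"
      by (auto simp: trilin_def tri_def lin_def)
    then show "tsum3 \<gamma> ts = tsum3 \<gamma> us"
      using * by (metis iota_inj iota_tsum3)
  qed
qed

lemma lin_apply_tsum:
  assumes "lin \<iota> A f" "set ts \<subseteq> B \<times> C" "\<And>u v. u \<in> B \<Longrightarrow> v \<in> C \<Longrightarrow> g u v \<in> A"
  shows "f (tsum g ts) = tsum (\<lambda>u v. f (g u v)) ts"
  using assms(2)
proof (induction ts)
  case Nil
  have "f (\<iota> 0 * 0) = \<iota> 0 * f 0" using assms(1) unfolding lin_def by blast
  then show ?case by simp
next
  case (Cons p ts)
  then show ?case using assms(1,3) closed_tsum[of ts B C g]
    by (cases p) (auto simp: lin_def)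
qed

lemma lin_0: "lin \<iota> A f \<Longrightarrow> f 0 = 0"
  using lin_apply_tsum[of f "[]"] by simp

lemma lin_uminus: "lin \<iota> A f \<Longrightarrow> u \<in> A \<Longrightarrow> f (- u) = - f u"
  unfolding lin_def by (metis iota_hom(1) iota_minus mult_minus1)

lemma lin_sum: "lin \<iota> A f \<Longrightarrow> (\<And>i. i \<in> I \<Longrightarrow> g i \<in> A) \<Longrightarrow> f (sum g I) = (\<Sum>i\<in>I. f (g i))"
proof (induction I rule: infinite_finite_induct)
  case (insert i I)
  then show ?case by (auto simp: lin_def)
qed (auto simp: lin_0)

end

section \<open>Hopf algebras\<close>

locale hopf_algebra =
  fixes \<iota> :: "'f::field \<Rightarrow> 't::ring_1" and A :: "'t set" and \<Delta> \<epsilon> S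
  assumes hopf: "hopf \<iota> A \<Delta> \<epsilon> S"

sublocale hopf_algebra \<subseteq> falgebra
  using hopf by unfold_locales (simp add: hopf_def)

context hopf_algebra
begin

lemma set_Delta [simp]: "x \<in> A \<Longrightarrow> set (\<Delta> x) \<subseteq> A \<times> A"
  using hopf by (simp add: hopf_def)

lemma eps_simps [simp]:
  "x \<in> A \<Longrightarrow> y \<in> A \<Longrightarrow> \<epsilon> (x + y) = \<epsilon> x + \<epsilon> y"
  "x \<in> A \<Longrightarrow> y \<in> A \<Longrightarrow> \<epsilon> (x * y) = \<epsilon> x * \<epsilon> y" "\<epsilon> 1 = 1"
  using hopf by (simp_all add: hopf_def)

lemma eps_iota [simp]: "\<epsilon> (\<iota> c) = c"
proof -
  have "\<epsilon> (\<iota> c * 1) = c * \<epsilon> 1" using hopf closed(2) unfolding hopf_def by blast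
  then show ?thesis by simp
qed

lemma lin_eps: "lin \<iota> A (\<lambda>x. \<iota> (\<epsilon> x))"
  by (simp add: lin_def)

lemma lin_S: "lin \<iota> A S"
  using hopf by (simp add: lin_def hopf_def)

lemma S_closed [simp]: "x \<in> A \<Longrightarrow> S x \<in> A"
  using hopf by (auto simp: hopf_def bij_betw_def)

lemma S_inj: "x \<in> A \<Longrightarrow> y \<in> A \<Longrightarrow> S x = S y \<Longrightarrow> x = y"
  using hopf by (auto simp: hopf_def bij_betw_def inj_on_def)

lemmas lin_eps_comp [lin_intros] = lin_comp[OF lin_eps]
lemmas lin_S_comp [lin_intros] = lin_comp[OF lin_S]

lemma eps_0 [simp]: "\<epsilon> 0 = 0"
  using eps_iota[of 0] by simp

lemma eps_minus [simp]: "x \<in> A \<Longrightarrow> \<epsilon> (- x) = - \<epsilon> x"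
  using lin_uminus[OF lin_eps, of x] iota_inj[of "\<epsilon> (- x)" "- \<epsilon> x"] by simp

lemma eps_diff [simp]: "x \<in> A \<Longrightarrow> y \<in> A \<Longrightarrow> \<epsilon> (x - y) = \<epsilon> x - \<epsilon> y"
  using eps_simps(1)[of x "- y"] by simp

lemma tsum_Delta_mult:
  assumes "bil \<iota> A B" "x \<in> A" "y \<in> A"
  shows "tsum B (\<Delta> (x * y)) = tsum (\<lambda>u v. tsum (\<lambda>u' v'. B (u * u') (v * v')) (\<Delta> y)) (\<Delta> x)"
proof -
  have "teq \<iota> A (\<Delta> (x * y)) (tmul (\<Delta> x) (\<Delta> y))" using hopf assms by (simp add: hopf_def)
  then show ?thesis using assms(1) by (simp add: teq_iff_bil)
qed

lemma tsum_Delta_1: "bil \<iota> A B \<Longrightarrow> tsum B (\<Delta> 1) = B 1 1"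
  using hopf by (auto simp: hopf_def teq_iff_bil)

lemma lin_Delta:
  assumes "bil \<iota> A B"
  shows "lin \<iota> A (\<lambda>x. tsum B (\<Delta> x))"
proof -
  have "tsum B (\<Delta> (x + y)) = tsum B (\<Delta> x) + tsum B (\<Delta> y)" if "x \<in> A" "y \<in> A" for x y
  proof -
    have "teq \<iota> A (\<Delta> (x + y)) (\<Delta> x @ \<Delta> y)" using hopf that by (simp add: hopf_def)
    then show ?thesis using assms by (simp add: teq_iff_bil)
  qed
  moreover have "tsum B (\<Delta> (\<iota> c * x)) = \<iota> c * tsum B (\<Delta> x)" if "x \<in> A" for c x
  proof -
    have "teq \<iota> A (\<Delta> (\<iota> c * x)) (tscale (\<iota> c) (\<Delta> x))" using hopf that by (simp add: hopf_def)
    then have "tsum B (\<Delta> (\<iota> c * x)) = tsum (\<lambda>u v. B (\<iota> c * u) v) (\<Delta> x)"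
      using assms by (simp add: teq_iff_bil)
    also have "\<dots> = tsum (\<lambda>u v. \<iota> c * B u v) (\<Delta> x)"
      by (rule tsum_cong[OF set_Delta[OF that]]) (use assms in \<open>auto simp: bil_def lin_def\<close>)
    finally show ?thesis by (simp add: tsum_mult_left)
  qed
  ultimately show ?thesis by (simp add: lin_def)
qed

text \<open>Separate linearity premises in place of \<open>bil\<close> let repeated use of
  \<open>lin_intros\<close> descend into nested sums over coproducts.\<close>

lemma lin_Delta_comp [lin_intros]:
  assumes "lin \<iota> D g" "\<And>x. x \<in> D \<Longrightarrow> g x \<in> A"
    "\<And>v. v \<in> A \<Longrightarrow> lin \<iota> A (\<lambda>u. B u v)" "\<And>u. u \<in> A \<Longrightarrow> lin \<iota> A (\<lambda>v. B u v)"
  shows "lin \<iota> D (\<lambda>x. tsum (\<lambda>u v. B u v) (\<Delta> (g x)))"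
  by (rule lin_comp[OF lin_Delta[OF bilI] assms(1,2)]) (use assms in auto)

lemmas lin_tsum_Delta [lin_intros] = lin_tsum[OF set_Delta]

lemma coassoc:
  assumes "tri \<iota> A C" "x \<in> A"
  shows "tsum (\<lambda>u v. tsum (\<lambda>p q. C p q v) (\<Delta> u)) (\<Delta> x) = tsum (\<lambda>u v. tsum (\<lambda>p q. C u p q) (\<Delta> v)) (\<Delta> x)"
proof -
  have "teq3 \<iota> A (DeltaId \<Delta> (\<Delta> x)) (IdDelta \<Delta> (\<Delta> x))" using hopf assms by (simp add: hopf_def)
  then show ?thesis using assms(1) by (simp add: teq3_iff_tri)
qed

lemma counit_left:
  assumes "lin \<iota> A f" "x \<in> A"
  shows "tsum (\<lambda>u v. \<iota> (\<epsilon> u) * f v) (\<Delta> x) = f x"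
proof -
  have "f x = f (tsum (\<lambda>u v. \<iota> (\<epsilon> u) * v) (\<Delta> x))"
    using hopf assms by (simp add: hopf_def)
  also have "\<dots> = tsum (\<lambda>u v. f (\<iota> (\<epsilon> u) * v)) (\<Delta> x)"
    by (rule lin_apply_tsum[OF assms(1) set_Delta]) (use assms in auto)
  also have "\<dots> = tsum (\<lambda>u v. \<iota> (\<epsilon> u) * f v) (\<Delta> x)"
    by (rule tsum_cong[OF set_Delta]) (use assms in \<open>auto simp: lin_def\<close>)
  finally show ?thesis ..
qed

lemma counit_right:
  assumes "lin \<iota> A f" "x \<in> A"
  shows "tsum (\<lambda>u v. \<iota> (\<epsilon> v) * f u) (\<Delta> x) = f x"
proof -
  have "f x = f (tsum (\<lambda>u v. u * \<iota> (\<epsilon> v)) (\<Delta> x))"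
    using hopf assms by (simp add: hopf_def)
  also have "\<dots> = tsum (\<lambda>u v. f (u * \<iota> (\<epsilon> v))) (\<Delta> x)"
    by (rule lin_apply_tsum[OF assms(1) set_Delta]) (use assms in auto)
  also have "\<dots> = tsum (\<lambda>u v. \<iota> (\<epsilon> v) * f u) (\<Delta> x)"
    by (rule tsum_cong[OF set_Delta]) (use assms in \<open>auto simp: lin_def central\<close>)
  finally show ?thesis ..
qed

lemma antipode:
  assumes "x \<in> A"
  shows "tsum (\<lambda>u v. S u * v) (\<Delta> x) = \<iota> (\<epsilon> x)" "tsum (\<lambda>u v. u * S v) (\<Delta> x) = \<iota> (\<epsilon> x)"
  using hopf assms by (simp_all add: hopf_def)

section \<open>The antipode as an antihomomorphism\<close>

lemma S_1 [simp]: "S 1 = 1"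
proof -
  have "tsum (\<lambda>u v. S u * v) (\<Delta> 1) = S 1 * 1"
    by (rule tsum_Delta_1) (intro bilI lin_intros lin_mult_left; simp)
  then show ?thesis by (simp add: antipode)
qed

text \<open>Uniqueness of convolution inverses for maps from A \<otimes> A to A:
  \<open>S (u * v)\<close> is a left inverse of multiplication (\<open>m'\<close>) and
  \<open>S v * S u\<close> is a right inverse (\<open>m\<close>), so the two agree.\<close>

lemma S_mult:
  assumes [simp]: "x \<in> A" "y \<in> A"
  shows "S (x * y) = S y * S x"
proof -
  have m: "tsum (\<lambda>p q. tsum (\<lambda>p' q'. p * p' * S q' * S q) (\<Delta> v')) (\<Delta> v) = \<iota> (\<epsilon> v) * \<iota> (\<epsilon> v')"
    if [simp]: "v \<in> A" "v' \<in> A" for v v'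
  proof -
    have "tsum (\<lambda>p q. tsum (\<lambda>p' q'. p * p' * S q' * S q) (\<Delta> v')) (\<Delta> v) = tsum (\<lambda>p q. p * tsum (\<lambda>p' q'. p' * S q') (\<Delta> v') * S q) (\<Delta> v)"
      by (simp flip: tsum_mult_left tsum_mult_right add: mult.assoc)
    also have "\<dots> = tsum (\<lambda>p q. \<iota> (\<epsilon> v') * (p * S q)) (\<Delta> v)"
      by (rule tsum_cong[OF set_Delta]) (simp, metis antipode(2) central mult.assoc that(2))
    also have "\<dots> = \<iota> (\<epsilon> v) * \<iota> (\<epsilon> v')"
      by (simp add: tsum_mult_left antipode mult.commute flip: iota_hom(3))
    finally show ?thesis .
  qed
  have m': "tsum (\<lambda>p q. tsum (\<lambda>p' q'. S (p * p') * (q * q')) (\<Delta> u')) (\<Delta> u) = \<iota> (\<epsilon> u) * \<iota> (\<epsilon> u')"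
    if [simp]: "u \<in> A" "u' \<in> A" for u u'
  proof -
    have "tsum (\<lambda>p q. S p * q) (\<Delta> (u * u')) = tsum (\<lambda>p q. tsum (\<lambda>p' q'. S (p * p') * (q * q')) (\<Delta> u')) (\<Delta> u)"
      by (rule tsum_Delta_mult) (auto intro!: bilI lin_intros lin_mult_left)
    then show ?thesis by (simp add: antipode)
  qed
  have c: "S z * (\<iota> c * \<iota> d) = \<iota> c * (\<iota> d * S z)" if "z \<in> A" for z c d
    using that by (metis S_closed central iota_hom(3) mult.assoc)
  let ?F = "\<lambda>u p q u' p' q'. S (u * u') * (p * p') * (S q' * S q)"
  have "S (x * y) = tsum (\<lambda>u v. \<iota> (\<epsilon> v) * S (u * y)) (\<Delta> x)"
    by (rule counit_right[symmetric]) (auto intro!: lin_intros lin_mult_left)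
  also have "\<dots> = tsum (\<lambda>u v. tsum (\<lambda>u' v'. \<iota> (\<epsilon> v) * (\<iota> (\<epsilon> v') * S (u * u'))) (\<Delta> y)) (\<Delta> x)"
    by (rule tsum_cong[OF set_Delta], simp, unfold tsum_mult_left)
       (rule arg_cong, rule counit_right[symmetric], auto intro!: lin_intros lin_mult_left)
  also have "\<dots> = tsum (\<lambda>u v. tsum (\<lambda>u' v'. S (u * u') * tsum (\<lambda>p q. tsum (\<lambda>p' q'. p * p' * S q' * S q) (\<Delta> v')) (\<Delta> v)) (\<Delta> y)) (\<Delta> x)"
    by (intro tsum_cong[OF set_Delta]) (simp_all add: m c)
  also have "\<dots> = tsum (\<lambda>u v. tsum (\<lambda>p q. tsum (\<lambda>u' v'. tsum (\<lambda>p' q'. ?F u p q u' p' q') (\<Delta> v')) (\<Delta> y)) (\<Delta> v)) (\<Delta> x)"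
    by (subst tsum_swap) (simp add: tsum_mult_left[symmetric] mult.assoc)
  \<comment> \<open>Associativity of the triple convolution product: coassociativity is applied to
    \<open>y\<close> here and to \<open>x\<close> in the next step but one below, after which
    \<open>m'\<close> collapses the left half.\<close>
  also have "\<dots> = tsum (\<lambda>u v. tsum (\<lambda>p q. tsum (\<lambda>u' v'. tsum (\<lambda>p' q'. ?F u p q p' q' v') (\<Delta> u')) (\<Delta> y)) (\<Delta> v)) (\<Delta> x)"
    by (intro tsum_cong[OF set_Delta] coassoc[symmetric]) (auto intro!: triI lin_intros lin_mult_left)
  also have "\<dots> = tsum (\<lambda>u v. tsum (\<lambda>p q. tsum (\<lambda>u' v'. tsum (\<lambda>p' q'. ?F p q v p' q' v') (\<Delta> u')) (\<Delta> y)) (\<Delta> u)) (\<Delta> x)"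
    by (rule coassoc[symmetric]) (auto intro!: triI lin_intros lin_mult_left)
  also have "\<dots> = tsum (\<lambda>u v. tsum (\<lambda>u' v'. tsum (\<lambda>p q. tsum (\<lambda>p' q'. ?F p q v p' q' v') (\<Delta> u')) (\<Delta> u)) (\<Delta> y)) (\<Delta> x)"
    by (subst tsum_swap) simp
  also have "\<dots> = tsum (\<lambda>u v. tsum (\<lambda>u' v'. \<iota> (\<epsilon> u) * \<iota> (\<epsilon> u') * (S v' * S v)) (\<Delta> y)) (\<Delta> x)"
    by (intro tsum_cong[OF set_Delta]) (simp_all add: tsum_mult_right m')
  also have "\<dots> = tsum (\<lambda>u v. tsum (\<lambda>u' v'. \<iota> (\<epsilon> u) * (\<iota> (\<epsilon> u') * S v' * S v)) (\<Delta> y)) (\<Delta> x)"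
    by (simp add: mult.assoc)
  also have "\<dots> = tsum (\<lambda>u v. \<iota> (\<epsilon> u) * (S y * S v)) (\<Delta> x)"
    by (simp add: tsum_mult_right tsum_mult_left counit_left[OF lin_S])
  also have "\<dots> = S y * S x"
    by (rule counit_left) (auto intro!: lin_intros lin_mult_left)
  finally show ?thesis .
qed

lemma S_iota [simp]: "S (\<iota> c) = \<iota> c"
proof -
  have "S (\<iota> c * 1) = \<iota> c * S 1" using lin_S closed(2) unfolding lin_def by blast
  then show ?thesis by simp
qed

lemma eps_S [simp]: "r \<in> A \<Longrightarrow> \<epsilon> (S r) = \<epsilon> r"
proof -
  assume [simp]: "r \<in> A"
  have "\<iota> (\<epsilon> (S r)) = tsum (\<lambda>u v. \<iota> (\<epsilon> v) * \<iota> (\<epsilon> (S u))) (\<Delta> r)"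
    by (rule counit_right[symmetric]) (auto intro!: lin_intros)
  also have "\<dots> = tsum (\<lambda>u v. \<iota> (\<epsilon> (S u * v))) (\<Delta> r)"
    by (rule tsum_cong[OF set_Delta]) (auto simp: mult.commute simp flip: iota_hom(3))
  also have "\<dots> = \<iota> (\<epsilon> (tsum (\<lambda>u v. S u * v) (\<Delta> r)))"
    by (rule lin_apply_tsum[OF lin_eps set_Delta, symmetric]) auto
  finally show ?thesis by (simp add: antipode iota_inj)
qed

section \<open>Group-like elements\<close>

lemma grouplike_eps:
  assumes "grouplike \<iota> A \<Delta> g"
  shows "\<epsilon> g = 1"
proof -
  have g: "g \<in> A" "g \<noteq> 0" "\<And>B. bil \<iota> A B \<Longrightarrow> tsum B (\<Delta> g) = B g g"
    using assms by (auto simp: grouplike_def teq_iff_bil)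
  have "\<iota> (\<epsilon> g) * g = tsum (\<lambda>u v. \<iota> (\<epsilon> u) * v) (\<Delta> g)"
    by (rule g(3)[symmetric]) (auto intro!: bilI lin_intros lin_mult_left)
  also have "\<dots> = g" using counit_left[OF lin_id g(1)] .
  finally have "\<iota> (\<epsilon> g - 1) * g = 0" by (simp add: algebra_simps)
  then show ?thesis using g(2) iota_mult_eq_0[of "\<epsilon> g - 1" g] by simp
qed

lemma grouplike_S:
  assumes "grouplike \<iota> A \<Delta> g"
  shows "S g * g = 1" "g * S g = 1"
proof -
  have g: "g \<in> A" "\<And>B. bil \<iota> A B \<Longrightarrow> tsum B (\<Delta> g) = B g g"
    using assms by (auto simp: grouplike_def teq_iff_bil)
  have "tsum (\<lambda>u v. S u * v) (\<Delta> g) = S g * g" "tsum (\<lambda>u v. u * S v) (\<Delta> g) = g * S g"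
    by (rule g(2), auto intro!: bilI lin_intros lin_mult_left)+
  then show "S g * g = 1" "g * S g = 1"
    using antipode[OF g(1)] grouplike_eps[OF assms] by simp_all
qed

text \<open>The inverse of a group-like element is group-like. This follows from \<Delta>(1) =
  \<Delta>(g) \<Delta>(S g), without a general formula for \<Delta> after \<open>S\<close>.\<close>

lemma Delta_S_grouplike:
  assumes g: "grouplike \<iota> A \<Delta> g" and B: "bil \<iota> A B"
  shows "tsum B (\<Delta> (S g)) = B (S g) (S g)"
proof -
  note [lin_intros] = lin_bil1[OF B] lin_bil2[OF B]
  have g' [simp]: "g \<in> A" and Dg: "\<And>B. bil \<iota> A B \<Longrightarrow> tsum B (\<Delta> g) = B g g"
    using g by (auto simp: grouplike_def teq_iff_bil)
  \<comment> \<open>The extra factors \<open>S g\<close> cancel the factors \<open>g\<close> that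
    \<Delta>(g) puts in front of \<Delta>(S g).\<close>
  let ?B = "\<lambda>u v. B (S g * u) (S g * v)"
  have B': "bil \<iota> A ?B" by (auto intro!: bilI lin_intros lin_mult_left)
  have "tsum ?B (\<Delta> 1) = tsum (\<lambda>u v. tsum (\<lambda>u' v'. ?B (u * u') (v * v')) (\<Delta> (S g))) (\<Delta> g)"
    using tsum_Delta_mult[OF B', of g "S g"] grouplike_S[OF g] by simp
  also have "\<dots> = tsum (\<lambda>u' v'. ?B (g * u') (g * v')) (\<Delta> (S g))"
    by (rule Dg) (auto intro!: bilI lin_intros lin_mult_left)
  also have "\<dots> = tsum B (\<Delta> (S g))"
    using grouplike_S[OF g] by (simp flip: mult.assoc)
  finally show ?thesis using tsum_Delta_1[OF B'] by simp
qed

lemma uinv_grouplike: "grouplike \<iota> A \<Delta> g \<Longrightarrow> uinv A g = S g"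
  unfolding uinv_def
  by (rule the_equality) (auto simp: grouplike_S grouplike_def, metis grouplike_S(1) grouplike_def mult.assoc mult_1 mult_1_right)

text \<open>\<open>S\<close> is a left convolution inverse of the identity, so convolving the
  vanishing product with \<open>S\<close> returns \<open>D\<close>. The values of \<open>D\<close>
  may lie outside \<open>A\<close>; the application has \<open>A\<close> equal to \<open>R\<close>
  and values in the Ore extension.\<close>

lemma convolution_cancel:
  assumes D: "lin \<iota> A D" and 0: "\<And>r. r \<in> A \<Longrightarrow> tsum (\<lambda>u v. u * D v) (\<Delta> r) = 0" and [simp]: "r \<in> A"
  shows "D r = 0"
proof -
  note lin_comp[OF D, lin_intros]
  have "D r = tsum (\<lambda>u v. \<iota> (\<epsilon> u) * D v) (\<Delta> r)"
    using counit_left[OF D] by simp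
  also have "\<dots> = tsum (\<lambda>u v. tsum (\<lambda>p q. S p * q * D v) (\<Delta> u)) (\<Delta> r)"
    by (rule tsum_cong[OF set_Delta]) (simp_all add: tsum_mult_right antipode)
  also have "\<dots> = tsum (\<lambda>u v. tsum (\<lambda>p q. S u * p * D q) (\<Delta> v)) (\<Delta> r)"
    by (rule coassoc) (auto intro!: triI lin_intros lin_mult_left)
  also have "\<dots> = tsum (\<lambda>u v. 0) (\<Delta> r)"
    by (rule tsum_cong[OF set_Delta]) (simp_all add: tsum_mult_left 0 mult.assoc)
  finally show ?thesis by simp
qed

end

section \<open>Ore extensions\<close>

locale ore_extension =
  fixes \<iota> :: "'f::field \<Rightarrow> 't::ring_1" and R T :: "'t set" and x :: 't and \<sigma> \<delta> :: "'t \<Rightarrow> 't"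
  assumes ore: "ore_ext \<iota> R T x \<sigma> \<delta>"

sublocale ore_extension \<subseteq> R: falgebra \<iota> R
  using ore unfolding ore_ext_def by unfold_locales blast

sublocale ore_extension \<subseteq> T: falgebra \<iota> T
  using ore unfolding ore_ext_def by unfold_locales blast

context ore_extension
begin

lemma aut: "alg_aut \<iota> R \<sigma>" and deriv: "sigma_deriv \<iota> R \<sigma> \<delta>"
  using ore unfolding ore_ext_def by blast+

lemma R_T: "R \<subseteq> T" and R_T' [simp]: "r \<in> R \<Longrightarrow> r \<in> T" and x_T [simp]: "x \<in> T"
  using ore by (auto simp: ore_ext_def)

lemma lin_sigma: "lin \<iota> R \<sigma>" and lin_delta: "lin \<iota> R \<delta>"
  using aut deriv by (auto simp: alg_aut_def sigma_deriv_def lin_def)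

lemmas lin_sigma_comp [lin_intros] = lin_comp[OF lin_sigma]
lemmas lin_delta_comp [lin_intros] = lin_comp[OF lin_delta]

lemma sigma_closed [simp]: "r \<in> R \<Longrightarrow> \<sigma> r \<in> R" and delta_closed [simp]: "r \<in> R \<Longrightarrow> \<delta> r \<in> R"
  using aut deriv by (auto simp: alg_aut_def sigma_deriv_def bij_betw_def)

lemma sigma_simps [simp]: "\<sigma> 1 = 1" "\<sigma> 0 = 0" "\<delta> 0 = 0"
  "r \<in> R \<Longrightarrow> s \<in> R \<Longrightarrow> \<sigma> (r * s) = \<sigma> r * \<sigma> s"
  "r \<in> R \<Longrightarrow> s \<in> R \<Longrightarrow> \<sigma> (r + s) = \<sigma> r + \<sigma> s"
  "r \<in> R \<Longrightarrow> s \<in> R \<Longrightarrow> \<delta> (r + s) = \<delta> r + \<delta> s"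
  using aut deriv R.lin_0[OF lin_sigma] R.lin_0[OF lin_delta]
  by (auto simp: alg_aut_def sigma_deriv_def)

lemma delta_1 [simp]: "\<delta> 1 = 0"
proof -
  have "\<delta> (1 * 1) = \<delta> 1 * 1 + \<sigma> 1 * \<delta> 1"
    using deriv R.closed(2) unfolding sigma_deriv_def by blast
  then show ?thesis by simp
qed

lemma sigma_inj: "r \<in> R \<Longrightarrow> s \<in> R \<Longrightarrow> \<sigma> r = \<sigma> s \<Longrightarrow> r = s"
  using aut by (auto simp: alg_aut_def bij_betw_def inj_on_def)

lemma sigma_surj: "r \<in> R \<Longrightarrow> \<exists>s\<in>R. \<sigma> s = r"
  using aut unfolding alg_aut_def bij_betw_def by (metis imageE)

lemma x_commute: "r \<in> R \<Longrightarrow> x * r = \<sigma> r * x + \<delta> r"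
  using ore by (auto simp: ore_ext_def algebra_simps)

lemma x_commute': "r \<in> R \<Longrightarrow> x * (r * y) = \<sigma> r * (x * y) + \<delta> r * y"
  by (metis x_commute distrib_right mult.assoc)

text \<open>Coefficients form a total function of finite support, so uniqueness can be stated
  without reference to the length \<open>n\<close> of the sum.\<close>

definition is_coef :: "'t \<Rightarrow> (nat \<Rightarrow> 't) \<Rightarrow> bool" where
  "is_coef t c \<longleftrightarrow> (\<forall>i. c i \<in> R) \<and> (\<exists>n. (\<forall>i\<ge>n. c i = 0) \<and> t = (\<Sum>i<n. c i * x ^ i))"

definition coef :: "'t \<Rightarrow> nat \<Rightarrow> 't" where
  "coef t = (SOME c. is_coef t c)"

lemma sum_pad:
  fixes c :: "nat \<Rightarrow> 't"
  assumes "\<forall>i\<ge>n. c i = 0" "n \<le> m"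
  shows "(\<Sum>i<m. c i * f i) = (\<Sum>i<n. c i * f i)"
  using assms by (intro sum.mono_neutral_right) auto

lemma powers_independent:
  assumes "\<forall>i<n. c i \<in> R" "(\<Sum>i<n. c i * x ^ i) = 0"
  shows "\<forall>i<n. c i = 0"
proof -
  have "\<forall>n c. (\<forall>i<n. c i \<in> R) \<and> (\<Sum>i<n. c i * x ^ i) = 0 \<longrightarrow> (\<forall>i<n. c i = 0)"
    using ore unfolding ore_ext_def by (elim conjE)
  from this[rule_format, of n c] show ?thesis using assms by blast
qed

lemma T_eq: "T = {(\<Sum>i<n. c i * x ^ i) | n c. \<forall>i<n. c i \<in> R}"
  using ore unfolding ore_ext_def by (elim conjE)

lemma coef_unique:
  assumes "is_coef t c"
  shows "coef t = c"
proof -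
  have "d = c" if d: "is_coef t d" for d
  proof
    fix i
    obtain n where n: "\<forall>i\<ge>n. c i = 0" "t = (\<Sum>i<n. c i * x ^ i)" using assms by (auto simp: is_coef_def)
    obtain m where m: "\<forall>i\<ge>m. d i = 0" "t = (\<Sum>i<m. d i * x ^ i)" using d by (auto simp: is_coef_def)
    let ?N = "Suc (max i (max n m))"
    have "(\<Sum>i<?N. (c i - d i) * x ^ i) = 0"
      using sum_pad[OF n(1), of ?N] sum_pad[OF m(1), of ?N] n(2) m(2) by (simp add: left_diff_distrib sum_subtractf)
    moreover have "\<forall>i<?N. c i - d i \<in> R" using assms d by (auto simp: is_coef_def)
    ultimately have "\<forall>i<?N. c i - d i = 0"
      by (rule powers_independent[rotated])
    then show "d i = c i" by simp
  qed
  then show ?thesis unfolding coef_def using assms by (metis someI)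
qed

lemma is_coef_coef:
  assumes "t \<in> T"
  shows "is_coef t (coef t)"
proof -
  obtain n c where c: "t = (\<Sum>i<n. c i * x ^ i)" "\<forall>i<n. c i \<in> R"
    using assms T_eq by blast
  have "is_coef t (\<lambda>i. if i < n then c i else 0)"
    unfolding is_coef_def using c by (auto intro!: exI[of _ n])
  with coef_unique[OF this] show ?thesis by simp
qed

lemma coef_closed [simp]: "t \<in> T \<Longrightarrow> coef t i \<in> R"
  using is_coef_coef unfolding is_coef_def by blast

text \<open>One more than the usual degree, and 0 for the zero polynomial: an exclusive bound for
  the indices of nonzero coefficients.\<close>

definition deg :: "'t \<Rightarrow> nat" where
  "deg t = (LEAST n. \<forall>i\<ge>n. coef t i = 0)"

lemma coef_deg: "t \<in> T \<Longrightarrow> deg t \<le> i \<Longrightarrow> coef t i = 0"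
proof -
  assume "t \<in> T" "deg t \<le> i"
  from is_coef_coef[OF this(1)] have "\<exists>n. \<forall>i\<ge>n. coef t i = 0"
    unfolding is_coef_def by (elim conjE exE) (rule exI)
  from LeastI_ex[OF this, folded deg_def] show ?thesis using \<open>deg t \<le> i\<close> by blast
qed

lemma expansion:
  assumes "t \<in> T" "\<forall>i\<ge>n. coef t i = 0"
  shows "t = (\<Sum>i<n. coef t i * x ^ i)"
proof -
  obtain m where m: "\<forall>i\<ge>m. coef t i = 0" "t = (\<Sum>i<m. coef t i * x ^ i)"
    using is_coef_coef[OF assms(1)] by (auto simp: is_coef_def)
  note m(2)
  also have "(\<Sum>i<m. coef t i * x ^ i) = (\<Sum>i<max m n. coef t i * x ^ i)"
    by (rule sum_pad[symmetric]) (use m(1) in auto)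
  also have "\<dots> = (\<Sum>i<n. coef t i * x ^ i)"
    by (rule sum_pad) (use assms(2) in auto)
  finally show ?thesis .
qed

lemma expansion_deg: "t \<in> T \<Longrightarrow> t = (\<Sum>i<deg t. coef t i * x ^ i)"
  by (rule expansion) (auto intro: coef_deg)

lemma coef_add [simp]:
  assumes "s \<in> T" "t \<in> T"
  shows "coef (s + t) i = coef s i + coef t i"
proof -
  let ?n = "max (deg s) (deg t)"
  have "s + t = (\<Sum>i<?n. coef s i * x ^ i) + (\<Sum>i<?n. coef t i * x ^ i)"
    using assms by (intro arg_cong2[where f="(+)"] expansion) (auto simp: coef_deg)
  then have "is_coef (s + t) (\<lambda>i. coef s i + coef t i)"
    using assms unfolding is_coef_def
    by (intro conjI exI[of _ ?n]) (auto simp: coef_deg distrib_right sum.distrib)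
  from coef_unique[OF this] show ?thesis by simp
qed

lemma coef_mult [simp]:
  assumes "r \<in> R" "t \<in> T"
  shows "coef (r * t) i = r * coef t i"
proof -
  have "r * t = (\<Sum>i<deg t. r * coef t i * x ^ i)"
    using arg_cong[OF expansion_deg[OF assms(2)], of "(*) r"] by (simp only: sum_distrib_left mult.assoc)
  then have "is_coef (r * t) (\<lambda>i. r * coef t i)"
    using assms unfolding is_coef_def
    by (intro conjI exI[of _ "deg t"]) (auto simp: coef_deg)
  from coef_unique[OF this] show ?thesis by simp
qed

lemma coef_R [simp]: "r \<in> R \<Longrightarrow> coef r i = (if i = 0 then r else 0)"
  by (subst coef_unique[of r "\<lambda>i. if i = 0 then r else 0"])
     (auto simp: is_coef_def intro!: exI[of _ "Suc 0"])

text \<open>Moving x past a coefficient gives x c x^i = \<sigma>(c) x^(i+1) + \<delta>(c) x^i; the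
  cases collect the contributions to one power.\<close>

lemma coef_x_mult:
  assumes [simp]: "t \<in> T"
  shows "coef (x * t) i = (case i of 0 \<Rightarrow> \<delta> (coef t 0) | Suc j \<Rightarrow> \<sigma> (coef t j) + \<delta> (coef t i))"
proof -
  let ?c = "coef t" and ?n = "deg t"
  let ?d = "\<lambda>i. case i of 0 \<Rightarrow> \<delta> (?c 0) | Suc j \<Rightarrow> \<sigma> (?c j) + \<delta> (?c i)"
  have "x * t = (\<Sum>i<?n. x * (?c i * x ^ i))"
    using arg_cong[OF expansion_deg[OF assms], of "(*) x"] by (simp only: sum_distrib_left)
  also have "\<dots> = (\<Sum>i<?n. \<sigma> (?c i) * x ^ Suc i) + (\<Sum>i<?n. \<delta> (?c i) * x ^ i)"
    by (simp add: x_commute' sum.distrib)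
  also have "(\<Sum>i<?n. \<delta> (?c i) * x ^ i) = (\<Sum>i<Suc ?n. \<delta> (?c i) * x ^ i)"
    by (simp add: coef_deg)
  also have "(\<Sum>i<?n. \<sigma> (?c i) * x ^ Suc i) + (\<Sum>i<Suc ?n. \<delta> (?c i) * x ^ i) = (\<Sum>i<Suc ?n. ?d i * x ^ i)"
    unfolding sum.lessThan_Suc_shift[of _ ?n] by (simp add: sum.distrib distrib_right add_ac del: power_Suc)
  finally have eq: "x * t = (\<Sum>i<Suc ?n. ?d i * x ^ i)" .
  have "\<forall>i. ?d i \<in> R" "\<forall>i\<ge>Suc ?n. ?d i = 0"
    by (auto simp: coef_deg split: nat.split)
  then have "is_coef (x * t) ?d"
    unfolding is_coef_def using eq by blast
  from coef_unique[OF this] show ?thesis by simp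
qed

lemma coef_x [simp]: "coef x i = (if i = 1 then 1 else 0)"
  using coef_x_mult[of 1 i] by (auto split: nat.splits)

lemma coef_x_power [simp]: "coef (x ^ k) i = (if i = k then 1 else 0)"
  by (induction k arbitrary: i) (auto simp: coef_x_mult split: nat.splits)

lemma lin_coef: "lin \<iota> T (\<lambda>t. coef t i)"
  by (simp add: lin_def)

lemmas lin_coef_comp [lin_intros] = lin_comp[OF lin_coef]

lemma T_induct_monom [consumes 1, case_names monom add]:
  assumes "t \<in> T" "\<And>r k. r \<in> R \<Longrightarrow> P (r * x ^ k)"
    "\<And>p q. p \<in> T \<Longrightarrow> q \<in> T \<Longrightarrow> P p \<Longrightarrow> P q \<Longrightarrow> P (p + q)"
  shows "P t"
proof -
  have "P (\<Sum>i<n. coef t i * x ^ i)" for n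
  proof (induction n)
    case 0
    then show ?case using assms(2)[of 0 0] by simp
  next
    case (Suc n)
    then show ?case using assms by auto
  qed
  from this[of "deg t"] show ?thesis unfolding expansion_deg[OF assms(1), symmetric] .
qed

text \<open>\<open>T\<close> is generated as a ring by \<open>R\<close> and \<open>x\<close>. Hence
  multiplicative properties, such as the Hopf axioms of part (ii), need checking only there.\<close>

lemma T_induct [consumes 1, case_names R x add mult]:
  assumes "t \<in> T" "\<And>r. r \<in> R \<Longrightarrow> P r" "P x"
    "\<And>p q. p \<in> T \<Longrightarrow> q \<in> T \<Longrightarrow> P p \<Longrightarrow> P q \<Longrightarrow> P (p + q)"
    "\<And>p q. p \<in> T \<Longrightarrow> q \<in> T \<Longrightarrow> P p \<Longrightarrow> P q \<Longrightarrow> P (p * q)"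
  shows "P t"
proof -
  have px: "P (x ^ k)" for k
    by (induction k) (auto intro: assms)
  show ?thesis using assms(1) by (induction t rule: T_induct_monom) (auto intro: assms px)
qed

section \<open>Linear polynomials with unit leading coefficient and change of variable\<close>

lemma coef_linear_mult:
  assumes [simp]: "\<kappa> \<in> R" "\<mu> \<in> R" "t \<in> T" and 0: "\<forall>i>n. coef t i = 0"
  shows "coef ((\<kappa> * x + \<mu>) * t) (Suc n) = \<kappa> * \<sigma> (coef t n)"
    and "\<forall>i>Suc n. coef ((\<kappa> * x + \<mu>) * t) i = 0"
proof -
  have *: "coef ((\<kappa> * x + \<mu>) * t) i = \<kappa> * coef (x * t) i + \<mu> * coef t i" for i
    by (simp add: distrib_right mult.assoc)
  show "coef ((\<kappa> * x + \<mu>) * t) (Suc n) = \<kappa> * \<sigma> (coef t n)"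
    using 0 by (simp add: * coef_x_mult)
  show "\<forall>i>Suc n. coef ((\<kappa> * x + \<mu>) * t) i = 0"
    using 0 by (auto simp: * coef_x_mult split: nat.splits)
qed

lemma unit_sigma: "is_unit_in R u \<Longrightarrow> is_unit_in R (\<sigma> u)"
  unfolding is_unit_in_def by (metis sigma_closed sigma_simps(1,4))

lemma unit_mult: "is_unit_in R u \<Longrightarrow> is_unit_in R v \<Longrightarrow> is_unit_in R (u * v)"
proof -
  assume "is_unit_in R u" "is_unit_in R v"
  then obtain u' v' where "u' \<in> R" "v' \<in> R" "u * u' = 1" "u' * u = 1" "v * v' = 1" "v' * v = 1" "u \<in> R" "v \<in> R"
    by (auto simp: is_unit_in_def)
  then show ?thesis unfolding is_unit_in_def
    by (intro conjI bexI[of _ "v' * u'"]) (auto, (metis mult.assoc mult_1_right)+)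
qed

lemma unit_0_left: "is_unit_in R u \<Longrightarrow> u * y = 0 \<Longrightarrow> y = 0"
  unfolding is_unit_in_def by (metis mult.assoc mult_1 mult_zero_right)

lemma unit_0_right: "is_unit_in R u \<Longrightarrow> y * u = 0 \<Longrightarrow> y = 0"
  unfolding is_unit_in_def by (metis mult.assoc mult_1_right mult_zero_left)

text \<open>Powers of a linear polynomial with unit leading coefficient are again triangular with unit
  diagonal, so they form a basis on either side.\<close>

lemma coef_linear_power:
  assumes "is_unit_in R \<kappa>" "\<mu> \<in> R"
  shows "(\<forall>i>n. coef ((\<kappa> * x + \<mu>) ^ n) i = 0) \<and> is_unit_in R (coef ((\<kappa> * x + \<mu>) ^ n) n)"
proof (induction n)
  case 0
  then show ?case by (auto simp: is_unit_in_def)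
next
  case (Suc n)
  have [simp]: "\<kappa> \<in> R" using assms by (simp add: is_unit_in_def)
  show ?case
    using coef_linear_mult[of \<kappa> \<mu> "(\<kappa> * x + \<mu>) ^ n" n] Suc assms by (simp add: unit_mult unit_sigma)
qed

text \<open>Each further factor replaces the leading coefficient c by \<kappa> \<sigma>(c), which
  vanishes only with c since \<kappa> is a unit and \<sigma> is injective. The form with
  \<open>r\<close> on the right fits the antipode of \<open>T\<close>, which sends r x^n to y^n
  S(r).\<close>

lemma coef_linear_power_right:
  assumes "is_unit_in R \<kappa>" "\<mu> \<in> R" "r \<in> R"
  shows "(\<forall>i>n. coef ((\<kappa> * x + \<mu>) ^ n * r) i = 0) \<and> (coef ((\<kappa> * x + \<mu>) ^ n * r) n = 0 \<longrightarrow> r = 0)"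
proof (induction n)
  case 0
  then show ?case using assms by auto
next
  case (Suc n)
  have [simp]: "\<kappa> \<in> R" using assms by (simp add: is_unit_in_def)
  let ?t = "(\<kappa> * x + \<mu>) ^ n * r"
  have "coef ?t n = 0" if "\<kappa> * \<sigma> (coef ?t n) = 0"
    using unit_0_left[OF assms(1) that] sigma_inj[of "coef ?t n" 0] assms by simp
  then show ?case
    using coef_linear_mult[of \<kappa> \<mu> ?t n] Suc assms by (simp add: mult.assoc)
qed

text \<open>The coefficient at the highest index sees only the last summand; that summand is removed
  and the argument repeats. \<open>y n\<close> already contains its scalar, and \<open>P n\<close>
  says that this scalar vanishes, so scalars on the left and on the right are covered alike.\<close>

lemma triangular_independent:
  assumes "\<And>i. y i \<in> T" "\<And>n i. i > n \<Longrightarrow> coef (y n) i = 0" "\<And>n. coef (y n) n = 0 \<Longrightarrow> P n"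
    and "(\<Sum>i<n. y i) = 0" "\<And>n. P n \<Longrightarrow> y n = 0"
  shows "\<forall>i<n. P i"
  using assms(4)
proof (induction n)
  case (Suc n)
  have "coef (\<Sum>i<m. y i) k = (\<Sum>i<m. coef (y i) k)" for m k
    by (rule T.lin_sum[OF lin_coef]) (rule assms(1))
  then have "(\<Sum>i<Suc n. coef (y i) n) = 0"
    using Suc.prems by (metis R.closed(1) coef_R)
  moreover have "(\<Sum>i<n. coef (y i) n) = 0" using assms(2) by simp
  ultimately have "P n" using assms(3) by simp
  then show ?case using Suc assms(5) by (auto simp: less_Suc_eq)
qed auto

lemma coef_diff [simp]: "s \<in> T \<Longrightarrow> t \<in> T \<Longrightarrow> coef (s - t) i = coef s i - coef t i"
  using coef_add[of "s - t" t i] by simp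

lemma change_of_variable:
  assumes \<kappa>: "is_unit_in R \<kappa>" and [simp]: "\<mu> \<in> R"
  shows "\<exists>\<sigma>' \<delta>'. ore_ext \<iota> R T (\<kappa> * x + \<mu>) \<sigma>' \<delta>'"
proof -
  obtain \<kappa>' where [simp]: "\<kappa> \<in> R" "\<kappa>' \<in> R" "\<kappa> * \<kappa>' = 1" "\<kappa>' * \<kappa> = 1"
    using \<kappa> by (auto simp: is_unit_in_def)
  have [simp]: "\<kappa> * (\<kappa>' * z) = z" "\<kappa>' * (\<kappa> * z) = z" for z
    by (simp_all flip: mult.assoc)
  define y where "y = \<kappa> * x + \<mu>"
  \<comment> \<open>Comparing leading terms in \<open>y * r = \<sigma>' r * y + \<delta>' r\<close>
    forces \<sigma>'(r) \<kappa> = \<kappa> \<sigma>(r).\<close>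
  define \<sigma>' where "\<sigma>' r = \<kappa> * \<sigma> r * \<kappa>'" for r
  \<comment> \<open>Taken as the commutation defect, \<delta>' satisfies the derivation rule
    formally; only its values in \<open>R\<close> need an argument, namely that the x-terms
    cancel.\<close>
  define \<delta>' where "\<delta>' r = y * r - \<sigma>' r * y" for r
  have y_T [simp]: "y \<in> T" by (simp add: y_def)
  have \<sigma>'_R [simp]: "r \<in> R \<Longrightarrow> \<sigma>' r \<in> R" for r
    by (simp add: \<sigma>'_def)
  have \<delta>'_R: "\<delta>' r \<in> R" if "r \<in> R" for r
  proof -
    have "\<delta>' r = \<kappa> * \<delta> r + \<mu> * r - \<sigma>' r * \<mu>"
      using that by (simp add: \<delta>'_def y_def \<sigma>'_def algebra_simps x_commute)
    then show ?thesis using that by simp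
  qed
  have inj: "inj_on \<sigma>' R"
  proof (rule inj_onI)
    fix r s assume "r \<in> R" "s \<in> R" "\<sigma>' r = \<sigma>' s"
    then have "\<kappa>' * \<sigma>' r * \<kappa> = \<kappa>' * \<sigma>' s * \<kappa>" by simp
    then have "\<sigma> r = \<sigma> s" by (simp add: \<sigma>'_def mult.assoc)
    then show "r = s" using sigma_inj \<open>r \<in> R\<close> \<open>s \<in> R\<close> by blast
  qed
  have surj: "\<sigma>' ` R = R"
  proof
    show "R \<subseteq> \<sigma>' ` R"
    proof
      fix r assume "r \<in> R"
      then obtain s where "s \<in> R" "\<sigma> s = \<kappa>' * r * \<kappa>" using sigma_surj[of "\<kappa>' * r * \<kappa>"] by auto
      then show "r \<in> \<sigma>' ` R" by (auto simp: \<sigma>'_def mult.assoc intro!: image_eqI[of _ _ s])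
    qed
  qed auto
  have aut': "alg_aut \<iota> R \<sigma>'"
    unfolding alg_aut_def bij_betw_def
  proof (intro conjI ballI allI inj surj)
    fix c r s assume [simp]: "r \<in> R" "s \<in> R"
    show "\<sigma>' (r + s) = \<sigma>' r + \<sigma>' s" "\<sigma>' (r * s) = \<sigma>' r * \<sigma>' s"
      by (simp_all add: \<sigma>'_def algebra_simps)
  next
    fix c r assume [simp]: "r \<in> R"
    have "\<sigma> (\<iota> c * r) = \<iota> c * \<sigma> r" using lin_sigma by (simp add: lin_def)
    then show "\<sigma>' (\<iota> c * r) = \<iota> c * \<sigma>' r"
      using R.central[of \<kappa> c] by (simp only: \<sigma>'_def) (simp flip: mult.assoc)
  qed (simp add: \<sigma>'_def)
  have deriv': "sigma_deriv \<iota> R \<sigma>' \<delta>'"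
    unfolding sigma_deriv_def
  proof (intro conjI ballI allI \<delta>'_R)
    fix r s assume [simp]: "r \<in> R" "s \<in> R"
    have "\<sigma>' (r + s) = \<sigma>' r + \<sigma>' s" "\<sigma>' (r * s) = \<sigma>' r * \<sigma>' s"
      using aut' by (simp_all add: alg_aut_def)
    then show "\<delta>' (r + s) = \<delta>' r + \<delta>' s" "\<delta>' (r * s) = \<delta>' r * s + \<sigma>' r * \<delta>' s"
      by (simp_all add: \<delta>'_def algebra_simps)
  next
    fix c r assume [simp]: "r \<in> R"
    have "\<sigma>' (\<iota> c * r) = \<iota> c * \<sigma>' r"
      using aut' \<open>r \<in> R\<close> unfolding alg_aut_def by blast
    moreover have "y * (\<iota> c * r) = \<iota> c * (y * r)"
      using T.central[of y c] by (simp flip: mult.assoc)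
    ultimately show "\<delta>' (\<iota> c * r) = \<iota> c * \<delta>' r"
      by (simp add: \<delta>'_def algebra_simps)
  qed
  have top: "\<And>n i. i > n \<Longrightarrow> coef (y ^ n) i = 0" "\<And>n. is_unit_in R (coef (y ^ n) n)"
    using coef_linear_power[OF \<kappa>, of \<mu>] by (auto simp: y_def)
  have span: "\<exists>c. (\<forall>i. c i \<in> R) \<and> t = (\<Sum>i<n. c i * y ^ i)" if "t \<in> T" "\<forall>i\<ge>n. coef t i = 0" for t n
    using that
  proof (induction n arbitrary: t)
    case 0
    then show ?case using expansion[of t 0] by (auto intro!: exI[of _ "\<lambda>_. 0"])
  next
    case (Suc n)
    obtain u where u: "u \<in> R" "u * coef (y ^ n) n = 1" using top(2)[of n] by (auto simp: is_unit_in_def)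
    \<comment> \<open>As \<open>u\<close> inverts the leading coefficient of \<open>y ^ n\<close>
      from the left, subtracting \<open>d * y ^ n\<close> removes the top term of
      \<open>t\<close>.\<close>
    define d where "d = coef t n * u"
    have d [simp]: "d \<in> R" using Suc u by (simp add: d_def)
    have "coef (t - d * y ^ n) i = 0" if "i \<ge> n" for i
      using Suc.prems top(1)[of n i] that u by (cases "i = n") (auto simp: d_def mult.assoc)
    then obtain c where c: "\<forall>i. c i \<in> R" "t - d * y ^ n = (\<Sum>i<n. c i * y ^ i)"
      using Suc.IH[of "t - d * y ^ n"] Suc.prems by auto
    then have "t = (\<Sum>i<Suc n. (c(n := d)) i * y ^ i)"
      by (simp add: algebra_simps)
    then show ?case using c d by (metis fun_upd_apply)
  qed
  have T': "T = {(\<Sum>i<n. c i * y ^ i) | n c. \<forall>i<n. c i \<in> R}"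
  proof (intro Set.equalityI subsetI)
    fix t assume "t \<in> T"
    then show "t \<in> {(\<Sum>i<n. c i * y ^ i) | n c. \<forall>i<n. c i \<in> R}"
      using span[of t "deg t"] coef_deg[of t] by fast
  qed auto
  have indep: "\<forall>i<n. c i = 0" if c: "\<forall>i<n. c i \<in> R" "(\<Sum>i<n. c i * y ^ i) = 0" for n c
  proof -
    \<comment> \<open>Extension by zero, because \<open>triangular_independent\<close> wants its
      hypotheses at every index.\<close>
    define d where "d i = (if i < n then c i else 0)" for i
    have d: "d i \<in> R" for i using c by (simp add: d_def)
    have "\<forall>i<n. d i = 0"
    proof (rule triangular_independent[of "\<lambda>i. d i * y ^ i"])
      show "(\<Sum>i<n. d i * y ^ i) = 0" using c(2) by (simp add: d_def)
      show "d m = 0" if "coef (d m * y ^ m) m = 0" for m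
        using that d top(2)[of m] unit_0_right by simp
    qed (use d top(1) in auto)
    then show ?thesis by (simp add: d_def)
  qed
  have "ore_ext \<iota> R T y \<sigma>' \<delta>'"
    unfolding ore_ext_def
    using R.falg T.falg R_T y_T aut' deriv' T' indep by (intro conjI) (auto simp: \<delta>'_def)
  then show ?thesis unfolding y_def by blast
qed

end

section \<open>Hopf Ore extensions\<close>

locale hopf_ore_extension =
  fixes \<iota> :: "'f::field \<Rightarrow> 't::ring_1" and R \<Delta>R \<epsilon>R SR T \<Delta> \<epsilon> S x \<sigma> \<delta> a b v w
  assumes hoe: "hoe \<iota> R \<Delta>R \<epsilon>R SR T \<Delta> \<epsilon> S x \<sigma> \<delta> a b v w"

sublocale hopf_ore_extension \<subseteq> ore_extension \<iota> R T x \<sigma> \<delta>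
  using hoe unfolding hoe_def by unfold_locales (elim conjE)

sublocale hopf_ore_extension \<subseteq> HR: hopf_algebra \<iota> R \<Delta>R \<epsilon>R SR
  using hoe unfolding hoe_def by unfold_locales (elim conjE)

sublocale hopf_ore_extension \<subseteq> HT: hopf_algebra \<iota> T \<Delta> \<epsilon> S
  using hoe unfolding hoe_def by unfold_locales (elim conjE)

context hopf_ore_extension
begin

lemma a_R [simp]: "a \<in> R" and b_R [simp]: "b \<in> R"
  and set_v: "set v \<subseteq> R \<times> R" and set_w: "set w \<subseteq> R \<times> R"
  using hoe unfolding hoe_def by blast+

lemma eps_R [simp]: "r \<in> R \<Longrightarrow> \<epsilon> r = \<epsilon>R r" and S_R [simp]: "r \<in> R \<Longrightarrow> S r = SR r"
  using hoe unfolding hoe_def by blast+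

lemma mem_v: "(p, q) \<in> set v \<Longrightarrow> p \<in> R" "(p, q) \<in> set v \<Longrightarrow> q \<in> R"
  and mem_w: "(p, q) \<in> set w \<Longrightarrow> p \<in> R" "(p, q) \<in> set w \<Longrightarrow> q \<in> R"
  and mem_Delta: "(p, q) \<in> set (\<Delta>R r) \<Longrightarrow> r \<in> R \<Longrightarrow> p \<in> R" "(p, q) \<in> set (\<Delta>R r) \<Longrightarrow> r \<in> R \<Longrightarrow> q \<in> R"
  using set_v set_w HR.set_Delta[of r] by blast+

lemmas mem = mem_v mem_w mem_Delta

lemmas lin_tsum_v [lin_intros] = lin_tsum[OF set_v]
lemmas lin_tsum_w [lin_intros] = lin_tsum[OF set_w]

lemma Delta_R:
  assumes "r \<in> R" "bil \<iota> T B"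
  shows "tsum B (\<Delta> r) = tsum B (\<Delta>R r)"
proof -
  have "teq \<iota> T (\<Delta> r) (\<Delta>R r)" using hoe assms(1) unfolding hoe_def by blast
  then show ?thesis using assms(2) by (simp add: T.teq_iff_bil)
qed

lemma Delta_x:
  assumes "bil \<iota> T B"
  shows "tsum B (\<Delta> x) = B a x + B x b + tsum (\<lambda>p q. B (p * x) (q * x)) v + tsum B w"
proof -
  have "teq \<iota> T (\<Delta> x) ([(a, x), (x, b)] @ tmul v [(x, x)] @ w)" using hoe unfolding hoe_def by blast
  then show ?thesis using assms by (simp add: T.teq_iff_bil add_ac)
qed

text \<open>The legs of v(x \<otimes> x) have the form \<open>r * x\<close>, so coassociativity at
  \<open>x\<close> involves their coproducts.\<close>

lemma Delta_mult_x:
  assumes r [simp]: "r \<in> R" and B: "bil \<iota> T B"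
  shows "tsum B (\<Delta> (r * x)) = tsum (\<lambda>p q. B (p * a) (q * x) + B (p * x) (q * b) +
     tsum (\<lambda>p' q'. B (p * p' * x) (q * q' * x)) v + tsum (\<lambda>p' q'. B (p * p') (q * q')) w) (\<Delta>R r)"
proof -
  note [lin_intros] = lin_bil1[OF B] lin_bil2[OF B]
  have "tsum B (\<Delta> (r * x)) = tsum (\<lambda>p q. tsum (\<lambda>p' q'. B (p * p') (q * q')) (\<Delta> x)) (\<Delta> r)"
    by (rule HT.tsum_Delta_mult) (use B in auto)
  also have "\<dots> = tsum (\<lambda>p q. tsum (\<lambda>p' q'. B (p * p') (q * q')) (\<Delta> x)) (\<Delta>R r)"
    by (rule Delta_R) (auto intro!: bilI lin_intros T.lin_mult_left)
  also have "\<dots> = tsum (\<lambda>p q. B (p * a) (q * x) + B (p * x) (q * b) +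
     tsum (\<lambda>p' q'. B (p * p' * x) (q * q' * x)) v + tsum (\<lambda>p' q'. B (p * p') (q * q')) w) (\<Delta>R r)"
    by (rule tsum_cong[OF HR.set_Delta[OF r]], subst Delta_x)
       (auto intro!: bilI lin_intros T.lin_mult_left simp: mult.assoc)
  finally show ?thesis .
qed

text \<open>On each side the four groups of terms come from a \<otimes> x, x \<otimes> b, v(x
  \<otimes> x) and w, in this order. No coefficients are compared yet.\<close>

lemma coassoc_x:
  assumes C: "tri \<iota> T C"
  shows "tsum (\<lambda>p q. C p q x) (\<Delta>R a) +
     (C a x b + C x b b + tsum (\<lambda>p q. C (p * x) (q * x) b) v + tsum (\<lambda>p q. C p q b) w) +
     tsum (\<lambda>r s. tsum (\<lambda>p q. C (p * a) (q * x) (s * x) + C (p * x) (q * b) (s * x) +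
        tsum (\<lambda>p' q'. C (p * p' * x) (q * q' * x) (s * x)) v + tsum (\<lambda>p' q'. C (p * p') (q * q') (s * x)) w) (\<Delta>R r)) v +
     tsum (\<lambda>r s. tsum (\<lambda>p q. C p q s) (\<Delta>R r)) w =
     (C a a x + C a x b + tsum (\<lambda>p q. C a (p * x) (q * x)) v + tsum (\<lambda>p q. C a p q) w) +
     tsum (\<lambda>p q. C x p q) (\<Delta>R b) +
     tsum (\<lambda>r s. tsum (\<lambda>p q. C (r * x) (p * a) (q * x) + C (r * x) (p * x) (q * b) +
        tsum (\<lambda>p' q'. C (r * x) (p * p' * x) (q * q' * x)) v + tsum (\<lambda>p' q'. C (r * x) (p * p') (q * q')) w) (\<Delta>R s)) v +
     tsum (\<lambda>r s. tsum (\<lambda>p q. C r p q) (\<Delta>R s)) w"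
proof -
  note [lin_intros] = lin_tri1[OF C] lin_tri2[OF C] lin_tri3[OF C]
  have B1: "bil \<iota> T (\<lambda>p q. C p q s)" and B2: "bil \<iota> T (\<lambda>p q. C s p q)" if "s \<in> T" for s
    using that by (auto intro!: bilI lin_intros)
  have "tsum (\<lambda>r s. tsum (\<lambda>p q. C p q s) (\<Delta> r)) (\<Delta> x) =
    tsum (\<lambda>p q. C p q x) (\<Delta> a) + tsum (\<lambda>p q. C p q b) (\<Delta> x) +
     tsum (\<lambda>r s. tsum (\<lambda>p q. C p q (s * x)) (\<Delta> (r * x))) v + tsum (\<lambda>r s. tsum (\<lambda>p q. C p q s) (\<Delta> r)) w"
    by (rule Delta_x) (auto intro!: bilI lin_intros)
  also have "\<dots> = tsum (\<lambda>p q. C p q x) (\<Delta>R a) +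
     (C a x b + C x b b + tsum (\<lambda>p q. C (p * x) (q * x) b) v + tsum (\<lambda>p q. C p q b) w) +
     tsum (\<lambda>r s. tsum (\<lambda>p q. C (p * a) (q * x) (s * x) + C (p * x) (q * b) (s * x) +
        tsum (\<lambda>p' q'. C (p * p' * x) (q * q' * x) (s * x)) v + tsum (\<lambda>p' q'. C (p * p') (q * q') (s * x)) w) (\<Delta>R r)) v +
     tsum (\<lambda>r s. tsum (\<lambda>p q. C p q s) (\<Delta>R r)) w"
    by (intro arg_cong2[where f="(+)"] tsum_cong[OF set_v] tsum_cong[OF set_w] Delta_R Delta_mult_x Delta_x B1) auto
  finally have L: "tsum (\<lambda>r s. tsum (\<lambda>p q. C p q s) (\<Delta> r)) (\<Delta> x) = \<dots>" .
  have "tsum (\<lambda>r s. tsum (\<lambda>p q. C r p q) (\<Delta> s)) (\<Delta> x) =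
    tsum (\<lambda>p q. C a p q) (\<Delta> x) + tsum (\<lambda>p q. C x p q) (\<Delta> b) +
     tsum (\<lambda>r s. tsum (\<lambda>p q. C (r * x) p q) (\<Delta> (s * x))) v + tsum (\<lambda>r s. tsum (\<lambda>p q. C r p q) (\<Delta> s)) w"
    by (rule Delta_x) (auto intro!: bilI lin_intros)
  also have "\<dots> = (C a a x + C a x b + tsum (\<lambda>p q. C a (p * x) (q * x)) v + tsum (\<lambda>p q. C a p q) w) +
     tsum (\<lambda>p q. C x p q) (\<Delta>R b) +
     tsum (\<lambda>r s. tsum (\<lambda>p q. C (r * x) (p * a) (q * x) + C (r * x) (p * x) (q * b) +
        tsum (\<lambda>p' q'. C (r * x) (p * p' * x) (q * q' * x)) v + tsum (\<lambda>p' q'. C (r * x) (p * p') (q * q')) w) (\<Delta>R s)) v +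
     tsum (\<lambda>r s. tsum (\<lambda>p q. C r p q) (\<Delta>R s)) w"
    by (intro arg_cong2[where f="(+)"] tsum_cong[OF set_v] tsum_cong[OF set_w] Delta_R Delta_mult_x Delta_x B2) auto
  finally have Rr: "tsum (\<lambda>r s. tsum (\<lambda>p q. C r p q) (\<Delta> s)) (\<Delta> x) = \<dots>" .
  show ?thesis using HT.coassoc[OF C x_T] unfolding L Rr .
qed

text \<open>Inserting coefficient maps turns a form on \<open>R\<close> into one on
  \<open>T\<close>. Evaluated on it, an identity in T \<otimes> T \<otimes> T yields its coefficient
  at x^i \<otimes> x^j \<otimes> x^k.\<close>

lemma tri_coef:
  assumes C: "tri \<iota> R C"
  shows "tri \<iota> T (\<lambda>p q r. C (coef p i) (coef q j) (coef r k))"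
proof -
  note [lin_intros] = lin_tri1[OF C] lin_tri2[OF C] lin_tri3[OF C]
  show ?thesis by (auto intro!: triI lin_intros)
qed

text \<open>The suffix names the monomial that is compared. In the second and third identities
  \<open>v\<close> is entangled with \<open>w\<close>, which is why they do not yet say that
  \<open>a\<close> and \<open>b\<close> are group-like.\<close>

lemma
  assumes C: "tri \<iota> R C"
  shows coassoc_xx1: "tsum (\<lambda>p q. C p q b) v = tsum (\<lambda>r s. tsum (\<lambda>p q. C r p (q * b)) (\<Delta>R s)) v"
    and coassoc_11x: "tsum (\<lambda>p q. C p q 1) (\<Delta>R a) +
       tsum (\<lambda>r s. tsum (\<lambda>p q. tsum (\<lambda>p' q'. C (p * p') (q * q') s) w) (\<Delta>R r)) v = C a a 1"
    and coassoc_x11: "C 1 b b = tsum (\<lambda>p q. C 1 p q) (\<Delta>R b) +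
       tsum (\<lambda>r s. tsum (\<lambda>p q. tsum (\<lambda>p' q'. C r (p * p') (q * q')) w) (\<Delta>R s)) v"
    and coassoc_111: "tsum (\<lambda>p q. C p q b) w + tsum (\<lambda>r s. tsum (\<lambda>p q. C p q s) (\<Delta>R r)) w =
       tsum (\<lambda>p q. C a p q) w + tsum (\<lambda>r s. tsum (\<lambda>p q. C r p q) (\<Delta>R s)) w"
proof -
  have [simp]: "p \<in> R \<Longrightarrow> q \<in> R \<Longrightarrow> C 0 p q = 0" "p \<in> R \<Longrightarrow> q \<in> R \<Longrightarrow> C p 0 q = 0" "p \<in> R \<Longrightarrow> q \<in> R \<Longrightarrow> C p q 0 = 0" for p q
    using C R.lin_0[of "\<lambda>z. C z p q"] R.lin_0[of "\<lambda>z. C p z q"] R.lin_0[of "\<lambda>z. C p q z"]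
    by (auto simp: tri_def)
  note c = coassoc_x[OF tri_coef[OF C]]
  show "tsum (\<lambda>p q. C p q b) v = tsum (\<lambda>r s. tsum (\<lambda>p q. C r p (q * b)) (\<Delta>R s)) v"
    using c[of 1 1 0] by (simp add: mem cong: tsum_cong_set)
  show "tsum (\<lambda>p q. C p q 1) (\<Delta>R a) +
       tsum (\<lambda>r s. tsum (\<lambda>p q. tsum (\<lambda>p' q'. C (p * p') (q * q') s) w) (\<Delta>R r)) v = C a a 1"
    using c[of 0 0 1] by (simp add: mem cong: tsum_cong_set)
  show "C 1 b b = tsum (\<lambda>p q. C 1 p q) (\<Delta>R b) +
       tsum (\<lambda>r s. tsum (\<lambda>p q. tsum (\<lambda>p' q'. C r (p * p') (q * q')) w) (\<Delta>R s)) v"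
    using c[of 1 0 0] by (simp add: mem cong: tsum_cong_set)
  show "tsum (\<lambda>p q. C p q b) w + tsum (\<lambda>r s. tsum (\<lambda>p q. C p q s) (\<Delta>R r)) w =
       tsum (\<lambda>p q. C a p q) w + tsum (\<lambda>r s. tsum (\<lambda>p q. C r p q) (\<Delta>R s)) w"
    using c[of 0 0 0] by (simp add: mem cong: tsum_cong_set)
qed

end

section \<open>Consequences of S(x) = \<alpha> x + \<beta>\<close>

locale hopf_ore_extension_linear = hopf_ore_extension +
  fixes \<alpha> \<beta>
  assumes alpha: "is_unit_in R \<alpha>" and beta_R [simp]: "\<beta> \<in> R" and S_x: "S x = \<alpha> * x + \<beta>"
begin

lemma alpha_R [simp]: "\<alpha> \<in> R"
  using alpha by (simp add: is_unit_in_def)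

text \<open>Write V for \<Sum> S(v1) v2. Since S(p x) = S(x) S(p), the antipode law at
  \<open>x\<close> is a polynomial of degree at most 2 in x, with coefficient \<alpha> \<sigma>(V)
  at x^2 and, once V = 0, S(a) + \<alpha> \<sigma>(b) at x.\<close>

lemma antipode_v: "tsum (\<lambda>p q. SR p * q) v = 0" (is "?V = 0")
  and S_a: "SR a = - (\<alpha> * \<sigma> b)"
proof -
  let ?W = "tsum (\<lambda>p q. SR p * q) w"
  have [simp]: "?V \<in> R" "?W \<in> R"
    by (auto intro!: R.closed_tsum[OF set_v] R.closed_tsum[OF set_w])
  have "tsum (\<lambda>p q. S p * q) (\<Delta> x) = \<iota> (\<epsilon> x)"
    by (rule HT.antipode) simp
  moreover have "tsum (\<lambda>p q. S p * q) (\<Delta> x) =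
    S a * x + S x * b + tsum (\<lambda>p q. S (p * x) * (q * x)) v + tsum (\<lambda>p q. S p * q) w"
    by (rule Delta_x) (auto intro!: bilI lin_intros T.lin_mult_left)
  moreover have "tsum (\<lambda>p q. S (p * x) * (q * x)) v = tsum (\<lambda>p q. S x * (SR p * q) * x) v"
    by (rule tsum_cong[OF set_v]) (simp add: HT.S_mult mult.assoc)
  moreover have "tsum (\<lambda>p q. S p * q) w = ?W"
    by (rule tsum_cong[OF set_w]) simp
  ultimately have eq: "SR a * x + (\<alpha> * x + \<beta>) * b + (\<alpha> * x + \<beta>) * ?V * x + ?W = \<iota> (\<epsilon> x)"
    by (simp add: tsum_mult_left tsum_mult_right S_x)
  have "(\<alpha> * x + \<beta>) * r = \<alpha> * \<sigma> r * x + (\<alpha> * \<delta> r + \<beta> * r)" if "r \<in> R" for r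
    using that by (simp add: algebra_simps x_commute)
  note eq = eq[unfolded this[OF b_R] this[OF \<open>?V \<in> R\<close>]]
  have xx: "coef (x * x) i = (if i = 2 then 1 else 0)" for i
    using coef_x_power[of 2 i] by (simp add: power2_eq_square)
  have "coef (SR a * x + (\<alpha> * \<sigma> b * x + (\<alpha> * \<delta> b + \<beta> * b)) + (\<alpha> * \<sigma> ?V * x + (\<alpha> * \<delta> ?V + \<beta> * ?V)) * x + ?W) 2 = 0"
    unfolding eq by simp
  then have "\<alpha> * \<sigma> ?V = 0"
    by (simp add: distrib_right mult.assoc xx)
  then have "\<sigma> ?V = \<sigma> 0" using unit_0_left[OF alpha] by simp
  then show V: "?V = 0" by (rule sigma_inj[rotated 2]) auto
  have "coef (SR a * x + (\<alpha> * \<sigma> b * x + (\<alpha> * \<delta> b + \<beta> * b)) + (\<alpha> * \<sigma> ?V * x + (\<alpha> * \<delta> ?V + \<beta> * ?V)) * x + ?W) 1 = 0"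
    unfolding eq by simp
  then show "SR a = - (\<alpha> * \<sigma> b)"
    by (simp add: V mult.assoc eq_neg_iff_add_eq_0)
qed

lemma eps_v: "tsum (\<lambda>p q. \<iota> (\<epsilon>R p) * \<iota> (\<epsilon>R q)) v = 0"
proof -
  have "tsum (\<lambda>p q. \<iota> (\<epsilon>R p) * \<iota> (\<epsilon>R q)) v = tsum (\<lambda>p q. \<iota> (\<epsilon>R (SR p * q))) v"
    by (rule tsum_cong[OF set_v]) simp
  also have "\<dots> = \<iota> (\<epsilon>R (tsum (\<lambda>p q. SR p * q) v))"
    by (rule R.lin_apply_tsum[OF HR.lin_eps set_v, symmetric]) simp
  finally show ?thesis by (simp add: antipode_v)
qed

text \<open>The coefficient of x in the left counit law is \<epsilon>(a) + \<epsilon>(x) \<Sum>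
  \<epsilon>(v1) v2 = 1. A second application of \<epsilon> removes the sum by \<open>eps_v\<close>;
  the right counit law treats b in the same way.\<close>

lemma eps_ab: "\<epsilon>R a = 1" "\<epsilon>R b = 1"
proof -
  let ?V = "tsum (\<lambda>p q. \<iota> (\<epsilon>R p) * q) v" and ?W = "tsum (\<lambda>p q. \<iota> (\<epsilon>R p) * q) w"
  have [simp]: "?V \<in> R" "?W \<in> R"
    by (auto intro!: R.closed_tsum[OF set_v] R.closed_tsum[OF set_w])
  have "x = tsum (\<lambda>p q. \<iota> (\<epsilon> p) * q) (\<Delta> x)"
    using HT.counit_left[OF lin_id x_T] by simp
  also have "\<dots> = \<iota> (\<epsilon> a) * x + \<iota> (\<epsilon> x) * b + tsum (\<lambda>p q. \<iota> (\<epsilon> (p * x)) * (q * x)) v + tsum (\<lambda>p q. \<iota> (\<epsilon> p) * q) w"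
    by (rule Delta_x) (auto intro!: bilI lin_intros T.lin_mult_left)
  also have "tsum (\<lambda>p q. \<iota> (\<epsilon> (p * x)) * (q * x)) v = tsum (\<lambda>p q. \<iota> (\<epsilon> x) * (\<iota> (\<epsilon>R p) * q) * x) v"
    by (rule tsum_cong[OF set_v]) (simp add: mult.assoc[symmetric] mult.commute[of "\<epsilon> x"] flip: T.iota_hom(3))
  also have "tsum (\<lambda>p q. \<iota> (\<epsilon> p) * q) w = ?W"
    by (rule tsum_cong[OF set_w]) simp
  finally have "coef x 1 = coef (\<iota> (\<epsilon>R a) * x + \<iota> (\<epsilon> x) * b + \<iota> (\<epsilon> x) * ?V * x + ?W) 1"
    by (simp only: tsum_mult_left tsum_mult_right eps_R[OF a_R])
  then have "\<epsilon>R (\<iota> (\<epsilon>R a) + \<iota> (\<epsilon> x) * ?V) = 1" by simp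
  moreover have "\<iota> (\<epsilon>R ?V) = tsum (\<lambda>p q. \<iota> (\<epsilon>R (\<iota> (\<epsilon>R p) * q))) v"
    by (rule R.lin_apply_tsum[OF HR.lin_eps set_v]) simp
  moreover have "\<dots> = tsum (\<lambda>p q. \<iota> (\<epsilon>R p) * \<iota> (\<epsilon>R q)) v"
    by (rule tsum_cong[OF set_v]) simp
  ultimately show "\<epsilon>R a = 1" using R.iota_inj[of "\<epsilon>R ?V" 0] by (simp add: eps_v)
next
  let ?V = "tsum (\<lambda>p q. \<iota> (\<epsilon>R q) * p) v" and ?W = "tsum (\<lambda>p q. \<iota> (\<epsilon>R q) * p) w"
  have [simp]: "?V \<in> R" "?W \<in> R"
    by (auto intro!: R.closed_tsum[OF set_v] R.closed_tsum[OF set_w])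
  have "x = tsum (\<lambda>p q. \<iota> (\<epsilon> q) * p) (\<Delta> x)"
    using HT.counit_right[OF lin_id x_T] by simp
  also have "\<dots> = \<iota> (\<epsilon> x) * a + \<iota> (\<epsilon> b) * x + tsum (\<lambda>p q. \<iota> (\<epsilon> (q * x)) * (p * x)) v + tsum (\<lambda>p q. \<iota> (\<epsilon> q) * p) w"
    by (rule Delta_x) (auto intro!: bilI lin_intros T.lin_mult_left)
  also have "tsum (\<lambda>p q. \<iota> (\<epsilon> (q * x)) * (p * x)) v = tsum (\<lambda>p q. \<iota> (\<epsilon> x) * (\<iota> (\<epsilon>R q) * p) * x) v"
    by (rule tsum_cong[OF set_v]) (simp add: mult.assoc[symmetric] mult.commute[of "\<epsilon> x"] flip: T.iota_hom(3))
  also have "tsum (\<lambda>p q. \<iota> (\<epsilon> q) * p) w = ?W"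
    by (rule tsum_cong[OF set_w]) simp
  finally have "coef x 1 = coef (\<iota> (\<epsilon> x) * a + \<iota> (\<epsilon>R b) * x + \<iota> (\<epsilon> x) * ?V * x + ?W) 1"
    by (simp only: tsum_mult_left tsum_mult_right eps_R[OF b_R])
  then have "\<epsilon>R (\<iota> (\<epsilon>R b) + \<iota> (\<epsilon> x) * ?V) = 1" by simp
  moreover have "\<iota> (\<epsilon>R ?V) = tsum (\<lambda>p q. \<iota> (\<epsilon>R (\<iota> (\<epsilon>R q) * p))) v"
    by (rule R.lin_apply_tsum[OF HR.lin_eps set_v]) simp
  moreover have "\<dots> = tsum (\<lambda>p q. \<iota> (\<epsilon>R p) * \<iota> (\<epsilon>R q)) v"
    by (rule tsum_cong[OF set_v]) (simp add: mult.commute flip: R.iota_hom(3))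
  ultimately show "\<epsilon>R b = 1" using R.iota_inj[of "\<epsilon>R ?V" 0] by (simp add: eps_v)
qed

text \<open>Antimultiplicativity places S(r1) r2 in the middle of S(w1) S(r1) r2 w2, where it
  collapses to a central scalar.\<close>

lemma antipode_Delta_w:
  assumes [simp]: "r \<in> R"
  shows "tsum (\<lambda>p q. tsum (\<lambda>p' q'. SR (p * p') * (q * q')) w) (\<Delta>R r) = \<iota> (\<epsilon>R r) * tsum (\<lambda>p q. SR p * q) w"
proof -
  have "tsum (\<lambda>p q. tsum (\<lambda>p' q'. SR (p * p') * (q * q')) w) (\<Delta>R r) =
    tsum (\<lambda>p' q'. tsum (\<lambda>p q. SR (p * p') * (q * q')) (\<Delta>R r)) w"
    by (rule tsum_swap)
  also have "\<dots> = tsum (\<lambda>p' q'. SR p' * tsum (\<lambda>p q. SR p * q) (\<Delta>R r) * q') w"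
    by (simp add: HR.S_mult mem mult.assoc cong: tsum_cong_set flip: tsum_mult_left tsum_mult_right)
  also have "\<dots> = tsum (\<lambda>p' q'. \<iota> (\<epsilon>R r) * (SR p' * q')) w"
    by (rule tsum_cong[OF set_w]) (simp add: HR.antipode R.central[OF HR.S_closed] mult.assoc flip: mult.assoc[of "SR _"])
  finally show ?thesis by (simp add: tsum_mult_left)
qed

text \<open>The counit is applied to the leg that does not stem from \<Delta>(a) or \<Delta>(b), the
  antipode law to the other two. The mixed term in v and w becomes \<Sum> \<epsilon>(v1)
  \<epsilon>(v2) times \<Sum> S(w1) w2, hence 0, and the coproduct collapses to \<epsilon>(a) = 1 or
  \<epsilon>(b) = 1.\<close>

lemma S_a_a: "SR a * a = 1" and S_b_b: "SR b * b = 1"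
proof -
  let ?W = "tsum (\<lambda>p q. SR p * q) w"
  have [simp]: "?W \<in> R" by (auto intro!: R.closed_tsum[OF set_w])
  have "tsum (\<lambda>p q. \<iota> (\<epsilon>R 1) * (SR p * q)) (\<Delta>R a) +
       tsum (\<lambda>r s. tsum (\<lambda>p q. tsum (\<lambda>p' q'. \<iota> (\<epsilon>R s) * (SR (p * p') * (q * q'))) w) (\<Delta>R r)) v = \<iota> (\<epsilon>R 1) * (SR a * a)"
    by (rule coassoc_11x) (auto intro!: triI lin_intros R.lin_mult_left)
  moreover have "tsum (\<lambda>r s. tsum (\<lambda>p q. tsum (\<lambda>p' q'. \<iota> (\<epsilon>R s) * (SR (p * p') * (q * q'))) w) (\<Delta>R r)) v =
    tsum (\<lambda>r s. \<iota> (\<epsilon>R r) * \<iota> (\<epsilon>R s) * ?W) v"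
    by (rule tsum_cong[OF set_v]) (simp add: tsum_mult_left antipode_Delta_w, metis mult.assoc mult.commute R.iota_hom(3))
  ultimately show "SR a * a = 1"
    by (simp add: tsum_mult_right eps_v HR.antipode eps_ab)
  have "\<iota> (\<epsilon>R 1) * (SR b * b) = tsum (\<lambda>p q. \<iota> (\<epsilon>R 1) * (SR p * q)) (\<Delta>R b) +
       tsum (\<lambda>r s. tsum (\<lambda>p q. tsum (\<lambda>p' q'. \<iota> (\<epsilon>R r) * (SR (p * p') * (q * q'))) w) (\<Delta>R s)) v"
    by (rule coassoc_x11) (auto intro!: triI lin_intros R.lin_mult_left)
  moreover have "tsum (\<lambda>r s. tsum (\<lambda>p q. tsum (\<lambda>p' q'. \<iota> (\<epsilon>R r) * (SR (p * p') * (q * q'))) w) (\<Delta>R s)) v =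
    tsum (\<lambda>r s. \<iota> (\<epsilon>R r) * \<iota> (\<epsilon>R s) * ?W) v"
    by (rule tsum_cong[OF set_v]) (simp add: tsum_mult_left antipode_Delta_w mult.assoc)
  ultimately show "SR b * b = 1"
    by (simp add: tsum_mult_right eps_v HR.antipode eps_ab)
qed

text \<open>The left inverse of \<open>b\<close> makes \<open>SR a = - \<alpha> * \<sigma> b\<close> left invertible, and \<open>a\<close> is a right inverse of it.\<close>

lemma b_S_b: "b * SR b = 1"
proof -
  obtain \<alpha>' where \<alpha>': "\<alpha>' \<in> R" "\<alpha> * \<alpha>' = 1" "\<alpha>' * \<alpha> = 1" using alpha by (auto simp: is_unit_in_def)
  have 1: "\<sigma> (SR b) * \<sigma> b = 1" using arg_cong[OF S_b_b, of \<sigma>] by simp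
  have "\<sigma> b * - (a * \<alpha>) = \<alpha>' * (- (\<alpha> * \<sigma> b) * a) * \<alpha>"
    using \<alpha>' by (simp flip: mult.assoc)
  also have "\<dots> = 1" using \<alpha>' S_a_a by (simp flip: S_a)
  finally have 2: "\<sigma> b * - (a * \<alpha>) = 1" .
  \<comment> \<open>A left and a right inverse of \<open>\<sigma> b\<close> coincide, so
    \<open>\<sigma> (SR b)\<close> is a right inverse too; injectivity of \<sigma> brings this back
    to \<open>b\<close>.\<close>
  have "\<sigma> (SR b) = \<sigma> (SR b) * (\<sigma> b * - (a * \<alpha>))" unfolding 2 by simp
  also have "\<dots> = - (a * \<alpha>)" using 1 by (simp flip: mult.assoc)
  finally have "\<sigma> (b * SR b) = \<sigma> 1" using 2 by simp
  then show ?thesis by (rule sigma_inj[rotated 2]) auto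
qed

text \<open>Cancelling b in \<open>coassoc_xx1\<close> and applying the counit to the middle leg
  shows v = V \<otimes> 1 with V = \<Sum> v1 \<epsilon>(v2). Then S(V) = \<Sum> S(v1) v2 = 0, and
  injectivity of the antipode gives V = 0.\<close>

lemma tsum_v:
  assumes B: "bil \<iota> R B"
  shows "tsum B v = 0"
proof -
  have *: "tsum B v = tsum (\<lambda>r s. B r (\<iota> (\<epsilon>R s))) v" if B: "bil \<iota> R B" for B
  proof -
    note [lin_intros] = lin_bil1[OF B] lin_bil2[OF B]
    \<comment> \<open>The test form sends (p, q, z) to
      \<open>B p (\<iota> (\<epsilon>R q) * (z * SR b))\<close>: its last factor cancels
      \<open>b\<close>, its counit removes the middle leg.\<close>
    have "tsum (\<lambda>r s. B r (\<iota> (\<epsilon>R s) * (b * SR b))) v = tsum (\<lambda>r s. tsum (\<lambda>p q. B r (\<iota> (\<epsilon>R p) * (q * b * SR b))) (\<Delta>R s)) v"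
      by (rule coassoc_xx1) (auto intro!: triI lin_intros R.lin_mult_left)
    also have "\<dots> = tsum (\<lambda>r s. B r (tsum (\<lambda>p q. \<iota> (\<epsilon>R p) * q) (\<Delta>R s))) v"
    proof (rule tsum_cong[OF set_v])
      fix r s assume [simp]: "r \<in> R" "s \<in> R"
      show "tsum (\<lambda>p q. B r (\<iota> (\<epsilon>R p) * (q * b * SR b))) (\<Delta>R s) = B r (tsum (\<lambda>p q. \<iota> (\<epsilon>R p) * q) (\<Delta>R s))"
        by (subst R.lin_apply_tsum[of "B r", OF _ HR.set_Delta]) (use B in \<open>auto simp: mult.assoc b_S_b bil_def\<close>)
    qed
    also have "\<dots> = tsum B v"
      by (rule tsum_cong[OF set_v]) (simp add: HR.counit_left[OF lin_id])
    finally show ?thesis by (simp add: b_S_b)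
  qed
  let ?V = "tsum (\<lambda>r s. \<iota> (\<epsilon>R s) * r) v"
  have [simp]: "?V \<in> R" by (auto intro!: R.closed_tsum[OF set_v])
  have "SR ?V = tsum (\<lambda>r s. SR (\<iota> (\<epsilon>R s) * r)) v"
    by (rule R.lin_apply_tsum[OF HR.lin_S set_v]) auto
  also have "\<dots> = tsum (\<lambda>r s. SR r * \<iota> (\<epsilon>R s)) v"
    by (rule tsum_cong[OF set_v]) (auto simp: HR.S_mult)
  also have "\<dots> = tsum (\<lambda>r s. SR r * s) v"
    by (rule *[symmetric]) (auto intro!: bilI lin_intros R.lin_mult_left)
  finally have "SR ?V = SR 0" by (simp add: antipode_v R.lin_0[OF HR.lin_S])
  then have V: "?V = 0" by (rule HR.S_inj[rotated 2]) auto
  have "tsum B v = tsum (\<lambda>r s. B (\<iota> (\<epsilon>R s) * r) 1) v"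
    unfolding *[OF B]
  proof (rule tsum_cong[OF set_v])
    fix r s assume "r \<in> R" "s \<in> R"
    then have "B r (\<iota> (\<epsilon>R s) * 1) = \<iota> (\<epsilon>R s) * B r 1" "B (\<iota> (\<epsilon>R s) * r) 1 = \<iota> (\<epsilon>R s) * B r 1"
      using B R.closed(2) unfolding bil_def lin_def by blast+
    then show "B r (\<iota> (\<epsilon>R s)) = B (\<iota> (\<epsilon>R s) * r) 1" by simp
  qed
  also have "\<dots> = B ?V 1"
    by (rule R.lin_apply_tsum[OF _ set_v, symmetric]) (use B in \<open>auto simp: bil_def\<close>)
  finally show ?thesis using B R.lin_0[of "\<lambda>z. B z 1"] by (simp add: V bil_def)
qed

lemma v_eq_0: "teq \<iota> R v []"
  by (simp add: R.teq_iff_bil tsum_v)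

text \<open>With v = 0 the mixed terms drop out of \<open>coassoc_11x\<close> and
  \<open>coassoc_x11\<close>; the counit on the leg carrying 1 strips it off.\<close>

lemma grouplike_a: "grouplike \<iota> R \<Delta>R a" and grouplike_b: "grouplike \<iota> R \<Delta>R b"
proof -
  have "tsum B (\<Delta>R a) = B a a" "tsum B (\<Delta>R b) = B b b" if B: "bil \<iota> R B" for B
  proof -
    note [lin_intros] = lin_bil1[OF B] lin_bil2[OF B]
    have "tsum (\<lambda>p q. \<iota> (\<epsilon>R 1) * B p q) (\<Delta>R a) +
       tsum (\<lambda>r s. tsum (\<lambda>p q. tsum (\<lambda>p' q'. \<iota> (\<epsilon>R s) * B (p * p') (q * q')) w) (\<Delta>R r)) v = \<iota> (\<epsilon>R 1) * B a a"
      by (rule coassoc_11x) (auto intro!: triI lin_intros R.lin_mult_left)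
    moreover have "tsum (\<lambda>r s. tsum (\<lambda>p q. tsum (\<lambda>p' q'. \<iota> (\<epsilon>R s) * B (p * p') (q * q')) w) (\<Delta>R r)) v = 0"
      by (rule tsum_v) (auto intro!: bilI lin_intros R.lin_mult_left)
    ultimately show "tsum B (\<Delta>R a) = B a a" by simp
    have "\<iota> (\<epsilon>R 1) * B b b = tsum (\<lambda>p q. \<iota> (\<epsilon>R 1) * B p q) (\<Delta>R b) +
       tsum (\<lambda>r s. tsum (\<lambda>p q. tsum (\<lambda>p' q'. \<iota> (\<epsilon>R r) * B (p * p') (q * q')) w) (\<Delta>R s)) v"
      by (rule coassoc_x11) (auto intro!: triI lin_intros R.lin_mult_left)
    moreover have "tsum (\<lambda>r s. tsum (\<lambda>p q. tsum (\<lambda>p' q'. \<iota> (\<epsilon>R r) * B (p * p') (q * q')) w) (\<Delta>R s)) v = 0"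
      by (rule tsum_v) (auto intro!: bilI lin_intros R.lin_mult_left)
    ultimately show "tsum B (\<Delta>R b) = B b b" by simp
  qed
  moreover have "a \<noteq> 0" "b \<noteq> 0" using S_a_a S_b_b by auto
  ultimately show "grouplike \<iota> R \<Delta>R a" "grouplike \<iota> R \<Delta>R b"
    by (auto simp: grouplike_def R.teq_iff_bil)
qed

text \<open>The new variable is x b^(-1) - \<epsilon>(x). Right multiplication by the group-like
  b^(-1) turns x \<otimes> b into x b^(-1) \<otimes> 1, the shift makes the counit vanish, and
  \<open>a\<close> becomes a b^(-1).\<close>

lemma normalize:
  "\<exists>x' \<sigma>' \<delta>' a' w'. ore_ext \<iota> R T x' \<sigma>' \<delta>' \<and> a' \<in> R \<and> set w' \<subseteq> R \<times> R \<and>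
     \<epsilon> x' = 0 \<and> teq \<iota> T (\<Delta> x') ([(a', x'), (x', 1)] @ w')"
proof -
  let ?b = "SR b"
  define c where "c = \<iota> (\<epsilon> x)"
  define x' where "x' = x * ?b - c"
  \<comment> \<open>The added tensor appears on replacing x b^(-1) by \<open>x' + c\<close> in the
    second leg of a b^(-1) \<otimes> x b^(-1); the same replacement in the first leg of x b^(-1)
    \<otimes> 1 gives c 1 \<otimes> 1, which \<Delta>(-c) cancels.\<close>
  define w' where "w' = tmul w [(?b, ?b)] @ [(c * (a * ?b), 1)]"
  have [simp]: "c \<in> R" "x' \<in> T" by (simp_all add: c_def x'_def)
  have "is_unit_in R (\<sigma> ?b)"
    by (rule unit_sigma) (use b_S_b S_b_b in \<open>auto simp: is_unit_in_def\<close>)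
  \<comment> \<open>With its coefficients moved to the left, x b^(-1) - c is a linear polynomial
    with unit leading coefficient \<sigma>(b^(-1)).\<close>
  then obtain \<sigma>' \<delta>' where "ore_ext \<iota> R T (\<sigma> ?b * x + (\<delta> ?b - c)) \<sigma>' \<delta>'"
    using change_of_variable[of "\<sigma> ?b" "\<delta> ?b - c"] by auto
  then have ore': "ore_ext \<iota> R T x' \<sigma>' \<delta>'" by (simp add: x'_def x_commute add_diff_eq)
  have eps: "\<epsilon> x' = 0" by (simp add: x'_def c_def eps_ab)
  have w': "set w' \<subseteq> R \<times> R"
    using set_tmul[OF set_w, of "[(?b, ?b)]"] by (auto simp: w'_def)
  have "tsum B (\<Delta> x') = B (a * ?b) x' + B x' 1 + tsum B w'" if B: "bil \<iota> T B" for B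
  proof -
    note [lin_intros] = lin_bil1[OF B] lin_bil2[OF B]
    have add: "B p (q + q') = B p q + B p q'" "B (q + q') p = B q p + B q' p" if "p \<in> T" "q \<in> T" "q' \<in> T" for p q q'
      using that B by (simp_all add: bil_def lin_def)
    have sc: "B p (c * q) = c * B p q" "B (c * q) p = c * B q p" if "p \<in> T" "q \<in> T" for p q
      unfolding c_def using that B unfolding bil_def lin_def by blast+
    have xb: "x * ?b = x' + c * 1" by (simp add: x'_def)
    have L: "lin \<iota> T (\<lambda>t. tsum B (\<Delta> t))" using B by (rule HT.lin_Delta)
    have "tsum B (\<Delta> (c * 1)) = c * tsum B (\<Delta> 1)"
      unfolding c_def using L T.closed(2) unfolding lin_def by blast
    moreover have "tsum B (\<Delta> (x' + c * 1)) = tsum B (\<Delta> x') + tsum B (\<Delta> (c * 1))"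
      using L by (simp add: lin_def)
    ultimately have "tsum B (\<Delta> x') + c * B 1 1 = tsum B (\<Delta> (x * ?b))"
      unfolding xb HT.tsum_Delta_1[OF B] by (simp only:)
    also have "\<dots> = tsum (\<lambda>u v. tsum (\<lambda>u' v'. B (u * u') (v * v')) (\<Delta> ?b)) (\<Delta> x)"
      by (rule HT.tsum_Delta_mult[OF B]) auto
    also have "\<dots> = tsum (\<lambda>u v. B (u * ?b) (v * ?b)) (\<Delta> x)"
    proof (rule tsum_cong[OF HT.set_Delta[OF x_T]])
      fix u v assume [simp]: "u \<in> T" "v \<in> T"
      have B': "bil \<iota> T (\<lambda>u' v'. B (u * u') (v * v'))"
        by (auto intro!: bilI lin_intros T.lin_mult_left)
      have "tsum (\<lambda>u' v'. B (u * u') (v * v')) (\<Delta> ?b) = tsum (\<lambda>u' v'. B (u * u') (v * v')) (\<Delta>R ?b)"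
        by (rule Delta_R) (auto intro: B')
      also have "\<dots> = B (u * ?b) (v * ?b)"
        by (rule HR.Delta_S_grouplike[OF grouplike_b]) (rule bil_mono[OF B' R_T])
      finally show "tsum (\<lambda>u' v'. B (u * u') (v * v')) (\<Delta> ?b) = B (u * ?b) (v * ?b)" .
    qed
    also have "\<dots> = B (a * ?b) (x * ?b) + B (x * ?b) (b * ?b) +
       tsum (\<lambda>p q. B (p * x * ?b) (q * x * ?b)) v + tsum (\<lambda>p q. B (p * ?b) (q * ?b)) w"
      by (rule Delta_x) (auto intro!: bilI lin_intros)
    also have "tsum (\<lambda>p q. B (p * x * ?b) (q * x * ?b)) v = 0"
      by (rule tsum_v) (auto intro!: bilI lin_intros)
    also have "B (a * ?b) (x * ?b) = B (a * ?b) x' + c * B (a * ?b) 1"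
      unfolding xb by (simp add: add sc del: mult_1_right)
    also have "B (x * ?b) (b * ?b) = B x' 1 + c * B 1 1"
      unfolding xb b_S_b by (simp add: add sc del: mult_1_right)
    finally show ?thesis by (simp add: w'_def sc)
  qed
  then have "teq \<iota> T (\<Delta> x') ([(a * ?b, x'), (x', 1)] @ w')"
    by (simp add: T.teq_iff_bil add.assoc)
  moreover have "a * ?b \<in> R" by simp
  ultimately show ?thesis using ore' eps w' by blast
qed

end

section \<open>The normalized case: v = 0, b = 1, \<epsilon>(x) = 0\<close>

locale normalized_hopf_ore_extension =
  hopf_ore_extension_linear \<iota> R \<Delta>R \<epsilon>R SR T \<Delta> \<epsilon> S x \<sigma> \<delta> a 1 "[]" w \<alpha> \<beta>
  for \<iota> :: "'f::field \<Rightarrow> 't::ring_1" and R \<Delta>R \<epsilon>R SR T \<Delta> \<epsilon> S x \<sigma> \<delta> a w \<alpha> \<beta> +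
  assumes eps_x: "\<epsilon> x = 0"
begin

lemma a_S_a: "a * SR a = 1" and uinv_a: "uinv R a = SR a"
  using HR.grouplike_S[OF grouplike_a] HR.uinv_grouplike[OF grouplike_a] by auto

lemma S_x_formula: "S x = - (uinv R a * (x + tsum (\<lambda>u v. u * S v) w))"
proof -
  let ?W = "tsum (\<lambda>u v. u * S v) w"
  have "tsum (\<lambda>p q. p * S q) (\<Delta> x) = a * S x + x * S 1 + tsum (\<lambda>p q. p * x * S (q * x)) [] + ?W"
    by (rule Delta_x) (auto intro!: bilI lin_intros T.lin_mult_left)
  then have "a * S x + x + ?W = 0"
    by (simp add: HT.antipode eps_x)
  then have "SR a * (a * S x + x + ?W) = 0" by simp
  then have "S x + SR a * (x + ?W) = 0"
    by (simp add: distrib_left S_a_a add.assoc flip: mult.assoc)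
  then show ?thesis by (simp add: uinv_a eq_neg_iff_add_eq_0)
qed

text \<open>The two antipode laws at \<open>x\<close> each determine S(x); equating the results
  leaves this condition on w.\<close>

lemma S_w: "tsum (\<lambda>u v. SR u * v) w = uinv R a * tsum (\<lambda>u v. u * SR v) w"
proof -
  let ?W = "tsum (\<lambda>u v. SR u * v) w"
  have "tsum (\<lambda>p q. S p * q) (\<Delta> x) = S a * x + S x * 1 + tsum (\<lambda>p q. S (p * x) * (q * x)) [] + tsum (\<lambda>u v. S u * v) w"
    by (rule Delta_x) (auto intro!: bilI lin_intros T.lin_mult_left)
  moreover have "tsum (\<lambda>u v. S u * v) w = ?W" "tsum (\<lambda>u v. u * S v) w = tsum (\<lambda>u v. u * SR v) w"
    by (rule tsum_cong[OF set_w], simp)+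
  ultimately show ?thesis
    by (simp add: HT.antipode eps_x S_x_formula uinv_a algebra_simps)
qed

text \<open>The two counit laws at \<open>x\<close> say that contracting either leg of w with
  \<epsilon> gives 0. Projecting both legs by u - \<epsilon>(u) therefore does not change the
  tensor, and the projected list is the representative asked for.\<close>

lemma w_augmentation: "\<exists>ws. set ws \<subseteq> augideal R \<epsilon>R \<times> augideal R \<epsilon>R \<and> teq \<iota> R w ws"
proof -
  have "tsum (\<lambda>p q. \<iota> (\<epsilon> p) * q) (\<Delta> x) = \<iota> (\<epsilon> a) * x + \<iota> (\<epsilon> x) * 1 + tsum (\<lambda>p q. \<iota> (\<epsilon> (p * x)) * (q * x)) [] + tsum (\<lambda>p q. \<iota> (\<epsilon> p) * q) w"
    by (rule Delta_x) (auto intro!: bilI lin_intros T.lin_mult_left)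
  then have 1: "tsum (\<lambda>p q. \<iota> (\<epsilon> p) * q) w = 0"
    by (simp add: HT.counit_left[OF lin_id] eps_x eps_ab)
  have "tsum (\<lambda>p q. \<iota> (\<epsilon> q) * p) (\<Delta> x) = \<iota> (\<epsilon> x) * a + \<iota> (\<epsilon> 1) * x + tsum (\<lambda>p q. \<iota> (\<epsilon> (q * x)) * (p * x)) [] + tsum (\<lambda>p q. \<iota> (\<epsilon> q) * p) w"
    by (rule Delta_x) (auto intro!: bilI lin_intros T.lin_mult_left)
  then have 2: "tsum (\<lambda>p q. \<iota> (\<epsilon> q) * p) w = 0"
    by (simp add: HT.counit_right[OF lin_id] eps_x eps_ab)
  let ?f = "\<lambda>u. u - \<iota> (\<epsilon>R u)"
  have f: "?f u \<in> augideal R \<epsilon>R" if "u \<in> R" for u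
    using that by (simp add: augideal_def)
  let ?ws = "map (\<lambda>(u, v). (?f u, ?f v)) w"
  have "set ?ws \<subseteq> augideal R \<epsilon>R \<times> augideal R \<epsilon>R"
    using set_w f by auto
  moreover have "tsum B ?ws = tsum B w" if B: "bil \<iota> R B" for B
  proof -
    have lin: "lin \<iota> R (\<lambda>z. B z p)" "lin \<iota> R (B p)" if "p \<in> R" for p
      using that B by (simp_all add: bil_def)
    \<comment> \<open>The last three terms are arranged so that each, summed over w, is linear in
      one of the two vanishing contractions.\<close>
    have "B (?f u) (?f v) = B u v - B 1 (\<iota> (\<epsilon> u) * v) - B (\<iota> (\<epsilon> v) * u) 1 + B 1 (\<iota> (\<epsilon> u) * (\<iota> (\<epsilon>R v) * 1))"
      if [simp]: "u \<in> R" "v \<in> R" for u v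
    proof -
      have d: "B (p - q) r = B p r - B q r" "B r (p - q) = B r p - B r q" if [simp]: "p \<in> R" "q \<in> R" "r \<in> R" for p q r
      proof -
        have "B ((p - q) + q) r = B (p - q) r + B q r" "B r ((p - q) + q) = B r (p - q) + B r q"
          using lin[of r] unfolding lin_def by (metis R.closed_diff that)+
        then show "B (p - q) r = B p r - B q r" "B r (p - q) = B r p - B r q" by simp_all
      qed
      have s: "B (\<iota> c * p) r = \<iota> c * B p r" "B r (\<iota> c * p) = \<iota> c * B r p" if "p \<in> R" "r \<in> R" for c p r
        using lin[of r] that unfolding lin_def by blast+
      have s1: "B (\<iota> c) r = \<iota> c * B 1 r" "B r (\<iota> c) = \<iota> c * B r 1" if "r \<in> R" for c r
        using s[of 1 r c] that by simp_all
      have "\<iota> (\<epsilon>R v) * (\<iota> (\<epsilon>R u) * z) = \<iota> (\<epsilon>R u) * (\<iota> (\<epsilon>R v) * z)" for z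
        by (metis mult.assoc mult.commute R.iota_hom(3))
      then show ?thesis by (simp add: d s s1 algebra_simps del: mult_1_right)
    qed
    then have "tsum B ?ws = tsum (\<lambda>u v. B u v - B 1 (\<iota> (\<epsilon> u) * v) - B (\<iota> (\<epsilon> v) * u) 1 + B 1 (\<iota> (\<epsilon> u) * (\<iota> (\<epsilon>R v) * 1))) w"
      unfolding tsum_map by (intro tsum_cong[OF set_w])
    also have "\<dots> = tsum B w - tsum (\<lambda>u v. B 1 (\<iota> (\<epsilon> u) * v)) w - tsum (\<lambda>u v. B (\<iota> (\<epsilon> v) * u) 1) w
        + tsum (\<lambda>u v. B 1 (\<iota> (\<epsilon> u) * (\<iota> (\<epsilon>R v) * 1))) w"
      by (simp add: tsum_diff tsum_add)
    also have "tsum (\<lambda>u v. B 1 (\<iota> (\<epsilon> u) * v)) w = B 1 (tsum (\<lambda>u v. \<iota> (\<epsilon> u) * v) w)"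
      by (rule R.lin_apply_tsum[OF lin(2) set_w, symmetric]) auto
    also have "tsum (\<lambda>u v. B (\<iota> (\<epsilon> v) * u) 1) w = B (tsum (\<lambda>u v. \<iota> (\<epsilon> v) * u) w) 1"
      by (rule R.lin_apply_tsum[OF lin(1) set_w, symmetric]) auto
    also have "tsum (\<lambda>u v. B 1 (\<iota> (\<epsilon> u) * (\<iota> (\<epsilon>R v) * 1))) w = B 1 (\<iota> (\<epsilon>R (tsum (\<lambda>u v. \<iota> (\<epsilon> u) * v) w)))"
    proof -
      have l: "lin \<iota> R (\<lambda>z. B 1 (\<iota> (\<epsilon>R z)))"
        by (rule lin_comp[OF lin(2) HR.lin_eps]) auto
      have "B 1 (\<iota> (\<epsilon>R (tsum (\<lambda>u v. \<iota> (\<epsilon> u) * v) w))) = tsum (\<lambda>u v. B 1 (\<iota> (\<epsilon>R (\<iota> (\<epsilon> u) * v)))) w"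
        by (rule R.lin_apply_tsum[OF l set_w]) auto
      also have "\<dots> = tsum (\<lambda>u v. B 1 (\<iota> (\<epsilon> u) * (\<iota> (\<epsilon>R v) * 1))) w"
        by (rule tsum_cong[OF set_w]) simp
      finally show ?thesis ..
    qed
    finally show ?thesis
      unfolding 1 2 using R.lin_0[OF lin(1)] R.lin_0[OF lin(2)] by simp
  qed
  ultimately show ?thesis by (intro exI[of _ ?ws]) (simp add: R.teq_iff_bil)
qed

lemma w_cocycle:
  "teq3 \<iota> R (map (\<lambda>(u, v). (u, v, 1)) w @ DeltaId \<Delta>R w) (map (\<lambda>(u, v). (a, u, v)) w @ IdDelta \<Delta>R w)"
  unfolding R.teq3_iff_tri using coassoc_111 by simp

text \<open>\<Delta>(x r) is computed as \<Delta>(x) \<Delta>(r) and, since x r = \<sigma>(r) x +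
  \<delta>(r), as \<Delta>(\<sigma>(r)) \<Delta>(x) + \<Delta>(\<delta>(r)).\<close>

lemma Delta_x_mult:
  assumes [simp]: "r \<in> R" and B: "bil \<iota> T B"
  shows "tsum (\<lambda>p q. B (a * p) (x * q)) (\<Delta>R r) + tsum (\<lambda>p q. B (x * p) q) (\<Delta>R r) +
     tsum (\<lambda>u v. tsum (\<lambda>p q. B (u * p) (v * q)) (\<Delta>R r)) w =
     tsum (\<lambda>p q. B (p * a) (q * x) + B (p * x) q + tsum (\<lambda>u v. B (p * u) (q * v)) w) (\<Delta>R (\<sigma> r)) +
     tsum B (\<Delta>R (\<delta> r))"
proof -
  note [lin_intros] = lin_bil1[OF B] lin_bil2[OF B]
  have B': "bil \<iota> T (\<lambda>p q. B (u * p) (v * q))" if "u \<in> T" "v \<in> T" for u v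
    using that by (auto intro!: bilI lin_intros T.lin_mult_left)
  have "tsum B (\<Delta> (x * r)) = tsum (\<lambda>u v. tsum (\<lambda>p q. B (u * p) (v * q)) (\<Delta> r)) (\<Delta> x)"
    by (rule HT.tsum_Delta_mult[OF B]) auto
  also have "\<dots> = tsum (\<lambda>u v. tsum (\<lambda>p q. B (u * p) (v * q)) (\<Delta>R r)) (\<Delta> x)"
    by (intro tsum_cong[OF HT.set_Delta[OF x_T]] Delta_R B') auto
  also have "\<dots> = tsum (\<lambda>p q. B (a * p) (x * q)) (\<Delta>R r) + tsum (\<lambda>p q. B (x * p) (1 * q)) (\<Delta>R r) +
     tsum (\<lambda>u v. tsum (\<lambda>p q. B (u * x * p) (v * x * q)) (\<Delta>R r)) [] +
     tsum (\<lambda>u v. tsum (\<lambda>p q. B (u * p) (v * q)) (\<Delta>R r)) w"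
    by (rule Delta_x) (auto intro!: bilI lin_intros T.lin_mult_left)
  also have "\<dots> = tsum (\<lambda>p q. B (a * p) (x * q)) (\<Delta>R r) + tsum (\<lambda>p q. B (x * p) q) (\<Delta>R r) +
     tsum (\<lambda>u v. tsum (\<lambda>p q. B (u * p) (v * q)) (\<Delta>R r)) w" by simp
  finally have 1: "tsum B (\<Delta> (x * r)) = \<dots>" .
  have L: "lin \<iota> T (\<lambda>t. tsum B (\<Delta> t))" using B by (rule HT.lin_Delta)
  have "tsum B (\<Delta> (x * r)) = tsum B (\<Delta> (\<sigma> r * x)) + tsum B (\<Delta> (\<delta> r))"
    using L by (simp add: x_commute lin_def)
  also have "\<dots> = tsum (\<lambda>p q. B (p * a) (q * x) + B (p * x) q + tsum (\<lambda>u v. B (p * u) (q * v)) w) (\<Delta>R (\<sigma> r)) +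
     tsum B (\<Delta>R (\<delta> r))"
    by (simp add: Delta_mult_x[OF _ B] Delta_R[OF _ B])
  finally show ?thesis unfolding 1 .
qed

text \<open>The coefficients at x \<otimes> 1, 1 \<otimes> x and 1 \<otimes> 1 of the two
  expressions for \<Delta>(x r).\<close>

lemma
  assumes [simp]: "r \<in> R" and B: "bil \<iota> R B"
  shows Delta_sigma_left: "tsum B (\<Delta>R (\<sigma> r)) = tsum (\<lambda>p q. B (\<sigma> p) q) (\<Delta>R r)"
    and Delta_sigma_right: "tsum (\<lambda>p q. B (p * a) q) (\<Delta>R (\<sigma> r)) = tsum (\<lambda>p q. B (a * p) (\<sigma> q)) (\<Delta>R r)"
    and Delta_delta: "tsum (\<lambda>p q. B (a * p) (\<delta> q)) (\<Delta>R r) + tsum (\<lambda>p q. B (\<delta> p) q) (\<Delta>R r) +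
       tsum (\<lambda>u v. tsum (\<lambda>p q. B (u * p) (v * q)) (\<Delta>R r)) w =
       tsum (\<lambda>p q. tsum (\<lambda>u v. B (p * u) (q * v)) w) (\<Delta>R (\<sigma> r)) + tsum B (\<Delta>R (\<delta> r))"
proof -
  note [lin_intros] = lin_bil1[OF B] lin_bil2[OF B]
  have [simp]: "p \<in> R \<Longrightarrow> B 0 p = 0" "p \<in> R \<Longrightarrow> B p 0 = 0" for p
    using B R.lin_0[of "\<lambda>z. B z p"] R.lin_0[of "\<lambda>z. B p z"] by (auto simp: bil_def)
  have "bil \<iota> T (\<lambda>p q. B (coef p i) (coef q j))" for i j
    by (auto intro!: bilI lin_intros)
  note c = Delta_x_mult[OF assms(1) this]
  show "tsum B (\<Delta>R (\<sigma> r)) = tsum (\<lambda>p q. B (\<sigma> p) q) (\<Delta>R r)"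
    using c[of 1 0] by (simp add: mem x_commute cong: tsum_cong_set)
  show "tsum (\<lambda>p q. B (p * a) q) (\<Delta>R (\<sigma> r)) = tsum (\<lambda>p q. B (a * p) (\<sigma> q)) (\<Delta>R r)"
    using c[of 0 1] by (simp add: mem x_commute cong: tsum_cong_set)
  show "tsum (\<lambda>p q. B (a * p) (\<delta> q)) (\<Delta>R r) + tsum (\<lambda>p q. B (\<delta> p) q) (\<Delta>R r) +
       tsum (\<lambda>u v. tsum (\<lambda>p q. B (u * p) (v * q)) (\<Delta>R r)) w =
       tsum (\<lambda>p q. tsum (\<lambda>u v. B (p * u) (q * v)) w) (\<Delta>R (\<sigma> r)) + tsum B (\<Delta>R (\<delta> r))"
    using c[of 0 0] by (simp add: mem x_commute cong: tsum_cong_set)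
qed

lemma winding:
  "\<exists>\<chi>. character \<iota> R \<chi> \<and>
     (\<forall>r\<in>R. \<sigma> r = tsum (\<lambda>u v. \<iota> (\<chi> u) * v) (\<Delta>R r) \<and>
             \<sigma> r = tsum (\<lambda>u v. a * u * uinv R a * \<iota> (\<chi> v)) (\<Delta>R r))"
proof (intro exI conjI ballI)
  let ?\<chi> = "\<lambda>r. \<epsilon>R (\<sigma> r)"
  have sc: "\<sigma> (\<iota> c * r) = \<iota> c * \<sigma> r" if "r \<in> R" for c r
    using lin_sigma that unfolding lin_def by blast
  show "character \<iota> R ?\<chi>"
    unfolding character_def by (auto simp: sc simp del: sigma_simps(4)) (auto simp: sigma_simps(4))
  fix r assume [simp]: "r \<in> R"
  have "tsum (\<lambda>u v. \<iota> (\<epsilon>R u) * v) (\<Delta>R (\<sigma> r)) = tsum (\<lambda>u v. \<iota> (\<epsilon>R (\<sigma> u)) * v) (\<Delta>R r)"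
    by (rule Delta_sigma_left) (auto intro!: bilI lin_intros R.lin_mult_left)
  then show "\<sigma> r = tsum (\<lambda>u v. \<iota> (?\<chi> u) * v) (\<Delta>R r)"
    by (simp add: HR.counit_left[OF lin_id])
  \<comment> \<open>The counit goes on the second leg; the factor \<open>SR a\<close> cancels the
    \<open>a\<close> to the right of the first leg and creates the conjugation on the other
    side.\<close>
  have "tsum (\<lambda>u v. u * a * SR a * \<iota> (\<epsilon>R v)) (\<Delta>R (\<sigma> r)) = tsum (\<lambda>u v. a * u * SR a * \<iota> (\<epsilon>R (\<sigma> v))) (\<Delta>R r)"
    by (rule Delta_sigma_right) (auto intro!: bilI lin_intros R.lin_mult_left)
  moreover have "tsum (\<lambda>u v. u * a * SR a * \<iota> (\<epsilon>R v)) (\<Delta>R (\<sigma> r)) = tsum (\<lambda>u v. \<iota> (\<epsilon>R v) * u) (\<Delta>R (\<sigma> r))"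
  proof (rule tsum_cong[OF HR.set_Delta])
    fix u v assume [simp]: "u \<in> R" "v \<in> R"
    have "u * a * SR a * \<iota> (\<epsilon>R v) = u * (a * SR a) * \<iota> (\<epsilon>R v)" by (simp only: mult.assoc)
    then show "u * a * SR a * \<iota> (\<epsilon>R v) = \<iota> (\<epsilon>R v) * u" by (simp add: a_S_a R.central[of u])
  qed simp
  ultimately show "\<sigma> r = tsum (\<lambda>u v. a * u * uinv R a * \<iota> (?\<chi> v)) (\<Delta>R r)"
    by (simp add: HR.counit_right[OF lin_id] uinv_a)
qed

lemma Delta_delta_teq:
  assumes [simp]: "r \<in> R"
  shows "teq \<iota> R
      (\<Delta>R (\<delta> r) @ tneg (map (\<lambda>(u, v). (\<delta> u, v)) (\<Delta>R r)) @ tneg (map (\<lambda>(u, v). (a * u, \<delta> v)) (\<Delta>R r)))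
      (tmul w (\<Delta>R r) @ tneg (tmul (\<Delta>R (\<sigma> r)) w))"
proof -
  have "tsum B (\<Delta>R (\<delta> r) @ tneg (map (\<lambda>(u, v). (\<delta> u, v)) (\<Delta>R r)) @ tneg (map (\<lambda>(u, v). (a * u, \<delta> v)) (\<Delta>R r))) =
     tsum B (tmul w (\<Delta>R r) @ tneg (tmul (\<Delta>R (\<sigma> r)) w))" if B: "bil \<iota> R B" for B
  proof -
    have neg: "B (- p) q = - B p q" if "p \<in> R" "q \<in> R" for p q
      using that B R.lin_uminus[of "\<lambda>z. B z q"] by (simp add: bil_def)
    show ?thesis
      using Delta_delta[OF assms B] by (simp add: mem neg tsum_neg algebra_simps cong: tsum_cong_set)
  qed
  then show ?thesis unfolding R.teq_iff_bil by blast
qed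

end

section \<open>Constructing a Hopf Ore extension\<close>

text \<open>\<open>T\<close> is an arbitrary Ore extension inside the ambient ring, so its algebra
  structure is given and only coproduct, counit and antipode remain to be constructed.\<close>

locale hopf_ore_data = ore_extension \<iota> R T x \<sigma> \<delta> + HR: hopf_algebra \<iota> R \<Delta>R \<epsilon>R SR
  for \<iota> :: "'f::field \<Rightarrow> 't::ring_1" and R T x \<sigma> \<delta> \<Delta>R \<epsilon>R SR +
  fixes a :: 't and w :: "('t \<times> 't) list" and \<chi> :: "'t \<Rightarrow> 'f"
  assumes grouplike_a: "grouplike \<iota> R \<Delta>R a" and set_w: "set w \<subseteq> R \<times> R"
    and chi: "character \<iota> R \<chi>"
    and sigma_left: "\<And>r. r \<in> R \<Longrightarrow> \<sigma> r = tsum (\<lambda>u v. \<iota> (\<chi> u) * v) (\<Delta>R r)"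
    and sigma_right: "\<And>r. r \<in> R \<Longrightarrow> \<sigma> r = tsum (\<lambda>u v. a * u * uinv R a * \<iota> (\<chi> v)) (\<Delta>R r)"
    and delta_teq: "\<And>r. r \<in> R \<Longrightarrow> teq \<iota> R
          (\<Delta>R (\<delta> r) @ tneg (map (\<lambda>(u, v). (\<delta> u, v)) (\<Delta>R r))
                      @ tneg (map (\<lambda>(u, v). (a * u, \<delta> v)) (\<Delta>R r)))
          (tmul w (\<Delta>R r) @ tneg (tmul (\<Delta>R (\<sigma> r)) w))"
    and w_aug: "\<exists>ws. set ws \<subseteq> augideal R \<epsilon>R \<times> augideal R \<epsilon>R \<and> teq \<iota> R w ws"
    and S_w: "tsum (\<lambda>u v. SR u * v) w = uinv R a * tsum (\<lambda>u v. u * SR v) w"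
    and w_teq3: "teq3 \<iota> R (map (\<lambda>(u, v). (u, v, 1)) w @ DeltaId \<Delta>R w)
                (map (\<lambda>(u, v). (a, u, v)) w @ IdDelta \<Delta>R w)"
begin

lemma mem_w: "(p, q) \<in> set w \<Longrightarrow> p \<in> R" "(p, q) \<in> set w \<Longrightarrow> q \<in> R"
  and mem_Delta: "(p, q) \<in> set (\<Delta>R r) \<Longrightarrow> r \<in> R \<Longrightarrow> p \<in> R" "(p, q) \<in> set (\<Delta>R r) \<Longrightarrow> r \<in> R \<Longrightarrow> q \<in> R"
  using set_w HR.set_Delta[of r] by blast+

lemmas mem = mem_w mem_Delta

lemmas lin_tsum_w [lin_intros] = lin_tsum[OF set_w]

lemma a_R [simp]: "a \<in> R" and Delta_a: "bil \<iota> R B \<Longrightarrow> tsum B (\<Delta>R a) = B a a"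
  using grouplike_a by (auto simp: grouplike_def R.teq_iff_bil)

lemma eps_a [simp]: "\<epsilon>R a = 1" and S_a [simp]: "SR a * a = 1" "a * SR a = 1" and uinv_a: "uinv R a = SR a"
  using HR.grouplike_eps[OF grouplike_a] HR.grouplike_S[OF grouplike_a] HR.uinv_grouplike[OF grouplike_a] by auto

lemma lin_chi: "lin \<iota> R (\<lambda>r. \<iota> (\<chi> r))"
proof -
  have "\<chi> (p + q) = \<chi> p + \<chi> q" "\<chi> (\<iota> c * p) = c * \<chi> p" if "p \<in> R" "q \<in> R" for p q c
    using chi that unfolding character_def by blast+
  then show ?thesis unfolding lin_def by (metis R.iota_hom(2,3))
qed

lemmas lin_chi_comp [lin_intros] = lin_comp[OF lin_chi]

text \<open>Since \<sigma>(r) = \<chi>(r1) r2, coassociativity gives \<Delta>(\<sigma>(r)) =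
  \<chi>(r1) r2 \<otimes> r3, in which the first two factors form \<sigma> of the first leg.\<close>

lemma Delta_sigma_left:
  assumes [simp]: "r \<in> R" and B: "bil \<iota> R B"
  shows "tsum B (\<Delta>R (\<sigma> r)) = tsum (\<lambda>p q. B (\<sigma> p) q) (\<Delta>R r)"
proof -
  note [lin_intros] = lin_bil1[OF B] lin_bil2[OF B]
  have L: "lin \<iota> R (\<lambda>t. tsum B (\<Delta>R t))" using B by (rule HR.lin_Delta)
  have "tsum B (\<Delta>R (\<sigma> r)) = tsum (\<lambda>u v. tsum B (\<Delta>R (\<iota> (\<chi> u) * v))) (\<Delta>R r)"
    unfolding sigma_left[OF assms(1)] by (rule R.lin_apply_tsum[OF L HR.set_Delta]) auto
  also have "\<dots> = tsum (\<lambda>u v. tsum (\<lambda>p q. \<iota> (\<chi> u) * B p q) (\<Delta>R v)) (\<Delta>R r)"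
    by (rule tsum_cong[OF HR.set_Delta]) (use L in \<open>auto simp: lin_def tsum_mult_left\<close>)
  also have "\<dots> = tsum (\<lambda>u v. tsum (\<lambda>p q. \<iota> (\<chi> p) * B q v) (\<Delta>R u)) (\<Delta>R r)"
    by (rule HR.coassoc[symmetric]) (auto intro!: triI lin_intros R.lin_mult_left)
  also have "\<dots> = tsum (\<lambda>p q. B (\<sigma> p) q) (\<Delta>R r)"
  proof (rule tsum_cong[OF HR.set_Delta])
    fix u v assume [simp]: "u \<in> R" "v \<in> R"
    have "B (\<sigma> u) v = tsum (\<lambda>p q. B (\<iota> (\<chi> p) * q) v) (\<Delta>R u)"
      unfolding sigma_left[OF \<open>u \<in> R\<close>]
      by (rule R.lin_apply_tsum[OF _ HR.set_Delta]) (auto intro!: lin_intros)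
    also have "\<dots> = tsum (\<lambda>p q. \<iota> (\<chi> p) * B q v) (\<Delta>R u)"
      by (rule tsum_cong[OF HR.set_Delta]) (use B in \<open>auto simp: bil_def lin_def\<close>)
    finally show "tsum (\<lambda>p q. \<iota> (\<chi> p) * B q v) (\<Delta>R u) = B (\<sigma> u) v" ..
  qed simp
  finally show ?thesis .
qed

text \<open>The other description of \<sigma> gives \<Delta>(\<sigma>(r)) = a r1 a^(-1) \<otimes> a
  r2 a^(-1) \<chi>(r3), whose second leg is \<sigma>(r2); the factor \<open>a\<close> in the
  statement cancels a^(-1) in the first leg.\<close>

lemma Delta_sigma_right:
  assumes [simp]: "r \<in> R" and B: "bil \<iota> R B"
  shows "tsum (\<lambda>p q. B (p * a) q) (\<Delta>R (\<sigma> r)) = tsum (\<lambda>p q. B (a * p) (\<sigma> q)) (\<Delta>R r)"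
proof -
  note [lin_intros] = lin_bil1[OF B] lin_bil2[OF B]
  let ?B = "\<lambda>p q. B (p * a) q"
  have B': "bil \<iota> R ?B" by (auto intro!: bilI lin_intros)
  have L: "lin \<iota> R (\<lambda>t. tsum ?B (\<Delta>R t))" using B' by (rule HR.lin_Delta)
  \<comment> \<open>Conjugation by a group-like element commutes with the coproduct.\<close>
  have conj: "tsum ?B (\<Delta>R (a * u * SR a)) = tsum (\<lambda>p q. B (a * p) (a * q * SR a)) (\<Delta>R u)"
    if [simp]: "u \<in> R" for u
  proof -
    have "tsum ?B (\<Delta>R (a * (u * SR a))) = tsum (\<lambda>p q. tsum (\<lambda>p' q'. B (p * p' * a) (q * q')) (\<Delta>R (u * SR a))) (\<Delta>R a)"
      by (rule HR.tsum_Delta_mult[OF B']) auto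
    also have "\<dots> = tsum (\<lambda>p q. B (a * p * a) (a * q)) (\<Delta>R (u * SR a))"
      by (rule Delta_a) (auto intro!: bilI lin_intros R.lin_mult_left)
    also have "\<dots> = tsum (\<lambda>p q. tsum (\<lambda>p' q'. B (a * (p * p') * a) (a * (q * q'))) (\<Delta>R (SR a))) (\<Delta>R u)"
      by (rule HR.tsum_Delta_mult) (auto intro!: bilI lin_intros R.lin_mult_left)
    also have "\<dots> = tsum (\<lambda>p q. B (a * (p * SR a) * a) (a * (q * SR a))) (\<Delta>R u)"
      by (intro tsum_cong[OF HR.set_Delta] HR.Delta_S_grouplike[OF grouplike_a])
         (auto intro!: bilI lin_intros R.lin_mult_left)
    finally show ?thesis by (simp add: mult.assoc)
  qed
  have "tsum ?B (\<Delta>R (\<sigma> r)) = tsum (\<lambda>u v. tsum ?B (\<Delta>R (a * u * SR a * \<iota> (\<chi> v)))) (\<Delta>R r)"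
    unfolding sigma_right[OF assms(1)] uinv_a by (rule R.lin_apply_tsum[OF L HR.set_Delta]) auto
  also have "\<dots> = tsum (\<lambda>u v. tsum (\<lambda>p q. \<iota> (\<chi> v) * B (a * p) (a * q * SR a)) (\<Delta>R u)) (\<Delta>R r)"
  proof (rule tsum_cong[OF HR.set_Delta])
    fix u v assume [simp]: "u \<in> R" "v \<in> R"
    have "tsum ?B (\<Delta>R (a * u * SR a * \<iota> (\<chi> v))) = tsum ?B (\<Delta>R (\<iota> (\<chi> v) * (a * u * SR a)))"
      using R.central[of "a * u * SR a"] by simp
    also have "\<dots> = \<iota> (\<chi> v) * tsum ?B (\<Delta>R (a * u * SR a))"
      using L by (simp add: lin_def)
    finally show "tsum ?B (\<Delta>R (a * u * SR a * \<iota> (\<chi> v))) = tsum (\<lambda>p q. \<iota> (\<chi> v) * B (a * p) (a * q * SR a)) (\<Delta>R u)"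
      by (simp add: conj tsum_mult_left)
  qed simp
  also have "\<dots> = tsum (\<lambda>u v. tsum (\<lambda>p q. \<iota> (\<chi> q) * B (a * u) (a * p * SR a)) (\<Delta>R v)) (\<Delta>R r)"
    by (rule HR.coassoc) (auto intro!: triI lin_intros R.lin_mult_left)
  also have "\<dots> = tsum (\<lambda>p q. B (a * p) (\<sigma> q)) (\<Delta>R r)"
  proof (rule tsum_cong[OF HR.set_Delta])
    fix u v assume [simp]: "u \<in> R" "v \<in> R"
    have "B (a * u) (\<sigma> v) = tsum (\<lambda>p q. B (a * u) (a * p * SR a * \<iota> (\<chi> q))) (\<Delta>R v)"
      unfolding sigma_right[OF \<open>v \<in> R\<close>] uinv_a
      by (rule R.lin_apply_tsum[OF _ HR.set_Delta]) (auto intro!: lin_intros)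
    also have "\<dots> = tsum (\<lambda>p q. \<iota> (\<chi> q) * B (a * u) (a * p * SR a)) (\<Delta>R v)"
    proof (rule tsum_cong[OF HR.set_Delta])
      fix p q assume [simp]: "p \<in> R" "q \<in> R"
      show "B (a * u) (a * p * SR a * \<iota> (\<chi> q)) = \<iota> (\<chi> q) * B (a * u) (a * p * SR a)"
        using B R.central[of "a * p * SR a"] by (simp add: bil_def lin_def)
    qed simp
    finally show "tsum (\<lambda>p q. \<iota> (\<chi> q) * B (a * u) (a * p * SR a)) (\<Delta>R v) = B (a * u) (\<sigma> v)" ..
  qed simp
  finally show ?thesis .
qed

lemma Delta_delta:
  assumes [simp]: "r \<in> R" and B: "bil \<iota> R B"
  shows "tsum (\<lambda>p q. B (a * p) (\<delta> q)) (\<Delta>R r) + tsum (\<lambda>p q. B (\<delta> p) q) (\<Delta>R r) +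
       tsum (\<lambda>u v. tsum (\<lambda>p q. B (u * p) (v * q)) (\<Delta>R r)) w =
       tsum (\<lambda>p q. tsum (\<lambda>u v. B (p * u) (q * v)) w) (\<Delta>R (\<sigma> r)) + tsum B (\<Delta>R (\<delta> r))"
proof -
  have neg: "B (- p) q = - B p q" if "p \<in> R" "q \<in> R" for p q
    using that B R.lin_uminus[of "\<lambda>z. B z q"] by (simp add: bil_def)
  have "tsum B (\<Delta>R (\<delta> r) @ tneg (map (\<lambda>(u, v). (\<delta> u, v)) (\<Delta>R r)) @ tneg (map (\<lambda>(u, v). (a * u, \<delta> v)) (\<Delta>R r))) =
     tsum B (tmul w (\<Delta>R r) @ tneg (tmul (\<Delta>R (\<sigma> r)) w))"
    using delta_teq[OF assms(1)] B unfolding R.teq_iff_bil by blast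
  then show ?thesis by (simp add: mem neg tsum_neg algebra_simps cong: tsum_cong_set)
qed

lemma
  assumes f: "lin \<iota> R f"
  shows eps_w_left: "tsum (\<lambda>u v. \<iota> (\<epsilon>R u) * f v) w = 0" and eps_w_right: "tsum (\<lambda>u v. \<iota> (\<epsilon>R v) * f u) w = 0"
proof -
  obtain ws where ws: "set ws \<subseteq> augideal R \<epsilon>R \<times> augideal R \<epsilon>R" "teq \<iota> R w ws" using w_aug by blast
  note [lin_intros] = lin_comp[OF f]
  have "tsum (\<lambda>u v. \<iota> (\<epsilon>R u) * f v) w = tsum (\<lambda>u v. \<iota> (\<epsilon>R u) * f v) ws"
       "tsum (\<lambda>u v. \<iota> (\<epsilon>R v) * f u) w = tsum (\<lambda>u v. \<iota> (\<epsilon>R v) * f u) ws"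
    by (rule ws(2)[unfolded R.teq_iff_bil, rule_format], auto intro!: bilI lin_intros R.lin_mult_left)+
  moreover have "tsum (\<lambda>u v. \<iota> (\<epsilon>R u) * f v) ws = tsum (\<lambda>u v. 0) ws"
    "tsum (\<lambda>u v. \<iota> (\<epsilon>R v) * f u) ws = tsum (\<lambda>u v. 0) ws"
    by (rule tsum_cong[OF ws(1)], simp add: augideal_def)+
  ultimately show "tsum (\<lambda>u v. \<iota> (\<epsilon>R u) * f v) w = 0" "tsum (\<lambda>u v. \<iota> (\<epsilon>R v) * f u) w = 0" by simp_all
qed

text \<open>Applying \<epsilon> \<otimes> \<epsilon> to \<open>Delta_delta\<close> leaves e + e + 0
  = 0 + e for e = \<epsilon>(\<delta>(r)), as both w-terms vanish by \<open>eps_w_left\<close>.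
  Multiplicativity of the counit of \<open>T\<close> rests on this.\<close>

lemma eps_delta [simp]:
  assumes [simp]: "r \<in> R"
  shows "\<epsilon>R (\<delta> r) = 0"
proof -
  let ?B = "\<lambda>p q. \<iota> (\<epsilon>R p) * \<iota> (\<epsilon>R q)"
  have 1: "tsum ?B (\<Delta>R s) = \<iota> (\<epsilon>R s)" if "s \<in> R" for s
    using HR.counit_left[OF HR.lin_eps that] .
  have 2: "tsum (\<lambda>p q. ?B (a * p) (\<delta> q)) (\<Delta>R r) = \<iota> (\<epsilon>R (\<delta> r))"
    using HR.counit_left[of "\<lambda>q. \<iota> (\<epsilon>R (\<delta> q))" r] by (simp add: mem lin_intros lin_delta HR.lin_eps_comp cong: tsum_cong_set)
  have "tsum (\<lambda>p q. ?B (\<delta> p) q) (\<Delta>R r) = tsum (\<lambda>p q. \<iota> (\<epsilon>R q) * \<iota> (\<epsilon>R (\<delta> p))) (\<Delta>R r)"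
    by (simp add: mult.commute flip: R.iota_hom(3))
  also have "\<dots> = \<iota> (\<epsilon>R (\<delta> r))"
    by (rule HR.counit_right) (auto intro!: lin_intros)
  finally have 3: "tsum (\<lambda>p q. ?B (\<delta> p) q) (\<Delta>R r) = \<iota> (\<epsilon>R (\<delta> r))" .
  have "tsum (\<lambda>u v. tsum (\<lambda>p q. ?B (u * p) (v * q)) (\<Delta>R r)) w = tsum (\<lambda>u v. \<iota> (\<epsilon>R u) * tsum (\<lambda>p q. \<iota> (\<epsilon>R p) * \<iota> (\<epsilon>R (v * q))) (\<Delta>R r)) w"
    by (simp add: mem mult.assoc cong: tsum_cong_set flip: tsum_mult_left)
  also have "\<dots> = 0"
    by (rule eps_w_left) (auto intro!: lin_intros R.lin_mult_left)
  finally have 4: "tsum (\<lambda>u v. tsum (\<lambda>p q. ?B (u * p) (v * q)) (\<Delta>R r)) w = 0" .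
  have "tsum (\<lambda>p q. tsum (\<lambda>u v. ?B (p * u) (q * v)) w) (\<Delta>R (\<sigma> r)) = tsum (\<lambda>p q. tsum (\<lambda>u v. \<iota> (\<epsilon>R u) * \<iota> (\<epsilon>R p * \<epsilon>R (q * v))) w) (\<Delta>R (\<sigma> r))"
    by (simp add: mem mult_ac cong: tsum_cong_set del: R.iota_hom(3) T.iota_hom(3) flip: R.iota_hom(3))
  also have "\<dots> = tsum (\<lambda>p q. 0) (\<Delta>R (\<sigma> r))"
    by (intro tsum_cong[OF HR.set_Delta] eps_w_left) (auto intro!: lin_intros R.lin_mult_left)
  finally have 5: "tsum (\<lambda>p q. tsum (\<lambda>u v. ?B (p * u) (q * v)) w) (\<Delta>R (\<sigma> r)) = 0" by simp
  have "tsum (\<lambda>p q. ?B (a * p) (\<delta> q)) (\<Delta>R r) + tsum (\<lambda>p q. ?B (\<delta> p) q) (\<Delta>R r) +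
       tsum (\<lambda>u v. tsum (\<lambda>p q. ?B (u * p) (v * q)) (\<Delta>R r)) w =
       tsum (\<lambda>p q. tsum (\<lambda>u v. ?B (p * u) (q * v)) w) (\<Delta>R (\<sigma> r)) + tsum ?B (\<Delta>R (\<delta> r))"
    by (rule Delta_delta) (auto intro!: bilI lin_intros R.lin_mult_left)
  then show ?thesis
    unfolding 2 3 4 5 1[OF delta_closed[OF assms]] using R.iota_inj[of _ 0] by simp
qed

definition W :: 't where "W = tsum (\<lambda>u v. u * SR v) w"
text \<open>The future S(x): the solution of a y + x + W = 0, which is the right antipode law at
  x.\<close>

definition y :: 't where "y = - (SR a * (x + W))"

lemma W_R [simp]: "W \<in> R"
  unfolding W_def by (auto intro!: R.closed_tsum[OF set_w])

lemma y_T [simp]: "y \<in> T"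
  by (simp add: y_def)

lemma a_y: "a * y + x + W = 0"
  by (simp add: y_def flip: mult.assoc)

text \<open>Convolving the defect of this relation with the identity on the left gives zero.\<close>

lemma antipode_relation:
  assumes "r \<in> R"
  shows "SR r * y = y * SR (\<sigma> r) + SR (\<delta> r)"
proof -
  let ?D = "\<lambda>r. SR r * y - y * SR (\<sigma> r) - SR (\<delta> r)"
  have "?D r = 0"
  proof (rule HR.convolution_cancel[where D = ?D])
    show "lin \<iota> R ?D" by (auto intro!: lin_intros T.lin_mult_left)
    fix r assume r [simp]: "r \<in> R"
    \<comment> \<open>The convolution is evaluated after multiplication by \<open>a\<close>, because
      \<open>Delta_sigma_right\<close> and \<open>Delta_delta\<close> carry \<open>a * p\<close> in
      the first leg; \<open>SR a\<close> cancels it at the end.\<close>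
    let ?e = "\<iota> (\<epsilon>R r)" and ?P = "tsum (\<lambda>p q. a * p * y * SR (\<sigma> q)) (\<Delta>R r)"
      and ?Q = "tsum (\<lambda>p q. a * p * SR (\<delta> q)) (\<Delta>R r)"
    have 1: "tsum (\<lambda>p q. a * p * y * SR (\<sigma> q)) (\<Delta>R r) = tsum (\<lambda>p q. p * a * y * SR q) (\<Delta>R (\<sigma> r))"
      by (rule Delta_sigma_right[symmetric]) (auto intro!: bilI lin_intros T.lin_mult_left)
    have 2: "tsum (\<lambda>p q. \<sigma> p * x * SR q) (\<Delta>R r) = tsum (\<lambda>p q. p * x * SR q) (\<Delta>R (\<sigma> r))"
      by (rule Delta_sigma_left[symmetric]) (auto intro!: bilI lin_intros T.lin_mult_left)
    have 3: "tsum (\<lambda>p q. a * p * SR (\<delta> q)) (\<Delta>R r) + tsum (\<lambda>p q. \<delta> p * SR q) (\<Delta>R r) +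
       tsum (\<lambda>u v. tsum (\<lambda>p q. u * p * SR (v * q)) (\<Delta>R r)) w =
       tsum (\<lambda>p q. tsum (\<lambda>u v. p * u * SR (q * v)) w) (\<Delta>R (\<sigma> r)) + tsum (\<lambda>p q. p * SR q) (\<Delta>R (\<delta> r))"
      by (rule Delta_delta) (auto intro!: bilI lin_intros T.lin_mult_left)
    have 4: "tsum (\<lambda>p q. \<sigma> p * x * SR q) (\<Delta>R r) + tsum (\<lambda>p q. \<delta> p * SR q) (\<Delta>R r) = ?e * x"
    proof -
      have "tsum (\<lambda>p q. \<sigma> p * x * SR q) (\<Delta>R r) + tsum (\<lambda>p q. \<delta> p * SR q) (\<Delta>R r) = tsum (\<lambda>p q. x * (p * SR q)) (\<Delta>R r)"
        unfolding tsum_add[symmetric]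
        by (rule tsum_cong[OF HR.set_Delta]) (auto simp: x_commute distrib_right simp flip: mult.assoc)
      also have "\<dots> = ?e * x" using T.central[of x] by (simp add: tsum_mult_left HR.antipode)
      finally show ?thesis .
    qed
    have 5: "tsum (\<lambda>u v. tsum (\<lambda>p q. u * p * SR (v * q)) (\<Delta>R r)) w = ?e * W"
    proof -
      have "tsum (\<lambda>u v. tsum (\<lambda>p q. u * p * SR (v * q)) (\<Delta>R r)) w = tsum (\<lambda>u v. u * tsum (\<lambda>p q. p * SR q) (\<Delta>R r) * SR v) w"
        by (simp add: HR.S_mult mem mult.assoc cong: tsum_cong_set flip: tsum_mult_left tsum_mult_right)
      also have "\<dots> = tsum (\<lambda>u v. ?e * (u * SR v)) w"
      proof (rule tsum_cong[OF set_w])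
        fix u v assume "u \<in> R" "v \<in> R"
        then show "u * tsum (\<lambda>p q. p * SR q) (\<Delta>R r) * SR v = ?e * (u * SR v)"
          using R.central[of u "\<epsilon>R r"] by (simp add: HR.antipode mult.assoc[symmetric])
      qed
      finally show ?thesis by (simp add: tsum_mult_left W_def)
    qed
    have 6: "tsum (\<lambda>p q. tsum (\<lambda>u v. p * u * SR (q * v)) w) (\<Delta>R (\<sigma> r)) = tsum (\<lambda>p q. p * W * SR q) (\<Delta>R (\<sigma> r))"
      unfolding W_def by (simp add: HR.S_mult mem mult.assoc cong: tsum_cong_set flip: tsum_mult_left tsum_mult_right)
    have 7: "tsum (\<lambda>p q. p * a * y * SR q) (\<Delta>R (\<sigma> r)) + tsum (\<lambda>p q. p * x * SR q) (\<Delta>R (\<sigma> r)) +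
       tsum (\<lambda>p q. p * W * SR q) (\<Delta>R (\<sigma> r)) = 0"
    proof -
      have "p * a * y * SR q + p * x * SR q + p * W * SR q = p * (a * y + x + W) * SR q" for p q
        by (simp add: algebra_simps)
      then show ?thesis unfolding tsum_add[symmetric] by (simp add: a_y)
    qed
    have 8: "tsum (\<lambda>p q. a * p * SR q * y) (\<Delta>R r) = ?e * (a * y)"
    proof -
      have "tsum (\<lambda>p q. a * p * SR q * y) (\<Delta>R r) = a * tsum (\<lambda>p q. p * SR q) (\<Delta>R r) * y"
        by (simp add: mult.assoc flip: tsum_mult_left tsum_mult_right)
      then show ?thesis using R.central[of a "\<epsilon>R r"] by (simp add: HR.antipode mult.assoc[symmetric])
    qed
    \<comment> \<open>Regrouped, the terms combine into a sum of
      \<open>p * (a * y + x + W) * SR q\<close> over \<Delta>(\<sigma>(r)), zero by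
      \<open>a_y\<close>, plus the antipode law for \<delta>(r), zero by
      \<open>eps_delta\<close>.\<close>
    have "?P + ?Q + ?e * x + ?e * W = ?P + tsum (\<lambda>p q. \<sigma> p * x * SR q) (\<Delta>R r) +
       (?Q + tsum (\<lambda>p q. \<delta> p * SR q) (\<Delta>R r) + tsum (\<lambda>u v. tsum (\<lambda>p q. u * p * SR (v * q)) (\<Delta>R r)) w)"
      unfolding 4[symmetric] 5[symmetric] by (simp only: add_ac)
    also have "\<dots> = 0"
      unfolding 1 2 3 6 using 7 by (simp add: HR.antipode)
    finally have 9: "?P + ?Q + ?e * x + ?e * W = 0" .
    have 10: "?e * (a * y) + ?e * x + ?e * W = 0"
      using arg_cong[OF a_y, of "\<lambda>z. ?e * z"] by (simp add: distrib_left)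
    have "a * tsum (\<lambda>p q. p * ?D q) (\<Delta>R r) = tsum (\<lambda>p q. a * p * SR q * y) (\<Delta>R r) - ?P - ?Q"
      unfolding tsum_mult_left[symmetric] tsum_diff[symmetric] by (simp add: right_diff_distrib mult.assoc)
    also have "\<dots> = (?e * (a * y) + ?e * x + ?e * W) - (?P + ?Q + ?e * x + ?e * W)"
      unfolding 8 by (simp add: algebra_simps)
    finally have "a * tsum (\<lambda>p q. p * ?D q) (\<Delta>R r) = 0"
      unfolding 9 10 by simp
    then have "SR a * a * tsum (\<lambda>p q. p * ?D q) (\<Delta>R r) = 0" by (simp add: mult.assoc del: S_a)
    then show "tsum (\<lambda>p q. p * ?D q) (\<Delta>R r) = 0" by simp
  qed fact
  then show ?thesis by (simp add: algebra_simps)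
qed

section \<open>Extending the coproduct to T\<close>

definition X :: "('t \<times> 't) list" where "X = [(a, x), (x, 1)] @ w"

primrec Xpow :: "nat \<Rightarrow> ('t \<times> 't) list" where
  "Xpow 0 = [(1, 1)]"
| "Xpow (Suc n) = tmul X (Xpow n)"

text \<open>The formula \<Delta>(r x^i) = \<Delta>(r) X^i that an algebra map with x going to X must
  obey, imposed on the basis.\<close>

definition Delta_ext :: "'t \<Rightarrow> ('t \<times> 't) list" where
  "Delta_ext t = concat (map (\<lambda>i. tmul (\<Delta>R (coef t i)) (Xpow i)) [0..<deg t])"

lemma set_X: "set X \<subseteq> T \<times> T"
  using set_w R_T by (auto simp: X_def)

lemma set_Xpow: "set (Xpow n) \<subseteq> T \<times> T"
  by (induction n) (simp_all add: set_tmul[OF set_X])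

lemma set_Delta_T: "r \<in> R \<Longrightarrow> set (\<Delta>R r) \<subseteq> T \<times> T"
  using HR.set_Delta[of r] R_T by blast

lemma set_Delta_ext [simp]: "t \<in> T \<Longrightarrow> set (Delta_ext t) \<subseteq> T \<times> T"
  by (simp add: Delta_ext_def UN_subset_iff set_tmul[OF set_Delta_T set_Xpow])

lemmas lin_tsum_X [lin_intros] = lin_tsum[OF set_X]
lemmas lin_tsum_Xpow [lin_intros] = lin_tsum[OF set_Xpow]
lemmas lin_tsum_Delta_ext [lin_intros] = lin_tsum[OF set_Delta_ext]

lemma tsum_X: "tsum B X = B a x + B x 1 + tsum B w"
  by (simp add: X_def add.assoc)

text \<open>The Ore relation for X over \<Delta>(R). Expanding x q and x p produces terms with x in
  the second leg, in the first leg, and in neither, which are handled by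
  \<open>Delta_sigma_right\<close>, \<open>Delta_sigma_left\<close> and
  \<open>Delta_delta\<close>.\<close>

lemma X_relation:
  assumes [simp]: "r \<in> R" and B: "bil \<iota> T B"
  shows "tsum (\<lambda>u v. tsum (\<lambda>p q. B (u * p) (v * q)) (\<Delta>R r)) X =
    tsum (\<lambda>p q. tsum (\<lambda>u v. B (p * u) (q * v)) X) (\<Delta>R (\<sigma> r)) + tsum B (\<Delta>R (\<delta> r))"
proof -
  note [lin_intros] = lin_bil1[OF B] lin_bil2[OF B]
  have add: "B p (q + q') = B p q + B p q'" "B (q + q') p = B q p + B q' p" if "p \<in> T" "q \<in> T" "q' \<in> T" for p q q'
    using that B by (simp_all add: bil_def lin_def)
  have 1: "tsum (\<lambda>p q. B (a * p) (\<sigma> q * x)) (\<Delta>R r) = tsum (\<lambda>p q. B (p * a) (q * x)) (\<Delta>R (\<sigma> r))"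
    by (rule Delta_sigma_right[symmetric, where B = "\<lambda>p q. B p (q * x)"]) (auto intro!: bilI lin_intros)
  have 2: "tsum (\<lambda>p q. B (\<sigma> p * x) q) (\<Delta>R r) = tsum (\<lambda>p q. B (p * x) q) (\<Delta>R (\<sigma> r))"
    by (rule Delta_sigma_left[symmetric, where B = "\<lambda>p q. B (p * x) q"]) (auto intro!: bilI lin_intros)
  have 3: "tsum (\<lambda>p q. B (a * p) (\<delta> q)) (\<Delta>R r) + tsum (\<lambda>p q. B (\<delta> p) q) (\<Delta>R r) +
       tsum (\<lambda>u v. tsum (\<lambda>p q. B (u * p) (v * q)) (\<Delta>R r)) w =
       tsum (\<lambda>p q. tsum (\<lambda>u v. B (p * u) (q * v)) w) (\<Delta>R (\<sigma> r)) + tsum B (\<Delta>R (\<delta> r))"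
    by (rule Delta_delta[OF _ bil_mono[OF B R_T]]) simp
  have "tsum (\<lambda>u v. tsum (\<lambda>p q. B (u * p) (v * q)) (\<Delta>R r)) X =
     tsum (\<lambda>p q. B (a * p) (x * q)) (\<Delta>R r) + tsum (\<lambda>p q. B (x * p) q) (\<Delta>R r) +
     tsum (\<lambda>u v. tsum (\<lambda>p q. B (u * p) (v * q)) (\<Delta>R r)) w"
    by (simp add: tsum_X)
  also have "tsum (\<lambda>p q. B (a * p) (x * q)) (\<Delta>R r) = tsum (\<lambda>p q. B (a * p) (\<sigma> q * x)) (\<Delta>R r) + tsum (\<lambda>p q. B (a * p) (\<delta> q)) (\<Delta>R r)"
    by (simp add: mem x_commute add tsum_add cong: tsum_cong_set)
  also have "tsum (\<lambda>p q. B (x * p) q) (\<Delta>R r) = tsum (\<lambda>p q. B (\<sigma> p * x) q) (\<Delta>R r) + tsum (\<lambda>p q. B (\<delta> p) q) (\<Delta>R r)"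
    by (simp add: mem x_commute add tsum_add cong: tsum_cong_set)
  finally have "tsum (\<lambda>u v. tsum (\<lambda>p q. B (u * p) (v * q)) (\<Delta>R r)) X =
     tsum (\<lambda>p q. B (a * p) (\<sigma> q * x)) (\<Delta>R r) + tsum (\<lambda>p q. B (\<sigma> p * x) q) (\<Delta>R r) +
     (tsum (\<lambda>p q. B (a * p) (\<delta> q)) (\<Delta>R r) + tsum (\<lambda>p q. B (\<delta> p) q) (\<Delta>R r) +
       tsum (\<lambda>u v. tsum (\<lambda>p q. B (u * p) (v * q)) (\<Delta>R r)) w)"
    by (simp only: add_ac)
  also have "\<dots> = tsum (\<lambda>p q. tsum (\<lambda>u v. B (p * u) (q * v)) X) (\<Delta>R (\<sigma> r)) + tsum B (\<Delta>R (\<delta> r))"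
    unfolding 1 2 3 by (simp add: tsum_X tsum_add add.assoc)
  finally show ?thesis .
qed

definition term_sum :: "('t \<Rightarrow> 't \<Rightarrow> 't) \<Rightarrow> nat \<Rightarrow> 't \<Rightarrow> 't" where
  "term_sum B i c = tsum (\<lambda>p q. tsum (\<lambda>u v. B (p * u) (q * v)) (Xpow i)) (\<Delta>R c)"

lemma lin_term_sum:
  assumes B: "bil \<iota> T B"
  shows "lin \<iota> R (term_sum B i)"
proof -
  note [lin_intros] = lin_bil1[OF B] lin_bil2[OF B]
  show ?thesis unfolding term_sum_def by (auto intro!: lin_intros)
qed

text \<open>Any bound \<open>n\<close> beyond the support may replace \<open>deg t\<close>, so that
  two elements and their sum can be expanded to a common length.\<close>

lemma tsum_Delta_ext:
  assumes "bil \<iota> T B" "t \<in> T" "\<forall>i\<ge>n. coef t i = 0"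
  shows "tsum B (Delta_ext t) = (\<Sum>i<n. term_sum B i (coef t i))"
proof -
  have "tsum B (concat (map f [0..<m])) = (\<Sum>i<m. tsum B (f i))" for f m
    by (induction m) auto
  then have "tsum B (Delta_ext t) = (\<Sum>i<deg t. term_sum B i (coef t i))"
    by (simp add: Delta_ext_def term_sum_def)
  also have "\<dots> = (\<Sum>i<n. term_sum B i (coef t i))"
  proof -
    have "(\<Sum>i<deg t. term_sum B i (coef t i)) = (\<Sum>i<max (deg t) n. term_sum B i (coef t i))"
      using assms(2) R.lin_0[OF lin_term_sum[OF assms(1)]]
      by (intro sum.mono_neutral_left) (auto simp: coef_deg)
    also have "\<dots> = (\<Sum>i<n. term_sum B i (coef t i))"
      using assms(3) R.lin_0[OF lin_term_sum[OF assms(1)]]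
      by (intro sum.mono_neutral_right) auto
    finally show ?thesis .
  qed
  finally show ?thesis .
qed

lemma lin_Delta_ext:
  assumes B: "bil \<iota> T B"
  shows "lin \<iota> T (\<lambda>t. tsum B (Delta_ext t))"
proof -
  note l = lin_term_sum[OF B]
  have "tsum B (Delta_ext (s + t)) = tsum B (Delta_ext s) + tsum B (Delta_ext t)" if [simp]: "s \<in> T" "t \<in> T" for s t
  proof -
    let ?n = "max (deg s) (deg t)"
    have "tsum B (Delta_ext u) = (\<Sum>i<?n. term_sum B i (coef u i))" if "u \<in> {s, t, s + t}" for u
      using that by (intro tsum_Delta_ext[OF B]) (auto simp: coef_deg)
    then show ?thesis using l by (simp add: sum.distrib lin_def)
  qed
  moreover have "tsum B (Delta_ext (\<iota> c * t)) = \<iota> c * tsum B (Delta_ext t)" if [simp]: "t \<in> T" for c t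
  proof -
    have "tsum B (Delta_ext (\<iota> c * t)) = (\<Sum>i<deg t. term_sum B i (\<iota> c * coef t i))"
      by (subst tsum_Delta_ext[OF B, of _ "deg t"]) (auto simp: coef_deg)
    also have "\<dots> = \<iota> c * (\<Sum>i<deg t. term_sum B i (coef t i))"
      using l by (simp add: lin_def sum_distrib_left)
    also have "(\<Sum>i<deg t. term_sum B i (coef t i)) = tsum B (Delta_ext t)"
      by (rule tsum_Delta_ext[OF B, symmetric]) (auto simp: coef_deg)
    finally show ?thesis .
  qed
  ultimately show ?thesis by (simp add: lin_def)
qed

lemma lin_Delta_ext_comp [lin_intros]:
  assumes "lin \<iota> D g" "\<And>x. x \<in> D \<Longrightarrow> g x \<in> T"
    "\<And>v. v \<in> T \<Longrightarrow> lin \<iota> T (\<lambda>u. B u v)" "\<And>u. u \<in> T \<Longrightarrow> lin \<iota> T (\<lambda>v. B u v)"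
  shows "lin \<iota> D (\<lambda>x. tsum (\<lambda>u v. B u v) (Delta_ext (g x)))"
  by (rule lin_comp[OF lin_Delta_ext[OF bilI] assms(1,2)]) (use assms in auto)

lemma Delta_ext_monom:
  assumes "bil \<iota> T B" "r \<in> R"
  shows "tsum B (Delta_ext (r * x ^ k)) = term_sum B k r"
  using R.lin_0[OF lin_term_sum[OF assms(1)]] assms(2)
  by (subst tsum_Delta_ext[OF assms(1), of _ "Suc k"]) auto

lemma Delta_ext_R:
  assumes "bil \<iota> T B" "r \<in> R"
  shows "tsum B (Delta_ext r) = tsum B (\<Delta>R r)"
  using Delta_ext_monom[OF assms, of 0] by (simp add: term_sum_def)

lemma Delta_ext_x:
  assumes B: "bil \<iota> T B"
  shows "tsum B (Delta_ext x) = tsum B X"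
proof -
  note [lin_intros] = lin_bil1[OF B] lin_bil2[OF B]
  have "tsum B (Delta_ext x) = tsum (\<lambda>p q. tsum (\<lambda>u v. B (p * u) (q * v)) (Xpow 1)) (\<Delta>R 1)"
    using Delta_ext_monom[OF B, of 1 1] by (simp add: term_sum_def)
  also have "\<dots> = tsum (\<lambda>u v. B (1 * u) (1 * v)) (Xpow 1)"
    by (rule HR.tsum_Delta_1) (auto intro!: bilI lin_intros)
  finally show ?thesis by simp
qed

text \<open>Induction on the left factor: for \<open>r\<close> and for \<open>x\<close> the right
  factor is reduced to monomials, while sums and products are formal. \<open>q\<close> and
  \<open>B\<close> vary because the product case needs the hypothesis at \<open>p' * q\<close> and
  for forms shifted by the legs of the other factor.\<close>

lemma Delta_ext_mult:
  assumes "p \<in> T" "q \<in> T" "bil \<iota> T B"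
  shows "tsum B (Delta_ext (p * q)) = tsum (\<lambda>u v. tsum (\<lambda>u' v'. B (u * u') (v * v')) (Delta_ext q)) (Delta_ext p)"
  using assms
proof (induction p arbitrary: q B rule: T_induct)
  case (R r)
  note [lin_intros] = lin_bil1[OF R(3)] lin_bil2[OF R(3)]
  note [simp] = R(1)
  have bil2: "bil \<iota> T (\<lambda>u' v'. B (u * u') (v * v'))" if "u \<in> T" "v \<in> T" for u v
    using that by (auto intro!: bilI lin_intros T.lin_mult_left)
  have "tsum B (Delta_ext (r * q)) = tsum (\<lambda>u v. tsum (\<lambda>u' v'. B (u * u') (v * v')) (Delta_ext q)) (\<Delta>R r)"
    using R(2)
  proof (induction q rule: T_induct_monom)
    case (monom s k)
    note [simp] = monom
    have "tsum B (Delta_ext (r * (s * x ^ k))) = term_sum B k (r * s)"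
      using Delta_ext_monom[OF R(3), of "r * s" k] by (simp add: mult.assoc)
    also have "\<dots> = tsum (\<lambda>u v. tsum (\<lambda>p q. tsum (\<lambda>u' v'. B (u * p * u') (v * q * v')) (Xpow k)) (\<Delta>R s)) (\<Delta>R r)"
      unfolding term_sum_def by (rule HR.tsum_Delta_mult) (auto intro!: bilI lin_intros)
    also have "\<dots> = tsum (\<lambda>u v. tsum (\<lambda>u' v'. B (u * u') (v * v')) (Delta_ext (s * x ^ k))) (\<Delta>R r)"
    proof (rule tsum_cong[OF HR.set_Delta])
      fix u v assume "u \<in> R" "v \<in> R"
      then show "tsum (\<lambda>p q. tsum (\<lambda>u' v'. B (u * p * u') (v * q * v')) (Xpow k)) (\<Delta>R s) = tsum (\<lambda>u' v'. B (u * u') (v * v')) (Delta_ext (s * x ^ k))"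
        using Delta_ext_monom[OF bil2[of u v], of s k] by (simp add: term_sum_def mult.assoc)
    qed simp
    finally show ?case .
  next
    case (add p q)
    note [simp] = add(1,2)
    have "tsum (\<lambda>u' v'. B (u * u') (v * v')) (Delta_ext (p + q)) = tsum (\<lambda>u' v'. B (u * u') (v * v')) (Delta_ext p) + tsum (\<lambda>u' v'. B (u * u') (v * v')) (Delta_ext q)"
      if "u \<in> T" "v \<in> T" for u v
      using lin_Delta_ext[OF bil2[OF that]] by (simp add: lin_def)
    moreover have "tsum B (Delta_ext (r * p + r * q)) = tsum B (Delta_ext (r * p)) + tsum B (Delta_ext (r * q))"
      using lin_Delta_ext[OF R(3)] by (simp add: lin_def)
    ultimately show ?case using add(3,4) by (simp add: mem distrib_left tsum_add cong: tsum_cong_set)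
  qed
  also have "\<dots> = tsum (\<lambda>u v. tsum (\<lambda>u' v'. B (u * u') (v * v')) (Delta_ext q)) (Delta_ext r)"
    by (rule Delta_ext_R[symmetric]) (use R(2) in \<open>auto intro!: bilI lin_intros\<close>)
  finally show ?case .
next
  case x
  note [lin_intros] = lin_bil1[OF x(2)] lin_bil2[OF x(2)]
  have bil2: "bil \<iota> T (\<lambda>u' v'. B (u * u') (v * v'))" if "u \<in> T" "v \<in> T" for u v
    using that by (auto intro!: bilI lin_intros T.lin_mult_left)
  have "tsum B (Delta_ext (x * q)) = tsum (\<lambda>u v. tsum (\<lambda>u' v'. B (u * u') (v * v')) (Delta_ext q)) X"
    using x(1)
  proof (induction q rule: T_induct_monom)
    case (monom s k)
    note [simp] = monom
    have "x * (s * x ^ k) = \<sigma> s * x ^ Suc k + \<delta> s * x ^ k" by (simp add: x_commute')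
    then have "tsum B (Delta_ext (x * (s * x ^ k))) = term_sum B (Suc k) (\<sigma> s) + term_sum B k (\<delta> s)"
      using lin_Delta_ext[OF x(2)] Delta_ext_monom[OF x(2)] by (simp add: lin_def del: power_Suc)
    also have "\<dots> = tsum (\<lambda>p q. tsum (\<lambda>u v. tsum (\<lambda>u' v'. B (p * u * u') (q * v * v')) (Xpow k)) X) (\<Delta>R (\<sigma> s))
        + tsum (\<lambda>p q. tsum (\<lambda>u' v'. B (p * u') (q * v')) (Xpow k)) (\<Delta>R (\<delta> s))"
      by (simp add: term_sum_def mult.assoc)
    \<comment> \<open>\<open>X_relation\<close> is applied to the form that first multiplies its
      arguments on the right by X^k.\<close>
    also have "\<dots> = tsum (\<lambda>u v. tsum (\<lambda>p q. tsum (\<lambda>u' v'. B (u * p * u') (v * q * v')) (Xpow k)) (\<Delta>R s)) X"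
      by (rule X_relation[symmetric]) (auto intro!: bilI lin_intros)
    also have "\<dots> = tsum (\<lambda>u v. tsum (\<lambda>u' v'. B (u * u') (v * v')) (Delta_ext (s * x ^ k))) X"
    proof (rule tsum_cong[OF set_X])
      fix u v assume "u \<in> T" "v \<in> T"
      then show "tsum (\<lambda>p q. tsum (\<lambda>u' v'. B (u * p * u') (v * q * v')) (Xpow k)) (\<Delta>R s) = tsum (\<lambda>u' v'. B (u * u') (v * v')) (Delta_ext (s * x ^ k))"
        using Delta_ext_monom[OF bil2[of u v], of s k] by (simp add: term_sum_def mult.assoc)
    qed
    finally show ?case .
  next
    case (add p q)
    note [simp] = add(1,2)
    have "tsum (\<lambda>u' v'. B (u * u') (v * v')) (Delta_ext (p + q)) = tsum (\<lambda>u' v'. B (u * u') (v * v')) (Delta_ext p) + tsum (\<lambda>u' v'. B (u * u') (v * v')) (Delta_ext q)"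
      if "u \<in> T" "v \<in> T" for u v
      using lin_Delta_ext[OF bil2[OF that]] by (simp add: lin_def)
    then have "tsum (\<lambda>u v. tsum (\<lambda>u' v'. B (u * u') (v * v')) (Delta_ext (p + q))) X = tsum (\<lambda>u v. tsum (\<lambda>u' v'. B (u * u') (v * v')) (Delta_ext p) + tsum (\<lambda>u' v'. B (u * u') (v * v')) (Delta_ext q)) X"
      by (rule tsum_cong[OF set_X])
    moreover have "tsum B (Delta_ext (x * p + x * q)) = tsum B (Delta_ext (x * p)) + tsum B (Delta_ext (x * q))"
      using lin_Delta_ext[OF x(2)] by (simp add: lin_def)
    ultimately show ?case using add(3,4) by (simp add: distrib_left tsum_add)
  qed
  also have "\<dots> = tsum (\<lambda>u v. tsum (\<lambda>u' v'. B (u * u') (v * v')) (Delta_ext q)) (Delta_ext x)"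
    by (rule Delta_ext_x[symmetric]) (use x(1) in \<open>auto intro!: bilI lin_intros\<close>)
  finally show ?case .
next
  case (add p p')
  note [simp] = add(1,2,5)
  note [lin_intros] = lin_bil1[OF add(6)] lin_bil2[OF add(6)]
  have "bil \<iota> T (\<lambda>u v. tsum (\<lambda>u' v'. B (u * u') (v * v')) (Delta_ext q))"
    by (auto intro!: bilI lin_intros)
  then show ?case
    using lin_Delta_ext[OF add(6)] lin_Delta_ext[of "\<lambda>u v. tsum (\<lambda>u' v'. B (u * u') (v * v')) (Delta_ext q)"] add.IH[OF add(5,6)]
    by (simp add: lin_def distrib_right)
next
  case (mult p p')
  note [simp] = mult(1,2,5)
  note [lin_intros] = lin_bil1[OF mult(6)] lin_bil2[OF mult(6)]
  have bil1: "bil \<iota> T (\<lambda>u v. tsum (\<lambda>u' v'. B (u * u') (v * v')) (Delta_ext q))"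
    by (auto intro!: bilI lin_intros)
  have bil2: "bil \<iota> T (\<lambda>u' v'. B (u * u') (v * v'))" if "u \<in> T" "v \<in> T" for u v
    using that by (auto intro!: bilI lin_intros T.lin_mult_left)
  have "tsum B (Delta_ext (p * p' * q)) = tsum (\<lambda>u v. tsum (\<lambda>u' v'. B (u * u') (v * v')) (Delta_ext (p' * q))) (Delta_ext p)"
    using mult.IH(1)[of "p' * q" B] mult(6) by (simp add: mult.assoc)
  also have "\<dots> = tsum (\<lambda>u v. tsum (\<lambda>u' v'. tsum (\<lambda>u'' v''. B (u * (u' * u'')) (v * (v' * v''))) (Delta_ext q)) (Delta_ext p')) (Delta_ext p)"
    by (intro tsum_cong[OF set_Delta_ext] mult.IH(2) bil2) auto
  also have "\<dots> = tsum (\<lambda>u v. tsum (\<lambda>u' v'. B (u * u') (v * v')) (Delta_ext q)) (Delta_ext (p * p'))"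
    using mult.IH(1)[OF mult(2) bil1] by (simp add: mult.assoc)
  finally show ?case .
qed

lemma w_cocycle:
  assumes "tri \<iota> R C"
  shows "tsum (\<lambda>p q. C p q 1) w + tsum (\<lambda>u v. tsum (\<lambda>p q. C p q v) (\<Delta>R u)) w =
     tsum (\<lambda>p q. C a p q) w + tsum (\<lambda>u v. tsum (\<lambda>p q. C u p q) (\<Delta>R v)) w"
  using w_teq3 assms by (simp add: R.teq3_iff_tri)

text \<open>Both iterated coproducts are multiplicative, so \<open>R\<close> and \<open>x\<close>
  suffice. At \<open>x\<close> the terms containing x agree because \<open>a\<close> and 1 are
  group-like, and the rest is the cocycle condition on w.\<close>

lemma Delta_ext_coassoc:
  assumes "t \<in> T" "tri \<iota> T C"
  shows "tsum (\<lambda>u v. tsum (\<lambda>p q. C p q v) (Delta_ext u)) (Delta_ext t) = tsum (\<lambda>u v. tsum (\<lambda>p q. C u p q) (Delta_ext v)) (Delta_ext t)"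
  using assms
proof (induction t arbitrary: C rule: T_induct)
  case (R r)
  note [simp] = R(1)
  note [lin_intros] = lin_tri1[OF R(2)] lin_tri2[OF R(2)] lin_tri3[OF R(2)]
  have B1: "bil \<iota> T (\<lambda>p q. C p q s)" and B2: "bil \<iota> T (\<lambda>p q. C s p q)" if "s \<in> T" for s
    using that by (auto intro!: bilI lin_intros)
  have "tsum (\<lambda>u v. tsum (\<lambda>p q. C p q v) (Delta_ext u)) (Delta_ext r) = tsum (\<lambda>u v. tsum (\<lambda>p q. C p q v) (Delta_ext u)) (\<Delta>R r)"
    by (rule Delta_ext_R) (auto intro!: bilI lin_intros)
  also have "\<dots> = tsum (\<lambda>u v. tsum (\<lambda>p q. C p q v) (\<Delta>R u)) (\<Delta>R r)"
    by (intro tsum_cong[OF HR.set_Delta] Delta_ext_R B1) auto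
  also have "\<dots> = tsum (\<lambda>u v. tsum (\<lambda>p q. C u p q) (\<Delta>R v)) (\<Delta>R r)"
    by (rule HR.coassoc[OF tri_mono[OF R(2) R_T]]) simp
  also have "\<dots> = tsum (\<lambda>u v. tsum (\<lambda>p q. C u p q) (Delta_ext v)) (\<Delta>R r)"
    by (intro tsum_cong[OF HR.set_Delta] Delta_ext_R[symmetric] B2) auto
  also have "\<dots> = tsum (\<lambda>u v. tsum (\<lambda>p q. C u p q) (Delta_ext v)) (Delta_ext r)"
    by (rule Delta_ext_R[symmetric]) (auto intro!: bilI lin_intros)
  finally show ?case .
next
  case x
  note [lin_intros] = lin_tri1[OF x] lin_tri2[OF x] lin_tri3[OF x]
  have B1: "bil \<iota> T (\<lambda>p q. C p q s)" and B2: "bil \<iota> T (\<lambda>p q. C s p q)" if "s \<in> T" for s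
    using that by (auto intro!: bilI lin_intros)
  have Da: "tsum B (Delta_ext a) = B a a" and D1: "tsum B (Delta_ext 1) = B 1 1" if "bil \<iota> T B" for B
    using that by (simp_all add: Delta_ext_R Delta_a HR.tsum_Delta_1 bil_mono[OF _ R_T])
  have "tsum (\<lambda>u v. tsum (\<lambda>p q. C p q v) (Delta_ext u)) (Delta_ext x) = tsum (\<lambda>u v. tsum (\<lambda>p q. C p q v) (Delta_ext u)) X"
    by (rule Delta_ext_x) (auto intro!: bilI lin_intros)
  also have "\<dots> = C a a x + (C a x 1 + C x 1 1 + tsum (\<lambda>p q. C p q 1) w) + tsum (\<lambda>u v. tsum (\<lambda>p q. C p q v) (\<Delta>R u)) w"
  proof -
    have "tsum (\<lambda>u v. tsum (\<lambda>p q. C p q v) (Delta_ext u)) w = tsum (\<lambda>u v. tsum (\<lambda>p q. C p q v) (\<Delta>R u)) w"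
      by (intro tsum_cong[OF set_w] Delta_ext_R B1) auto
    moreover have "tsum (\<lambda>p q. C p q x) (Delta_ext a) = C a a x" by (rule Da) (simp add: B1)
    moreover have "tsum (\<lambda>p q. C p q 1) (Delta_ext x) = tsum (\<lambda>p q. C p q 1) X" by (rule Delta_ext_x) (simp add: B1)
    ultimately show ?thesis by (simp add: tsum_X)
  qed
  also have "\<dots> = (C a a x + C a x 1 + tsum (\<lambda>p q. C a p q) w) + C x 1 1 + tsum (\<lambda>u v. tsum (\<lambda>p q. C u p q) (\<Delta>R v)) w"
    using w_cocycle[OF tri_mono[OF x R_T]] by (simp add: add_ac)
  also have "\<dots> = tsum (\<lambda>u v. tsum (\<lambda>p q. C u p q) (Delta_ext v)) X"
  proof -
    have "tsum (\<lambda>u v. tsum (\<lambda>p q. C u p q) (Delta_ext v)) w = tsum (\<lambda>u v. tsum (\<lambda>p q. C u p q) (\<Delta>R v)) w"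
      by (intro tsum_cong[OF set_w] Delta_ext_R B2) auto
    moreover have "tsum (\<lambda>p q. C x p q) (Delta_ext 1) = C x 1 1" by (rule D1) (simp add: B2)
    moreover have "tsum (\<lambda>p q. C a p q) (Delta_ext x) = tsum (\<lambda>p q. C a p q) X" by (rule Delta_ext_x) (simp add: B2)
    ultimately show ?thesis by (simp add: tsum_X)
  qed
  also have "\<dots> = tsum (\<lambda>u v. tsum (\<lambda>p q. C u p q) (Delta_ext v)) (Delta_ext x)"
    by (rule Delta_ext_x[symmetric]) (auto intro!: bilI lin_intros)
  finally show ?case .
next
  case (add t t')
  note [simp] = add(1,2)
  note [lin_intros] = lin_tri1[OF add(5)] lin_tri2[OF add(5)] lin_tri3[OF add(5)]
  have "bil \<iota> T (\<lambda>u v. tsum (\<lambda>p q. C p q v) (Delta_ext u))" "bil \<iota> T (\<lambda>u v. tsum (\<lambda>p q. C u p q) (Delta_ext v))"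
    by (auto intro!: bilI lin_intros)
  then show ?case using add.IH[OF add(5)] by (simp add: lin_Delta_ext[unfolded lin_def])
next
  case (mult t t')
  note [simp] = mult(1,2)
  note [lin_intros] = lin_tri1[OF mult(5)] lin_tri2[OF mult(5)] lin_tri3[OF mult(5)]
  let ?F = "\<lambda>p p' q q' v v'. C (p * p') (q * q') (v * v')"
  have "tsum (\<lambda>u v. tsum (\<lambda>p q. C p q v) (Delta_ext u)) (Delta_ext (t * t')) =
    tsum (\<lambda>u v. tsum (\<lambda>u' v'. tsum (\<lambda>p q. C p q (v * v')) (Delta_ext (u * u'))) (Delta_ext t')) (Delta_ext t)"
    by (rule Delta_ext_mult) (auto intro!: bilI lin_intros)
  also have "\<dots> = tsum (\<lambda>u v. tsum (\<lambda>u' v'. tsum (\<lambda>p q. tsum (\<lambda>p' q'. ?F p p' q q' v v') (Delta_ext u')) (Delta_ext u)) (Delta_ext t')) (Delta_ext t)"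
    by (intro tsum_cong[OF set_Delta_ext] Delta_ext_mult) (auto intro!: bilI lin_intros)
  \<comment> \<open>Exchanging the sums puts those for \<open>t'\<close> innermost, where its
    hypothesis applies with the legs of \<open>t\<close> held fixed; the hypothesis for
    \<open>t\<close> follows.\<close>
  also have "\<dots> = tsum (\<lambda>u v. tsum (\<lambda>p q. tsum (\<lambda>u' v'. tsum (\<lambda>p' q'. ?F p p' q q' v v') (Delta_ext u')) (Delta_ext t')) (Delta_ext u)) (Delta_ext t)"
    by (subst tsum_swap) simp
  also have "\<dots> = tsum (\<lambda>u v. tsum (\<lambda>p q. tsum (\<lambda>u' v'. tsum (\<lambda>p' q'. ?F p u' q p' v q') (Delta_ext v')) (Delta_ext t')) (Delta_ext u)) (Delta_ext t)"
    by (intro tsum_cong[OF set_Delta_ext] mult.IH(2)) (auto intro!: triI lin_intros T.lin_mult_left)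
  also have "\<dots> = tsum (\<lambda>u v. tsum (\<lambda>p q. tsum (\<lambda>u' v'. tsum (\<lambda>p' q'. ?F u u' p p' q q') (Delta_ext v')) (Delta_ext t')) (Delta_ext v)) (Delta_ext t)"
    by (rule mult.IH(1)) (auto intro!: triI lin_intros)
  also have "\<dots> = tsum (\<lambda>u v. tsum (\<lambda>u' v'. tsum (\<lambda>p q. tsum (\<lambda>p' q'. ?F u u' p p' q q') (Delta_ext v')) (Delta_ext v)) (Delta_ext t')) (Delta_ext t)"
    by (subst tsum_swap) simp
  also have "\<dots> = tsum (\<lambda>u v. tsum (\<lambda>u' v'. tsum (\<lambda>p q. C (u * u') p q) (Delta_ext (v * v'))) (Delta_ext t')) (Delta_ext t)"
    by (intro tsum_cong[OF set_Delta_ext] Delta_ext_mult[symmetric]) (auto intro!: bilI lin_intros)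
  also have "\<dots> = tsum (\<lambda>u v. tsum (\<lambda>p q. C u p q) (Delta_ext v)) (Delta_ext (t * t'))"
    by (rule Delta_ext_mult[symmetric]) (auto intro!: bilI lin_intros)
  finally show ?case .
qed

section \<open>Counit and antipode of T\<close>

definition eps :: "'t \<Rightarrow> 'f" where "eps t = \<epsilon>R (coef t 0)"

lemma eps_R [simp]: "r \<in> R \<Longrightarrow> eps r = \<epsilon>R r" and eps_x [simp]: "eps x = 0"
  and eps_add [simp]: "s \<in> T \<Longrightarrow> t \<in> T \<Longrightarrow> eps (s + t) = eps s + eps t"
  by (simp_all add: eps_def)

text \<open>Only left multiplication by \<open>x\<close> is not formal: the constant coefficient of
  x t is \<delta> of that of t, and \<epsilon> kills it by \<open>eps_delta\<close>.\<close>

lemma eps_mult [simp]: "s \<in> T \<Longrightarrow> t \<in> T \<Longrightarrow> eps (s * t) = eps s * eps t"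
proof (induction s arbitrary: t rule: T_induct)
  case x
  then show ?case by (simp add: eps_def coef_x_mult)
qed (simp_all add: eps_def distrib_right mult.assoc)

lemma lin_eps: "lin \<iota> T (\<lambda>t. \<iota> (eps t))"
  by (simp add: lin_def)

lemmas lin_eps_comp [lin_intros] = lin_comp[OF lin_eps]

lemma Delta_ext_counit:
  assumes "t \<in> T"
  shows "tsum (\<lambda>u v. \<iota> (eps u) * v) (Delta_ext t) = t \<and> tsum (\<lambda>u v. u * \<iota> (eps v)) (Delta_ext t) = t"
proof -
  let ?L = "\<lambda>u v. \<iota> (eps u) * v" and ?R = "\<lambda>u v. \<iota> (eps v) * u"
  have bil: "bil \<iota> T ?L" "bil \<iota> T ?R"
    by (auto intro!: bilI lin_intros T.lin_mult_left)
  have "tsum ?L (Delta_ext t) = t \<and> tsum ?R (Delta_ext t) = t"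
    using assms
  proof (induction t rule: T_induct)
    case (R r)
    then show ?case
      using HR.counit_left[OF lin_id R] HR.counit_right[OF lin_id R]
      by (simp add: Delta_ext_R bil mem cong: tsum_cong_set)
  next
    case x
    then show ?case
      using eps_w_left[OF lin_id] eps_w_right[OF lin_id]
      by (simp add: Delta_ext_x bil tsum_X mem cong: tsum_cong_set)
  next
    case (add p q)
    then show ?case using lin_Delta_ext[OF bil(1)] lin_Delta_ext[OF bil(2)] by (simp add: lin_def)
  next
    case (mult p q)
    note [simp] = mult(1,2)
    have c: "\<iota> (eps u) * \<iota> (eps u') * (v * v') = \<iota> (eps u) * v * (\<iota> (eps u') * v')" if "v \<in> T" for u u' v v'
      using T.central[OF that] by (metis mult.assoc)
    have "tsum ?L (Delta_ext (p * q)) = tsum (\<lambda>u v. tsum (\<lambda>u' v'. ?L u v * ?L u' v') (Delta_ext q)) (Delta_ext p)"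
      unfolding Delta_ext_mult[OF mult(1,2) bil(1)] by (intro tsum_cong[OF set_Delta_ext]) (simp_all add: c)
    moreover have "tsum ?R (Delta_ext (p * q)) = tsum (\<lambda>u v. tsum (\<lambda>u' v'. ?R u v * ?R u' v') (Delta_ext q)) (Delta_ext p)"
      unfolding Delta_ext_mult[OF mult(1,2) bil(2)] by (intro tsum_cong[OF set_Delta_ext]) (simp_all add: c)
    ultimately show ?case using mult(3,4) by (simp add: tsum_mult_left tsum_mult_right)
  qed
  moreover have "tsum (\<lambda>u v. u * \<iota> (eps v)) (Delta_ext t) = tsum ?R (Delta_ext t)"
    by (rule tsum_cong[OF set_Delta_ext[OF assms]]) (rule T.central)
  ultimately show ?thesis by simp
qed

text \<open>Powers of \<open>y\<close> stand on the left because an antihomomorphism sends r x^i to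
  y^i S(r).\<close>

definition S_ext :: "'t \<Rightarrow> 't" where
  "S_ext t = (\<Sum>i<deg t. y ^ i * SR (coef t i))"

lemma S_0 [simp]: "SR 0 = 0"
  by (rule R.lin_0[OF HR.lin_S])

lemma S_ext_eq:
  assumes "t \<in> T" "\<forall>i\<ge>n. coef t i = 0"
  shows "S_ext t = (\<Sum>i<n. y ^ i * SR (coef t i))"
proof -
  have "S_ext t = (\<Sum>i<max (deg t) n. y ^ i * SR (coef t i))"
    unfolding S_ext_def using assms(1) by (intro sum.mono_neutral_left) (auto simp: coef_deg)
  also have "\<dots> = (\<Sum>i<n. y ^ i * SR (coef t i))"
    using assms(2) by (intro sum.mono_neutral_right) auto
  finally show ?thesis .
qed

lemma S_ext_closed [simp]: "t \<in> T \<Longrightarrow> S_ext t \<in> T"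
  unfolding S_ext_def by (auto intro!: T.closed_sum)

lemma lin_S_ext: "lin \<iota> T S_ext"
proof -
  have "S_ext (s + t) = S_ext s + S_ext t" if [simp]: "s \<in> T" "t \<in> T" for s t
  proof -
    let ?n = "max (deg s) (deg t)"
    have "S_ext u = (\<Sum>i<?n. y ^ i * SR (coef u i))" if "u \<in> {s, t, s + t}" for u
      using that by (intro S_ext_eq) (auto simp: coef_deg)
    then show ?thesis using HR.lin_S by (simp add: sum.distrib lin_def distrib_left)
  qed
  moreover have "S_ext (\<iota> c * t) = \<iota> c * S_ext t" if [simp]: "t \<in> T" for c t
  proof -
    have "S_ext (\<iota> c * t) = (\<Sum>i<deg t. y ^ i * SR (\<iota> c * coef t i))"
      by (subst S_ext_eq[of _ "deg t"]) (auto simp: coef_deg)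
    also have "\<dots> = (\<Sum>i<deg t. \<iota> c * (y ^ i * SR (coef t i)))"
    proof (rule sum.cong[OF refl])
      fix i
      show "y ^ i * SR (\<iota> c * coef t i) = \<iota> c * (y ^ i * SR (coef t i))"
        using HR.lin_S T.central[of "y ^ i" c] by (simp add: lin_def mult.assoc[symmetric])
    qed
    finally show ?thesis by (simp add: S_ext_def sum_distrib_left)
  qed
  ultimately show ?thesis by (simp add: lin_def)
qed

lemmas lin_S_ext_comp [lin_intros] = lin_comp[OF lin_S_ext]

lemma S_ext_add: "s \<in> T \<Longrightarrow> t \<in> T \<Longrightarrow> S_ext (s + t) = S_ext s + S_ext t"
  using lin_S_ext by (simp add: lin_def)

lemma S_ext_monom:
  assumes "r \<in> R"
  shows "S_ext (r * x ^ k) = y ^ k * SR r"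
  using assms by (subst S_ext_eq[of _ "Suc k"]) auto

lemma S_ext_R [simp]: "r \<in> R \<Longrightarrow> S_ext r = SR r" and S_ext_x [simp]: "S_ext x = y"
  using S_ext_monom[of r 0] S_ext_monom[of 1 1] by simp_all

text \<open>The decisive case is x times s x^k, whose image y^(k+1) S(\<sigma>(s)) + y^k
  S(\<delta>(s)) equals y^k S(s) y by \<open>antipode_relation\<close>.\<close>

lemma S_ext_mult:
  assumes "p \<in> T" "q \<in> T"
  shows "S_ext (p * q) = S_ext q * S_ext p"
  using assms
proof (induction p arbitrary: q rule: T_induct)
  case (R r)
  from R(2) show ?case
  proof (induction q rule: T_induct_monom)
    case (monom s k)
    have "S_ext (r * (s * x ^ k)) = y ^ k * SR (r * s)"
      using S_ext_monom[of "r * s" k] monom R(1) by (simp add: mult.assoc)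
    then show ?case using monom R(1) by (simp add: S_ext_monom HR.S_mult mult.assoc)
  next
    case (add p q)
    then show ?case using R(1) by (simp add: S_ext_add distrib_left distrib_right)
  qed
next
  case x
  then show ?case
  proof (induction q rule: T_induct_monom)
    case (monom s k)
    have "x * (s * x ^ k) = \<sigma> s * x ^ Suc k + \<delta> s * x ^ k" using monom by (simp add: x_commute')
    then have "S_ext (x * (s * x ^ k)) = y ^ Suc k * SR (\<sigma> s) + y ^ k * SR (\<delta> s)"
      using monom by (simp add: S_ext_add S_ext_monom del: power_Suc)
    also have "\<dots> = y ^ k * (SR s * y)"
      unfolding antipode_relation[OF monom] by (simp add: distrib_left mult.assoc power_Suc2 del: power_Suc)
    finally show ?case using monom by (simp add: S_ext_monom mult.assoc)
  next
    case (add p q)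
    then show ?case by (simp add: S_ext_add distrib_left distrib_right)
  qed
next
  case (add p p')
  then show ?case by (simp add: S_ext_add distrib_left distrib_right)
next
  case (mult p p')
  then show ?case by (simp add: mult.assoc)
qed

text \<open>As \<open>S_ext\<close> reverses products, the law for one factor sits inside that for
  the other and comes out as a central scalar. At \<open>x\<close> the right law is
  \<open>a_y\<close>; the left law is where \<open>S_w\<close> enters.\<close>

lemma Delta_ext_antipode:
  assumes "t \<in> T"
  shows "tsum (\<lambda>u v. S_ext u * v) (Delta_ext t) = \<iota> (eps t) \<and> tsum (\<lambda>u v. u * S_ext v) (Delta_ext t) = \<iota> (eps t)"
  using assms
proof -
  let ?L = "\<lambda>u v. S_ext u * v" and ?R = "\<lambda>u v. u * S_ext v"
  have bil: "bil \<iota> T ?L" "bil \<iota> T ?R"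
    by (auto intro!: bilI lin_intros T.lin_mult_left)
  show ?thesis
    using assms
  proof (induction t rule: T_induct)
    case (R r)
    then show ?case
      using HR.antipode[OF R] by (simp add: Delta_ext_R bil mem cong: tsum_cong_set)
  next
    case x
    have "SR a * x + y + uinv R a * W = 0" by (simp add: y_def uinv_a distrib_left)
    then show ?case
      using S_w a_y by (simp add: Delta_ext_x bil tsum_X mem W_def cong: tsum_cong_set)
  next
    case (add p q)
    then show ?case using lin_Delta_ext[OF bil(1)] lin_Delta_ext[OF bil(2)] by (simp add: lin_def)
  next
    case (mult p q)
    note [simp] = mult(1,2)
    have "tsum ?L (Delta_ext (p * q)) = tsum (\<lambda>u v. tsum (\<lambda>u' v'. S_ext u' * (S_ext u * v) * v') (Delta_ext q)) (Delta_ext p)"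
      unfolding Delta_ext_mult[OF mult(1,2) bil(1)] by (intro tsum_cong[OF set_Delta_ext]) (simp_all add: S_ext_mult mult.assoc)
    also have "\<dots> = tsum (\<lambda>u' v'. S_ext u' * tsum ?L (Delta_ext p) * v') (Delta_ext q)"
      by (subst tsum_swap) (simp add: tsum_mult_left tsum_mult_right)
    also have "\<dots> = tsum (\<lambda>u' v'. \<iota> (eps p) * ?L u' v') (Delta_ext q)"
    proof (rule tsum_cong[OF set_Delta_ext])
      fix u' v' assume "u' \<in> T" "v' \<in> T"
      then show "S_ext u' * tsum ?L (Delta_ext p) * v' = \<iota> (eps p) * ?L u' v'"
        using mult(3) T.central[of "S_ext u'" "eps p"] by (simp add: mult.assoc[symmetric])
    qed simp
    finally have 1: "tsum ?L (Delta_ext (p * q)) = \<iota> (eps (p * q))"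
      using mult(4) by (simp add: tsum_mult_left)
    have "tsum ?R (Delta_ext (p * q)) = tsum (\<lambda>u v. tsum (\<lambda>u' v'. u * (u' * S_ext v') * S_ext v) (Delta_ext q)) (Delta_ext p)"
      unfolding Delta_ext_mult[OF mult(1,2) bil(2)] by (intro tsum_cong[OF set_Delta_ext]) (simp_all add: S_ext_mult mult.assoc)
    also have "\<dots> = tsum (\<lambda>u v. u * tsum ?R (Delta_ext q) * S_ext v) (Delta_ext p)"
      by (simp add: tsum_mult_left tsum_mult_right)
    also have "\<dots> = tsum (\<lambda>u v. \<iota> (eps q) * ?R u v) (Delta_ext p)"
    proof (rule tsum_cong[OF set_Delta_ext])
      fix u v assume "u \<in> T" "v \<in> T"
      then show "u * tsum ?R (Delta_ext q) * S_ext v = \<iota> (eps q) * ?R u v"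
        using mult(4) T.central[of u "eps q"] by (simp add: mult.assoc[symmetric])
    qed simp
    finally have "tsum ?R (Delta_ext (p * q)) = \<iota> (eps (p * q))"
      using mult(3) by (simp add: tsum_mult_left mult.commute flip: T.iota_hom(3))
    with 1 show ?case by blast
  qed
qed

text \<open>Injectivity: \<open>y\<close> is linear with unit leading coefficient, so its powers are
  independent with coefficients on the right, and \<open>SR\<close> is injective. Surjectivity: the
  image of an antihomomorphism is closed under sums and products, so reaching \<open>R\<close> and
  \<open>x\<close> is enough.\<close>

lemma S_ext_bij: "bij_betw S_ext T T"
  unfolding bij_betw_def
proof
  have y: "y = - SR a * x + - (SR a * W)" by (simp add: y_def distrib_left)
  have unit: "is_unit_in R (- SR a)"
    unfolding is_unit_in_def by (intro conjI bexI[of _ "- a"]) auto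
  have zero: "t = 0" if [simp]: "t \<in> T" and "S_ext t = 0" for t
  proof -
    have top: "\<And>i. i > n \<Longrightarrow> coef (y ^ n * r) i = 0" "coef (y ^ n * r) n = 0 \<Longrightarrow> r = 0" if "r \<in> R" for n r
      unfolding y using coef_linear_power_right[OF unit _ that, of "- (SR a * W)" n] by simp_all
    have "\<forall>i<deg t. coef t i = 0"
    proof (rule triangular_independent[of "\<lambda>i. y ^ i * SR (coef t i)"])
      show "(\<Sum>i<deg t. y ^ i * SR (coef t i)) = 0" using that by (simp add: S_ext_def)
      show "coef t n = 0" if "coef (y ^ n * SR (coef t n)) n = 0" for n
        using that top(2)[of "SR (coef t n)" n] HR.S_inj[of "coef t n" 0] by simp
    qed (simp_all add: top(1))
    then have "(\<Sum>i<deg t. coef t i * x ^ i) = 0" by simp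
    then show ?thesis unfolding expansion_deg[OF \<open>t \<in> T\<close>, symmetric] .
  qed
  show "inj_on S_ext T"
  proof (rule inj_onI)
    fix s t assume [simp]: "s \<in> T" "t \<in> T" and "S_ext s = S_ext t"
    then have "S_ext (s - t) = 0" using S_ext_add[of "s - t" t] by simp
    then show "s = t" using zero[of "s - t"] by simp
  qed
  have surj_R: "\<exists>s\<in>R. SR s = r" if "r \<in> R" for r
    using HR.hopf that unfolding hopf_def bij_betw_def by (metis imageE)
  have "t \<in> S_ext ` T" if "t \<in> T" for t
    using that
  proof (induction t rule: T_induct)
    case (R r)
    then obtain s where "s \<in> R" "SR s = r" using surj_R by blast
    then show ?case by (auto intro!: image_eqI[of _ _ s])
  next
    case x
    \<comment> \<open>The preimages are chosen so that \<open>x * s - s'\<close> goes to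
      \<open>SR s * y - SR s'\<close>, that is -(a y) - W, which is \<open>x\<close> by
      \<open>a_y\<close>.\<close>
    obtain s s' where s: "s \<in> R" "SR s = - a" "s' \<in> R" "SR s' = W" using surj_R[of "- a"] surj_R[of W] by auto
    have "S_ext (x * s - s') + S_ext s' = S_ext (x * s)" using S_ext_add[of "x * s - s'" s'] s by simp
    also have "S_ext (x * s) = - (a * y)" using s by (simp add: S_ext_mult)
    also have "\<dots> = x + W" using a_y by (simp add: add.assoc neg_eq_iff_add_eq_0)
    finally have "x = S_ext (x * s - s')" using s by simp
    then show ?case using s by (intro image_eqI[of _ _ "x * s - s'"]) auto
  next
    case (add p q)
    then show ?case by (auto simp: S_ext_add[symmetric] intro!: imageI)
  next
    case (mult p q)
    then show ?case by (auto simp: S_ext_mult[symmetric] intro!: imageI)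
  qed
  then show "S_ext ` T = T" by auto
qed

lemma hopf_T: "hopf \<iota> T Delta_ext eps S_ext"
  unfolding hopf_def
proof (intro conjI ballI allI)
  fix c s t assume [simp]: "s \<in> T" "t \<in> T"
  show "teq \<iota> T (Delta_ext (s + t)) (Delta_ext s @ Delta_ext t)"
    using lin_Delta_ext by (simp add: T.teq_iff_bil lin_def)
  show "teq \<iota> T (Delta_ext (s * t)) (tmul (Delta_ext s) (Delta_ext t))"
    by (simp add: T.teq_iff_bil Delta_ext_mult)
  show "S_ext (s + t) = S_ext s + S_ext t" by (simp add: S_ext_add)
next
  fix c t assume [simp]: "t \<in> T"
  have "tsum B (Delta_ext (\<iota> c * t)) = tsum (\<lambda>u v. B (\<iota> c * u) v) (Delta_ext t)" if B: "bil \<iota> T B" for B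
  proof -
    have "tsum B (Delta_ext (\<iota> c * t)) = tsum (\<lambda>u v. \<iota> c * B u v) (Delta_ext t)"
      using lin_Delta_ext[OF B] by (simp add: lin_def tsum_mult_left)
    also have "\<dots> = tsum (\<lambda>u v. B (\<iota> c * u) v) (Delta_ext t)"
      by (rule tsum_cong[OF set_Delta_ext]) (use B in \<open>auto simp: bil_def lin_def\<close>)
    finally show ?thesis .
  qed
  then show "teq \<iota> T (Delta_ext (\<iota> c * t)) (tscale (\<iota> c) (Delta_ext t))"
    by (simp add: T.teq_iff_bil)
  show "eps (\<iota> c * t) = c * eps t" by simp
  show "S_ext (\<iota> c * t) = \<iota> c * S_ext t" using lin_S_ext \<open>t \<in> T\<close> unfolding lin_def by blast
next
  show "teq \<iota> T (Delta_ext 1) [(1, 1)]"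
    by (simp add: T.teq_iff_bil Delta_ext_R HR.tsum_Delta_1 bil_mono[OF _ R_T])
next
  fix t assume "t \<in> T"
  then show "teq3 \<iota> T (DeltaId Delta_ext (Delta_ext t)) (IdDelta Delta_ext (Delta_ext t))"
    by (simp add: T.teq3_iff_tri Delta_ext_coassoc)
qed (use T.falg S_ext_bij Delta_ext_counit Delta_ext_antipode in auto)

lemma hoe_T: "hoe \<iota> R \<Delta>R \<epsilon>R SR T Delta_ext eps S_ext x \<sigma> \<delta> a 1 [] w"
  unfolding hoe_def
  using HR.hopf hopf_T R_T ore set_w
  by (auto simp: T.teq_iff_bil Delta_ext_R Delta_ext_x X_def tmul_def)

end

theorem theorem2p4:
  fixes \<iota> :: "'f::field \<Rightarrow> 't::ring_1"
  shows
  "(\<forall>R \<Delta>R \<epsilon>R SR T \<Delta> \<epsilon> S x \<sigma> \<delta> a b v w \<alpha> \<beta>.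
      hoe \<iota> R \<Delta>R \<epsilon>R SR T \<Delta> \<epsilon> S x \<sigma> \<delta> a b v w \<and>
      \<alpha> \<in> R \<and> \<beta> \<in> R \<and> is_unit_in R \<alpha> \<and> S x = \<alpha> * x + \<beta> \<longrightarrow>
        (grouplike \<iota> R \<Delta>R a \<and> grouplike \<iota> R \<Delta>R b \<and> teq \<iota> R v []) \<and>
        (\<exists>x' \<sigma>' \<delta>' a' w'. ore_ext \<iota> R T x' \<sigma>' \<delta>' \<and> a' \<in> R \<and> set w' \<subseteq> R \<times> R \<and>
           \<epsilon> x' = 0 \<and> teq \<iota> T (\<Delta> x') ([(a', x'), (x', 1)] @ w')))
   \<and>
   (\<forall>R \<Delta>R \<epsilon>R SR T \<Delta> \<epsilon> S x \<sigma> \<delta> a w \<alpha> \<beta>.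
      hoe \<iota> R \<Delta>R \<epsilon>R SR T \<Delta> \<epsilon> S x \<sigma> \<delta> a 1 [] w \<and>
      \<alpha> \<in> R \<and> \<beta> \<in> R \<and> is_unit_in R \<alpha> \<and> S x = \<alpha> * x + \<beta> \<and> \<epsilon> x = 0 \<longrightarrow>
        S x = - (uinv R a * (x + tsum (\<lambda>u v. u * S v) w)) \<and>
        (\<exists>\<chi>. character \<iota> R \<chi> \<and>
           (\<forall>r\<in>R. \<sigma> r = tsum (\<lambda>u v. \<iota> (\<chi> u) * v) (\<Delta>R r) \<and>
                   \<sigma> r = tsum (\<lambda>u v. a * u * uinv R a * \<iota> (\<chi> v)) (\<Delta>R r))) \<and>
        (\<forall>r\<in>R. teq \<iota> R
            (\<Delta>R (\<delta> r) @ tneg (map (\<lambda>(u, v). (\<delta> u, v)) (\<Delta>R r))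
                        @ tneg (map (\<lambda>(u, v). (a * u, \<delta> v)) (\<Delta>R r)))
            (tmul w (\<Delta>R r) @ tneg (tmul (\<Delta>R (\<sigma> r)) w))) \<and>
        (\<exists>ws. set ws \<subseteq> augideal R \<epsilon>R \<times> augideal R \<epsilon>R \<and> teq \<iota> R w ws) \<and>
        tsum (\<lambda>u v. SR u * v) w = uinv R a * tsum (\<lambda>u v. u * SR v) w \<and>
        teq3 \<iota> R (map (\<lambda>(u, v). (u, v, 1)) w @ DeltaId \<Delta>R w)
                  (map (\<lambda>(u, v). (a, u, v)) w @ IdDelta \<Delta>R w))
   \<and>
   (\<forall>R \<Delta>R \<epsilon>R SR a w \<sigma> \<delta>.
      hopf \<iota> R \<Delta>R \<epsilon>R SR \<and> grouplike \<iota> R \<Delta>R a \<and> set w \<subseteq> R \<times> R \<and>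
      alg_aut \<iota> R \<sigma> \<and> sigma_deriv \<iota> R \<sigma> \<delta> \<and>
      (\<exists>\<chi>. character \<iota> R \<chi> \<and>
         (\<forall>r\<in>R. \<sigma> r = tsum (\<lambda>u v. \<iota> (\<chi> u) * v) (\<Delta>R r) \<and>
                 \<sigma> r = tsum (\<lambda>u v. a * u * uinv R a * \<iota> (\<chi> v)) (\<Delta>R r))) \<and>
      (\<forall>r\<in>R. teq \<iota> R
          (\<Delta>R (\<delta> r) @ tneg (map (\<lambda>(u, v). (\<delta> u, v)) (\<Delta>R r))
                      @ tneg (map (\<lambda>(u, v). (a * u, \<delta> v)) (\<Delta>R r)))
          (tmul w (\<Delta>R r) @ tneg (tmul (\<Delta>R (\<sigma> r)) w))) \<and>
      (\<exists>ws. set ws \<subseteq> augideal R \<epsilon>R \<times> augideal R \<epsilon>R \<and> teq \<iota> R w ws) \<and>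
      tsum (\<lambda>u v. SR u * v) w = uinv R a * tsum (\<lambda>u v. u * SR v) w \<and>
      teq3 \<iota> R (map (\<lambda>(u, v). (u, v, 1)) w @ DeltaId \<Delta>R w)
                (map (\<lambda>(u, v). (a, u, v)) w @ IdDelta \<Delta>R w)
      \<longrightarrow>
      (\<forall>T x. ore_ext \<iota> R T x \<sigma> \<delta> \<longrightarrow>
         (\<exists>\<Delta> \<epsilon> S. hoe \<iota> R \<Delta>R \<epsilon>R SR T \<Delta> \<epsilon> S x \<sigma> \<delta> a 1 [] w \<and> \<epsilon> x = 0 \<and>
             S x = - (uinv R a * (x + tsum (\<lambda>u v. u * SR v) w)))))"
\<comment> \<open>The pattern lets \<open>conjI\<close> split only conjunctions whose first member
  begins with two quantifiers, so the three parts separate while the conjunctions inside them stay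
  whole.\<close>
proof (intro conjI[of "\<forall>R \<Delta>R. _ R \<Delta>R"] allI impI)
  fix R :: "'t set" and \<Delta>R \<epsilon>R SR T \<Delta> \<epsilon> S x \<sigma> \<delta> a b v w \<alpha> \<beta>
  assume *: "hoe \<iota> R \<Delta>R \<epsilon>R SR T \<Delta> \<epsilon> S x \<sigma> \<delta> a b v w \<and>
      \<alpha> \<in> R \<and> \<beta> \<in> R \<and> is_unit_in R \<alpha> \<and> S x = \<alpha> * x + \<beta>"
  interpret hopf_ore_extension_linear \<iota> R \<Delta>R \<epsilon>R SR T \<Delta> \<epsilon> S x \<sigma> \<delta> a b v w \<alpha> \<beta>
    using * by unfold_locales auto
  show "(grouplike \<iota> R \<Delta>R a \<and> grouplike \<iota> R \<Delta>R b \<and> teq \<iota> R v []) \<and>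
        (\<exists>x' \<sigma>' \<delta>' a' w'. ore_ext \<iota> R T x' \<sigma>' \<delta>' \<and> a' \<in> R \<and> set w' \<subseteq> R \<times> R \<and>
           \<epsilon> x' = 0 \<and> teq \<iota> T (\<Delta> x') ([(a', x'), (x', 1)] @ w'))"
    using grouplike_a grouplike_b v_eq_0 normalize by (intro conjI)
next
  fix R :: "'t set" and \<Delta>R \<epsilon>R SR T \<Delta> \<epsilon> S x \<sigma> \<delta> a w \<alpha> \<beta>
  assume *: "hoe \<iota> R \<Delta>R \<epsilon>R SR T \<Delta> \<epsilon> S x \<sigma> \<delta> a 1 [] w \<and>
      \<alpha> \<in> R \<and> \<beta> \<in> R \<and> is_unit_in R \<alpha> \<and> S x = \<alpha> * x + \<beta> \<and> \<epsilon> x = 0"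
  interpret normalized_hopf_ore_extension \<iota> R \<Delta>R \<epsilon>R SR T \<Delta> \<epsilon> S x \<sigma> \<delta> a w \<alpha> \<beta>
    using * by unfold_locales auto
  show "S x = - (uinv R a * (x + tsum (\<lambda>u v. u * S v) w)) \<and>
        (\<exists>\<chi>. character \<iota> R \<chi> \<and>
           (\<forall>r\<in>R. \<sigma> r = tsum (\<lambda>u v. \<iota> (\<chi> u) * v) (\<Delta>R r) \<and>
                   \<sigma> r = tsum (\<lambda>u v. a * u * uinv R a * \<iota> (\<chi> v)) (\<Delta>R r))) \<and>
        (\<forall>r\<in>R. teq \<iota> R
            (\<Delta>R (\<delta> r) @ tneg (map (\<lambda>(u, v). (\<delta> u, v)) (\<Delta>R r))
                        @ tneg (map (\<lambda>(u, v). (a * u, \<delta> v)) (\<Delta>R r)))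
            (tmul w (\<Delta>R r) @ tneg (tmul (\<Delta>R (\<sigma> r)) w))) \<and>
        (\<exists>ws. set ws \<subseteq> augideal R \<epsilon>R \<times> augideal R \<epsilon>R \<and> teq \<iota> R w ws) \<and>
        tsum (\<lambda>u v. SR u * v) w = uinv R a * tsum (\<lambda>u v. u * SR v) w \<and>
        teq3 \<iota> R (map (\<lambda>(u, v). (u, v, 1)) w @ DeltaId \<Delta>R w)
                  (map (\<lambda>(u, v). (a, u, v)) w @ IdDelta \<Delta>R w)"
    by (intro conjI ballI S_x_formula winding Delta_delta_teq w_augmentation S_w w_cocycle)
next
  fix R :: "'t set" and \<Delta>R \<epsilon>R SR a w \<sigma> \<delta> T x
  assume *: "hopf \<iota> R \<Delta>R \<epsilon>R SR \<and> grouplike \<iota> R \<Delta>R a \<and> set w \<subseteq> R \<times> R \<and>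
      alg_aut \<iota> R \<sigma> \<and> sigma_deriv \<iota> R \<sigma> \<delta> \<and>
      (\<exists>\<chi>. character \<iota> R \<chi> \<and>
         (\<forall>r\<in>R. \<sigma> r = tsum (\<lambda>u v. \<iota> (\<chi> u) * v) (\<Delta>R r) \<and>
                 \<sigma> r = tsum (\<lambda>u v. a * u * uinv R a * \<iota> (\<chi> v)) (\<Delta>R r))) \<and>
      (\<forall>r\<in>R. teq \<iota> R
          (\<Delta>R (\<delta> r) @ tneg (map (\<lambda>(u, v). (\<delta> u, v)) (\<Delta>R r))
                      @ tneg (map (\<lambda>(u, v). (a * u, \<delta> v)) (\<Delta>R r)))
          (tmul w (\<Delta>R r) @ tneg (tmul (\<Delta>R (\<sigma> r)) w))) \<and>
      (\<exists>ws. set ws \<subseteq> augideal R \<epsilon>R \<times> augideal R \<epsilon>R \<and> teq \<iota> R w ws) \<and>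
      tsum (\<lambda>u v. SR u * v) w = uinv R a * tsum (\<lambda>u v. u * SR v) w \<and>
      teq3 \<iota> R (map (\<lambda>(u, v). (u, v, 1)) w @ DeltaId \<Delta>R w)
                (map (\<lambda>(u, v). (a, u, v)) w @ IdDelta \<Delta>R w)"
    and ore: "ore_ext \<iota> R T x \<sigma> \<delta>"
  from * obtain \<chi> where \<chi>: "character \<iota> R \<chi>"
    "\<And>r. r \<in> R \<Longrightarrow> \<sigma> r = tsum (\<lambda>u v. \<iota> (\<chi> u) * v) (\<Delta>R r)"
    "\<And>r. r \<in> R \<Longrightarrow> \<sigma> r = tsum (\<lambda>u v. a * u * uinv R a * \<iota> (\<chi> v)) (\<Delta>R r)"
    by metis
  interpret hopf_ore_data \<iota> R T x \<sigma> \<delta> \<Delta>R \<epsilon>R SR a w \<chi>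
    by unfold_locales (use * ore \<chi> in \<open>blast+\<close>)
  have "S_ext x = - (uinv R a * (x + tsum (\<lambda>u v. u * SR v) w))"
    by (simp add: y_def W_def uinv_a)
  then show "\<exists>\<Delta> \<epsilon> S. hoe \<iota> R \<Delta>R \<epsilon>R SR T \<Delta> \<epsilon> S x \<sigma> \<delta> a 1 [] w \<and> \<epsilon> x = 0 \<and>
             S x = - (uinv R a * (x + tsum (\<lambda>u v. u * SR v) w))"
    using hoe_T eps_x by blast
qed

end
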